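(* Let $N,n\ge1$ be integers, $1\le p\le\infty$, $1\le q<\infty$. Let $f\in H^p(\mathbb B_N)$, and let $\psi\in L^1(0,1)$ be a non-negative function such that $$\psi(2x)\le K\psi(x),\quad 0<x<1/2,$$ where $K$ is a positive constant. Then $$\int_0^1M_p^q(r,\nabla_n(f))\,\psi(1-r)\,dr\le C\int_0^1\left[t^{-n}\|\Delta^n_tf\|_p\right]^q\psi(t)\,dt,$$ where $C$ depends only on $K,p,q,n$ and $N$.
   Context: $\mathbb B_N$ is the unit ball of $\mathbb C^N$, $\mathbb S_N=\partial\mathbb B_N$, $\sigma$ is the normalized Lebesgue measure on $\mathbb S_N$, and $H(\mathbb B_N)$ is the space of holomorphic functions on $\mathbb B_N$. For a Borel function $g$ on $\mathbb B_N$ and $0<r<1$, $M_p(r,g)=\left(\int_{\mathbb S_N}|g(r\zeta)|^p\,d\sigma(\zeta)\right)^{1/p}$ for $p<\infty$ and $M_\infty(r,g)=\operatorname{ess\,sup}_{\zeta\in\mathbb S_N}|g(r\zeta)|$; $M_p^q(r,g)=(M_p(r,g))^q$. $H^p(\mathbb B_N)$ is the space of $f\in H(\mathbb B_N)$ with $\|f\|_p:=\sup_{0<r<1}M_p(r,f)<\infty$. The $n$-th order gradient is $\nabla_n(f)(z)=\left(\sum_{j_1,\dots,j_n=1}^N|\partial_{j_1}\cdots\partial_{j_n}f(z)|^2\right)^{1/2}$, where $\partial_jf=\partial f/\partial z_j$. For $t\in\mathbb R$, $\Delta^1_tf(z)=f(e^{it}z)-f(z)$ and $\Delta^n_tf=\Delta^1_t(\Delta^{n-1}_tf)$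 for $n\ge2$. *)

theory Defs
  imports "HOL-Analysis.Analysis" "HOL-Probability.Essential_Supremum"
begin

text \<open>
  \<open>\<complex>\<^sup>N\<close> is \<^typ>\<open>complex ^ 'N\<close> with \<open>N = CARD('N)\<close>; its norm is the Euclidean one.

  The normalized Lebesgue measure on the unit sphere, obtained from Lebesgue measure on the
  unit ball by polar coordinates: \<open>\<sigma>(A) = vol {z \<in> B. z / \<parallel>z\<parallel> \<in> A} / vol B\<close>.
  The underlying space of the measure is the sphere itself, so that measurability of
  \<open>\<zeta> \<mapsto> g (r\<zeta>)\<close> only concerns the values of \<open>g\<close> inside the ball.
\<close>

definition sphere_measure :: "(complex ^ 'N) measure" where
  "sphere_measure = restrict_space
     (distr (uniform_measure lborel (ball 0 1)) borel (\<lambda>z. z /\<^sub>R norm z)) (sphere 0 1)"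

lemma space_sphere_measure: "space sphere_measure = sphere 0 1"
  by (simp add: sphere_measure_def space_restrict_space)

lemma sets_sphere_measure: "sets sphere_measure = sets (restrict_space borel (sphere 0 1))"
  unfolding sphere_measure_def by (rule sets_restrict_space_cong) simp

lemma emeasure_sphere_measure_space:
  "emeasure (sphere_measure :: (complex ^ 'N) measure) (sphere 0 1) = 1"
proof -
  let ?B = "ball 0 1 :: (complex ^ 'N) set" and ?S = "sphere 0 1 :: (complex ^ 'N) set"
  let ?f = "\<lambda>z :: complex ^ 'N. z /\<^sub>R norm z"
  have [measurable]: "?f \<in> borel_measurable borel" by measurable
  have vol: "unit_ball_vol (real DIM(complex ^ 'N)) > 0"
    by (rule unit_ball_vol_pos) simp
  have fin: "emeasure lborel ?B \<noteq> \<infinity>" "emeasure lborel ?B \<noteq> 0"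
    using emeasure_lborel_ball_finite[of "0 :: complex ^ 'N" 1] order_less_imp_not_eq2[OF vol]
    by (auto simp: emeasure_ball simp del: DIM_cart)
  have S: "?S \<in> sets borel" by simp
  have pre: "?f -` ?S = - {0}"
    by (auto simp: norm_zero)
  have "emeasure sphere_measure ?S = emeasure (distr (uniform_measure lborel ?B) borel ?f) ?S"
    unfolding sphere_measure_def by (rule emeasure_restrict_space) (use S in auto)
  also have "\<dots> = emeasure (uniform_measure lborel ?B) (- {0})"
    by (subst emeasure_distr) (use S pre in auto)
  also have "\<dots> = emeasure lborel (?B - {0}) / emeasure lborel ?B"
    by (subst emeasure_uniform_measure) (auto simp: Diff_eq)
  also have "emeasure lborel (?B - {0}) = emeasure lborel ?B"
    by (rule emeasure_Diff_null_set) auto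
  finally show ?thesis using fin by (simp add: ennreal_divide_self less_top)
qed

text \<open>Power of an extended non-negative real; used only with an exponent \<open>a > 0\<close>.\<close>

definition enn_powr :: "ennreal \<Rightarrow> real \<Rightarrow> ennreal" where
  "enn_powr x a = (if x = \<infinity> then \<infinity> else ennreal (enn2real x powr a))"

definition int_mean :: "ennreal \<Rightarrow> real \<Rightarrow> (complex ^ 'N \<Rightarrow> 'b::real_normed_vector) \<Rightarrow> ennreal" where
  "int_mean p r g =
     (if p = \<infinity> then esssup sphere_measure (\<lambda>\<zeta>. ennreal (norm (g (r *\<^sub>R \<zeta>))))
      else enn_powr (\<integral>\<^sup>+\<zeta>. ennreal (norm (g (r *\<^sub>R \<zeta>)) powr enn2real p) \<partial>sphere_measure)
             (1 / enn2real p))"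

text \<open>Holomorphy in several variables: complex Frechet differentiability, i.e. the real
  derivative exists and is complex-linear.\<close>

definition mv_holomorphic_on :: "(complex ^ 'N \<Rightarrow> complex) \<Rightarrow> (complex ^ 'N) set \<Rightarrow> bool" where
  "mv_holomorphic_on f S \<longleftrightarrow>
     (\<forall>z\<in>S. \<exists>D. (f has_derivative D) (at z within S) \<and> (\<forall>c v. D (c *s v) = c * D v))"

definition hardy_norm :: "ennreal \<Rightarrow> (complex ^ 'N \<Rightarrow> complex) \<Rightarrow> ennreal" where
  "hardy_norm p f = (SUP r\<in>{0<..<1}. int_mean p r f)"

definition hardy_space :: "ennreal \<Rightarrow> (complex ^ 'N \<Rightarrow> complex) set" where
  "hardy_space p = {f. mv_holomorphic_on f (ball 0 1) \<and> hardy_norm p f < \<infinity>}"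

definition partial_deriv :: "'N \<Rightarrow> (complex ^ 'N \<Rightarrow> complex) \<Rightarrow> (complex ^ 'N \<Rightarrow> complex)" where
  "partial_deriv j f = (\<lambda>z. deriv (\<lambda>w. f (z + axis j w)) 0)"

text \<open>A list \<open>[j\<^sub>1, \<dots>, j\<^sub>n]\<close> stands for \<open>\<partial>\<^bsub>j\<^sub>1\<^esub> \<cdots> \<partial>\<^bsub>j\<^sub>n\<^esub>\<close>.\<close>

definition nth_gradient :: "nat \<Rightarrow> (complex ^ 'N \<Rightarrow> complex) \<Rightarrow> complex ^ 'N \<Rightarrow> real" where
  "nth_gradient n f z =
     sqrt (\<Sum>js | length js = n. (cmod (foldr partial_deriv js f z))\<^sup>2)"

definition rot_diff :: "real \<Rightarrow> (complex ^ 'N \<Rightarrow> complex) \<Rightarrow> (complex ^ 'N \<Rightarrow> complex)" where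
  "rot_diff t f = (\<lambda>z. f (cis t *s z) - f z)"

definition rot_diff_iter :: "nat \<Rightarrow> real \<Rightarrow> (complex ^ 'N \<Rightarrow> complex) \<Rightarrow> (complex ^ 'N \<Rightarrow> complex)" where
  "rot_diff_iter n t f = (rot_diff t ^^ n) f"

end

theory Submission
  imports Defs "HOL-Complex_Analysis.Complex_Analysis" "HOL-Probability.Probability"
begin

text \<open>
  The differences \<open>\<Delta>\<^sub>t\<close> see \<open>f\<close> only along the circles \<open>t \<mapsto> e\<^sup>i\<^sup>t z\<close>, that is, through the radial
  derivative \<open>R f(z) = \<Sum>\<^sub>j z\<^sub>j \<partial>\<^sub>jf(z)\<close>, whereas \<open>\<nabla>\<^sub>n f\<close> contains all derivatives of order \<open>n\<close>. The proof
  passes from \<open>\<nabla>\<^sub>n f\<close> to \<open>R\<^sup>n f\<close> and from \<open>R\<^sup>n f\<close> to \<open>\<Delta>\<^sub>t\<^sup>n f\<close>; both steps are inequalities between integral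
  means in which the radius may move towards the boundary by a fixed proportion of its distance.

  From \<open>\<nabla>\<^sub>n\<close> to \<open>R\<^sup>n\<close> (\<open>mean_le_partials\<close>). Since \<open>\<partial>\<^sub>j R = (R + 1) \<partial>\<^sub>j\<close>, we have
  \<open>\<partial>\<^sub>jf(z) = \<integral>\<^sub>0\<^sup>1 \<partial>\<^sub>j(R f)(s z) ds\<close>, and the integrand can be estimated by Cauchy's formula for \<open>R f\<close> on discs
  about \<open>s z\<close>. In a general direction such a disc has radius at most \<open>1 - s\<bar>z\<bar>\<close>, and the resulting loss
  \<open>(1 - s\<bar>z\<bar>)\<^sup>-\<^sup>1\<close> integrates to a logarithm. In a direction orthogonal to \<open>z\<close> the disc may have radius
  comparable to the square root of \<open>1 - s\<bar>z\<bar>\<close>, and the loss is integrable; the direction of \<open>z\<close> itself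
  is covered by \<open>R f\<close>. To use this for means over the sphere, the displacement is made random:
  the orthogonal vector is the projection of a second uniformly distributed vector \<open>a\<close>. The law of
  the displaced point is then invariant under unitary maps, and an invariant law integrates a function
  as the uniform measures on spheres do (\<open>nn_integral_unitary_invariant_le\<close>).

  From \<open>R\<^sup>n\<close> to \<open>\<Delta>\<^sub>t\<^sup>n\<close> (\<open>radial_pow_absorption\<close>). Taylor's formula on circles compares \<open>\<Delta>\<^sub>s\<^sup>n f\<close> with
  \<open>(i s R)\<^sup>n f\<close> up to \<open>s\<^sup>n\<^sup>+\<^sup>1 R\<^sup>n\<^sup>+\<^sup>1 f\<close>, and Cauchy's formula bounds \<open>R\<^sup>n\<^sup>+\<^sup>1 f\<close> by \<open>R\<^sup>n f\<close>. Thus for every \<open>s > 0\<close>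
  the mean of \<open>R\<^sup>n f\<close> at radius \<open>r\<close> is at most \<open>C s\<^sup>-\<^sup>n \<parallel>\<Delta>\<^sub>s\<^sup>n f\<parallel>\<^sub>p\<close> plus \<open>C s / (1 - r)\<close> times its mean at radius
  \<open>(1 + r) / 2\<close>. Take \<open>s = \<kappa> (1 - r)\<close> with \<open>\<kappa> = 2\<^sup>-\<^sup>m\<close>, raise to the power \<open>q\<close> and integrate against
  \<open>\<psi>(1 - r)\<close>. By the doubling condition the second term becomes a multiple of the left-hand side, with
  a coefficient that is small with \<open>\<kappa>\<close>, and is absorbed (\<open>weighted_integral_shrunk_mean_le\<close>).
  As \<open>\<psi>\<close> can be compared with its dilates by powers of 2 only, \<open>\<kappa>\<close> has to be such a power, and only
  exact values \<open>\<parallel>\<Delta>\<^sub>t\<^sup>n f\<parallel>\<^sub>p\<close>, no averages over \<open>t\<close>, may occur. The left-hand side is finite if all radii are first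
  multiplied by some \<open>\<delta> < 1\<close>; at the end \<open>\<delta>\<close> tends to 1 by monotone convergence.
\<close>

unbundle no fps_syntax

section \<open>Unitary maps and the measure of the sphere\<close>

text \<open>
  By the Vitali covering theorem an open set is a disjoint union of balls up to a null set, and
  an isometry maps each ball to a ball of the same radius.
\<close>
lemma emeasure_open_le_orthogonal_image:
  fixes T :: "'a::euclidean_space \<Rightarrow> 'a"
  assumes T: "orthogonal_transformation T" and S: "open S"
  shows "emeasure lborel S \<le> emeasure lborel (T ` S)"
proof -
  define K where "K = {k. snd k > 0 \<and> ball (fst k) (snd k) \<subseteq> S}"
  obtain C where C: "countable C" "C \<subseteq> K"
    and disj: "pairwise (\<lambda>i j. disjnt (ball (fst i) (snd i)) (ball (fst j) (snd j))) C"
    and neg: "negligible (S - (\<Union>i\<in>C. ball (fst i) (snd i)))"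
  proof (rule Vitali_covering_theorem_balls[of S K fst snd])
    fix x and d :: real assume "x \<in> S" "0 < d"
    then obtain e where e: "e > 0" "ball x e \<subseteq> S" using S openE by blast
    have "(x, min e (d/2)) \<in> K" using e \<open>0 < d\<close> by (auto simp: K_def)
    then show "\<exists>i. i \<in> K \<and> x \<in> ball (fst i) (snd i) \<and> snd i < d"
      using e \<open>0 < d\<close> by (intro exI[of _ "(x, min e (d/2))"]) auto
  qed blast
  let ?B = "\<lambda>i::'a \<times> real. ball (fst i) (snd i)"
  have sub: "(\<Union>i\<in>C. ?B i) \<subseteq> S" using C by (auto simp: K_def)
  have opU: "open (\<Union>i\<in>C. ?B i)" by auto
  have TB: "T ` ?B i = ball (T (fst i)) (snd i)" for i
    using T by (simp add: image_orthogonal_transformation_ball)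
  have inj: "inj T" using T by (rule orthogonal_transformation_inj)
  have d1: "disjoint_family_on ?B C"
    using disj by (auto simp: disjoint_family_on_def pairwise_def disjnt_def)
  have d2: "disjoint_family_on (\<lambda>i. T ` ?B i) C"
    using d1 inj unfolding disjoint_family_on_def by (simp add: image_Int[symmetric])
  have openT: "open (T ` S)"
    using T S by (intro open_surjective_linear_image orthogonal_transformation_linear
        orthogonal_transformation_surj)
  have "emeasure lborel S = emeasure lborel (\<Union>i\<in>C. ?B i)"
  proof (rule emeasure_eq_AE)
    have "S - (\<Union>i\<in>C. ?B i) \<in> null_sets lebesgue"
      using neg by (simp add: negligible_iff_null_sets)
    moreover have "S - (\<Union>i\<in>C. ?B i) \<in> sets lborel"
      using S opU by (simp only: sets_lborel sets.Diff borel_open)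
    ultimately have "S - (\<Union>i\<in>C. ?B i) \<in> null_sets lborel"
      by (auto simp: null_sets_def)
    from AE_not_in[OF this] show "AE x in lborel. x \<in> S \<longleftrightarrow> x \<in> (\<Union>i\<in>C. ?B i)"
      by eventually_elim (use sub in blast)
    show "S \<in> sets lborel" unfolding sets_lborel by (rule borel_open[OF S])
    show "(\<Union>i\<in>C. ?B i) \<in> sets lborel" unfolding sets_lborel by (rule borel_open[OF opU])
  qed
  also have "\<dots> = (\<integral>\<^sup>+i. emeasure lborel (?B i) \<partial>count_space C)"
    using C(1) d1 by (intro emeasure_UN_countable) simp_all
  also have "\<dots> = (\<integral>\<^sup>+i. emeasure lborel (T ` ?B i) \<partial>count_space C)"
  proof (rule nn_integral_cong)
    fix i assume "i \<in> space (count_space C)"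
    then have "snd i > 0" using C(2) by (auto simp: K_def)
    then show "emeasure lborel (?B i) = emeasure lborel (T ` ?B i)"
      unfolding TB by (simp add: emeasure_ball)
  qed
  also have "\<dots> = emeasure lborel (\<Union>i\<in>C. T ` ?B i)"
    using C(1) d2 by (intro emeasure_UN_countable[symmetric]) (simp_all add: TB)
  also have "\<dots> \<le> emeasure lborel (T ` S)"
    using sub openT by (intro emeasure_mono) auto
  finally show ?thesis .
qed

text \<open>
  The previous inequality is applied to \<open>T\<close> and to its inverse.
\<close>
lemma lborel_distr_orthogonal:
  fixes T :: "'a::euclidean_space \<Rightarrow> 'a"
  assumes T: "orthogonal_transformation T"
  shows "distr lborel borel T = lborel"
proof (rule lborel_eqI[symmetric])
  have lin: "linear T" using T by (rule orthogonal_transformation_linear)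
  have bij: "bij T" using T by (rule orthogonal_transformation_bij)
  have Ti: "orthogonal_transformation (inv T)" using T by (rule orthogonal_transformation_inv)
  have [measurable]: "T \<in> borel_measurable borel"
    using lin by (intro borel_measurable_continuous_onI) (simp add: linear_continuous_on linear_linear)
  fix l u :: 'a assume lu: "\<And>b. b \<in> Basis \<Longrightarrow> l \<bullet> b \<le> u \<bullet> b"
  have im: "T -` box l u = inv T ` box l u" using bij by (simp add: bij_vimage_eq_inv_image)
  have op: "open (T -` box l u)"
  proof (rule open_vimage)
    show "continuous_on UNIV T" using lin by (simp add: linear_continuous_on linear_linear)
  qed (simp add: open_box)
  have eq: "T ` (T -` box l u) = box l u" using bij by (simp add: bij_is_surj surj_image_vimage_eq)
  have "emeasure (distr lborel borel T) (box l u) = emeasure lborel (T -` box l u)"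
    by (simp add: emeasure_distr)
  also have "\<dots> = emeasure lborel (box l u)"
  proof (rule antisym)
    show "emeasure lborel (T -` box l u) \<le> emeasure lborel (box l u)"
      using emeasure_open_le_orthogonal_image[OF T op] eq by simp
    show "emeasure lborel (box l u) \<le> emeasure lborel (T -` box l u)"
      unfolding im by (rule emeasure_open_le_orthogonal_image[OF Ti]) (rule open_box)
  qed
  finally show "emeasure (distr lborel borel T) (box l u) = (\<Prod>b\<in>Basis. (u - l) \<bullet> b)"
    using lu by simp
qed simp

definition herm :: "complex ^ 'N \<Rightarrow> complex ^ 'N \<Rightarrow> complex" where
  "herm z w = (\<Sum>i\<in>UNIV. z $ i * cnj (w $ i))"

lemma herm_add_left: "herm (x + y) w = herm x w + herm y w"
  by (simp add: herm_def algebra_simps sum.distrib)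

lemma herm_scale_left: "herm (c *s x) w = c * herm x w"
  by (simp add: herm_def algebra_simps sum_distrib_left)

lemma herm_scale_right: "herm x (c *s w) = cnj c * herm x w"
  by (simp add: herm_def algebra_simps sum_distrib_left)

lemma herm_cnj: "herm w z = cnj (herm z w)"
  by (simp add: herm_def mult.commute)

lemma herm_add_right: "herm w (x + y) = herm w x + herm w y"
  by (simp add: herm_def algebra_simps sum.distrib)

lemma Re_herm: "Re (herm x y) = x \<bullet> y"
  by (simp add: herm_def inner_vec_def inner_complex_def)

lemma Im_herm: "Im (herm x y) = x \<bullet> (\<i> *s y)"
  using Re_herm[of x "\<i> *s y"] by (simp add: herm_scale_right)

lemma herm_self: "herm x x = complex_of_real ((norm x)\<^sup>2)"
proof (rule complex_eqI)
  show "Im (herm x x) = Im (complex_of_real ((norm x)\<^sup>2))"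
    by (simp add: herm_def mult.commute)
qed (simp add: Re_herm power2_norm_eq_inner)

lemma norm_vector_scale: "norm (c *s (x :: complex ^ 'N)) = cmod c * norm x"
proof -
  have "norm (c *s x) = L2_set (\<lambda>i. cmod c * norm (x $ i)) UNIV"
    by (simp add: norm_vec_def norm_mult)
  then show ?thesis by (simp only: norm_vec_def L2_set_right_distrib norm_ge_zero)
qed

text \<open>
  Multiplication by \<open>c\<close> makes a hermitian product real and non-negative.
\<close>
lemma unimodular_factor:
  obtains c where "cmod c = 1" "c * w = complex_of_real (cmod w)"
proof (cases "w = 0")
  case False
  have "cnj (sgn w) * w = (w * cnj w) / complex_of_real (cmod w)"
    by (simp add: sgn_eq mult.commute)
  also have "\<dots> = complex_of_real (cmod w)"
    using False by (simp add: complex_norm_square[symmetric] power2_eq_square)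
  finally have "cnj (sgn w) * w = complex_of_real (cmod w)" .
  then show ?thesis using False by (intro that[of "cnj (sgn w)"]) (auto simp: norm_sgn)
qed (auto intro: that[of 1])

lemma norm_herm_le: "cmod (herm x y) \<le> norm x * norm y"
proof -
  obtain c where c: "cmod c = 1" "c * herm x y = complex_of_real (cmod (herm x y))"
    by (rule unimodular_factor)
  have "cmod (herm x y) = Re (herm (c *s x) y)" using c by (simp add: herm_scale_left)
  also have "\<dots> \<le> norm (c *s x) * norm y" by (simp add: Re_herm norm_cauchy_schwarz)
  also have "norm (c *s x) = norm x"
    using c by (simp add: norm_vector_scale)
  finally show ?thesis .
qed

lemma of_real_scale: "complex_of_real r *s x = r *\<^sub>R x"
  by (simp add: vec_eq_iff) (simp add: scaleR_conv_of_real)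

definition unitary_map :: "(complex ^ 'N \<Rightarrow> complex ^ 'N) \<Rightarrow> bool" where
  "unitary_map T \<longleftrightarrow> orthogonal_transformation T \<and> (\<forall>c x. T (c *s x) = c *s T x)"

lemma unitary_map_herm:
  assumes "unitary_map T" shows "herm (T x) (T y) = herm x y"
proof (rule complex_eqI)
  have o: "orthogonal_transformation T" and c: "\<And>c x. T (c *s x) = c *s T x"
    using assms by (auto simp: unitary_map_def)
  show "Re (herm (T x) (T y)) = Re (herm x y)"
    using o by (simp add: Re_herm orthogonal_transformation_def)
  show "Im (herm (T x) (T y)) = Im (herm x y)"
    using o by (simp add: Im_herm orthogonal_transformation_def flip: c)
qed

lemma unitary_mapI:
  assumes "\<And>x y. T (x + y) = T x + T y" "\<And>c x. T (c *s x) = c *s T x"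
    "\<And>x. norm (T x) = norm x"
  shows "unitary_map T"
proof -
  have "linear T"
  proof (rule linearI)
    fix r :: real and x show "T (r *\<^sub>R x) = r *\<^sub>R T x"
      using assms(2)[of "complex_of_real r" x] by (simp only: of_real_scale)
  qed (rule assms(1))
  then show ?thesis
    using assms by (simp add: unitary_map_def orthogonal_transformation)
qed

lemma unitary_map_scale: "cmod c = 1 \<Longrightarrow> unitary_map (\<lambda>x. c *s x)"
  by (rule unitary_mapI) (auto simp: vector_add_ldistrib norm_vector_scale mult.commute)

lemma unitary_map_comp: "unitary_map S \<Longrightarrow> unitary_map T \<Longrightarrow> unitary_map (\<lambda>x. S (T x))"
  using orthogonal_transformation_compose[of S T] by (auto simp: unitary_map_def o_def)

text \<open>
  The reflection in the complex hyperplane orthogonal to \<open>u\<close>.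
\<close>
lemma unitary_map_reflection:
  assumes "u \<noteq> 0"
  shows "unitary_map (\<lambda>z. z - (2 * herm z u / herm u u) *s u)"
proof (rule unitary_mapI)
  fix x
  define k where "k = herm x u / herm u u"
  have uu: "herm u u \<noteq> 0" using assms by (simp add: herm_self)
  have cuu: "cnj (herm u u) = herm u u" by (simp add: herm_self)
  have "herm (x - (2 * k) *s u) (x - (2 * k) *s u) = herm x x"
  proof -
    have *: "x - (2 * k) *s u = x + (- 2 * k) *s u" by (simp add: vec_eq_iff)
    have ku: "k * herm u u = herm x u" using uu by (simp add: k_def)
    have xu: "herm u x = cnj k * herm u u"
      using ku cuu by (metis complex_cnj_mult herm_cnj)
    have "herm (x - (2 * k) *s u) (x - (2 * k) *s u)
      = herm x x + cnj (- 2 * k) * herm x u + (- 2 * k) * (herm u x + cnj (- 2 * k) * herm u u)"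
      unfolding * by (simp only: herm_add_left herm_add_right herm_scale_left herm_scale_right)
        (simp add: algebra_simps)
    also have "\<dots> = herm x x" unfolding xu ku[symmetric] by (simp add: algebra_simps)
    finally show ?thesis .
  qed
  then have "(norm (x - (2 * k) *s u))\<^sup>2 = (norm x)\<^sup>2"
    unfolding herm_self by (metis of_real_eq_iff)
  then show "norm (x - (2 * herm x u / herm u u) *s u) = norm x"
    by (simp add: k_def)
next
  fix x y
  show "x + y - (2 * herm (x + y) u / herm u u) *s u
    = x - (2 * herm x u / herm u u) *s u + (y - (2 * herm y u / herm u u) *s u)"
    by (simp add: herm_add_left vec_eq_iff ring_distribs add_divide_distrib)
next
  fix c x
  show "c *s x - (2 * herm (c *s x) u / herm u u) *s u = c *s (x - (2 * herm x u / herm u u) *s u)"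
    by (simp add: herm_scale_left vec_eq_iff right_diff_distrib)
qed

text \<open>
  Multiplying \<open>x\<close> by a unimodular \<open>c\<close> makes its hermitian product with \<open>y\<close> real; the reflection
  along \<open>c x - y\<close> then exchanges \<open>c x\<close> and \<open>y\<close>, as in the real case.
\<close>
lemma unitary_map_transitive:
  assumes "norm x = norm y"
  obtains T where "unitary_map T" "T x = y"
proof -
  obtain c where c: "cmod c = 1" "c * herm x y = complex_of_real (cmod (herm x y))"
    by (rule unimodular_factor)
  define x' where "x' = c *s x"
  have nx: "norm x' = norm y" using assms c by (simp add: x'_def norm_vector_scale)
  have hr: "herm x' y = cnj (herm x' y)" using c by (simp add: x'_def herm_scale_left)
  have U: "unitary_map (\<lambda>z. c *s z)" using c by (intro unitary_map_scale)
  show ?thesis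
  proof (cases "x' = y")
    case True
    then show ?thesis using that[OF U] by (simp add: x'_def)
  next
    case False
    define u where "u = x' - y"
    have u0: "u \<noteq> 0" using False by (simp add: u_def)
    have um: "u = x' + (-1) *s y" by (simp add: u_def vec_eq_iff)
    have yx: "herm y x' = herm x' y" using hr by (metis herm_cnj)
    have yy: "herm y y = herm x' x'" using nx by (simp add: herm_self)
    have "herm u u = 2 * herm x' u"
      unfolding um by (simp only: herm_add_left herm_add_right herm_scale_left herm_scale_right yx yy) simp
    then have k: "2 * herm x' u / herm u u = 1" 
      using u0 by (metis divide_self_if herm_self norm_eq_zero of_real_eq_0_iff power_eq_0_iff)
    have "unitary_map (\<lambda>z. c *s z - (2 * herm (c *s z) u / herm u u) *s u)"
      using unitary_map_comp[OF unitary_map_reflection[OF u0] U] by simp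
    moreover have "c *s x - (2 * herm (c *s x) u / herm u u) *s u = y"
      using k by (simp add: x'_def[symmetric] u_def)
    ultimately show ?thesis using that by blast
  qed
qed

lemma unitary_map_norm: "unitary_map T \<Longrightarrow> norm (T x) = norm x"
  by (simp add: unitary_map_def orthogonal_transformation)

lemma unitary_map_linear: "unitary_map T \<Longrightarrow> linear T"
  by (simp add: unitary_map_def orthogonal_transformation)

lemma unitary_map_measurable [measurable_dest]:
  "unitary_map T \<Longrightarrow> T \<in> borel_measurable borel"
  by (intro borel_measurable_continuous_onI)
     (simp add: linear_continuous_on linear_linear unitary_map_linear)

lemma prob_space_sphere_measure: "prob_space (sphere_measure :: (complex ^ 'N) measure)"
  by (rule prob_spaceI) (simp add: space_sphere_measure emeasure_sphere_measure_space)

lemma borel_measurable_sphereI: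
  "f \<in> borel \<rightarrow>\<^sub>M M \<Longrightarrow> f \<in> sphere_measure \<rightarrow>\<^sub>M M"
  using measurable_restrict_space1[of f borel M "sphere 0 1"]
  unfolding measurable_cong_sets[OF sets_sphere_measure refl] by blast

lemma nn_integral_sphere_measure:
  assumes [measurable]: "g \<in> borel_measurable (borel :: (complex ^ 'N) measure)"
  shows "(\<integral>\<^sup>+\<zeta>. g \<zeta> \<partial>sphere_measure) =
    (\<integral>\<^sup>+z\<in>ball 0 1. g (z /\<^sub>R norm z) \<partial>lborel) / emeasure lborel (ball 0 1 :: (complex ^ 'N) set)"
proof -
  let ?S = "sphere 0 1 :: (complex ^ 'N) set" and ?B = "ball 0 1 :: (complex ^ 'N) set"
  have [measurable]: "?S \<in> sets borel" by (intro borel_closed) simp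
  have "(\<integral>\<^sup>+\<zeta>. g \<zeta> \<partial>sphere_measure) =
    (\<integral>\<^sup>+\<zeta>\<in>?S. g \<zeta> \<partial>distr (uniform_measure lborel ?B) borel (\<lambda>z. z /\<^sub>R norm z))"
    unfolding sphere_measure_def by (rule nn_integral_restrict_space) auto
  also have "\<dots> = (\<integral>\<^sup>+z. g (z /\<^sub>R norm z) * indicator ?S (z /\<^sub>R norm z) \<partial>uniform_measure lborel ?B)"
    by (subst nn_integral_distr) auto
  also have "\<dots> = (\<integral>\<^sup>+z\<in>?B. (g (z /\<^sub>R norm z) * indicator ?S (z /\<^sub>R norm z)) \<partial>lborel) / emeasure lborel ?B"
    by (subst nn_integral_uniform_measure) auto
  also have "(\<integral>\<^sup>+z\<in>?B. (g (z /\<^sub>R norm z) * indicator ?S (z /\<^sub>R norm z)) \<partial>lborel)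
     = (\<integral>\<^sup>+z\<in>?B. g (z /\<^sub>R norm z) \<partial>lborel)"
  proof (rule nn_integral_cong_AE)
    have "AE z in lborel. z \<noteq> (0 :: complex ^ 'N)" by (rule AE_lborel_singleton)
    then show "AE z in lborel. g (z /\<^sub>R norm z) * indicator ?S (z /\<^sub>R norm z) * indicator ?B z
        = g (z /\<^sub>R norm z) * indicator ?B z"
      by eventually_elim (auto simp: indicator_def)
  qed
  finally show ?thesis .
qed

lemma nn_integral_sphere_unitary:
  assumes T: "unitary_map T" and [measurable]: "g \<in> borel_measurable (borel :: (complex ^ 'N) measure)"
  shows "(\<integral>\<^sup>+\<zeta>. g (T \<zeta>) \<partial>sphere_measure) = (\<integral>\<^sup>+\<zeta>. g \<zeta> \<partial>(sphere_measure :: (complex ^ 'N) measure))"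
proof -
  have [measurable]: "T \<in> borel_measurable borel" using T by (rule unitary_map_measurable)
  have ot: "orthogonal_transformation T" using T by (simp add: unitary_map_def)
  have "(\<integral>\<^sup>+z\<in>ball 0 1. g (z /\<^sub>R norm z) \<partial>lborel) = (\<integral>\<^sup>+z\<in>ball 0 1. g (z /\<^sub>R norm z) \<partial>distr lborel borel T)"
    by (simp add: lborel_distr_orthogonal[OF ot])
  also have "\<dots> = (\<integral>\<^sup>+z\<in>ball 0 1. g (T (z /\<^sub>R norm z)) \<partial>lborel)"
    by (subst nn_integral_distr)
       (auto simp: unitary_map_norm[OF T] linear_scale[OF unitary_map_linear[OF T]] indicator_def
        intro!: nn_integral_cong)
  finally show ?thesis by (simp add: nn_integral_sphere_measure)
qed

section \<open>Spherical caps and unitarily invariant laws\<close>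

lemma nn_integral_sphere_mono:
  "(\<And>\<zeta>. norm \<zeta> = 1 \<Longrightarrow> f \<zeta> \<le> g \<zeta>) \<Longrightarrow> (\<integral>\<^sup>+\<zeta>. f \<zeta> \<partial>sphere_measure) \<le> (\<integral>\<^sup>+\<zeta>. g \<zeta> \<partial>sphere_measure)"
  by (rule nn_integral_mono) (simp add: space_sphere_measure)

lemma nn_integral_sphere_cong:
  "(\<And>\<zeta>. norm \<zeta> = 1 \<Longrightarrow> f \<zeta> = g \<zeta>) \<Longrightarrow> (\<integral>\<^sup>+\<zeta>. f \<zeta> \<partial>sphere_measure) = (\<integral>\<^sup>+\<zeta>. g \<zeta> \<partial>sphere_measure)"
  by (rule nn_integral_cong) (simp add: space_sphere_measure)

definition cap_mass :: "real \<Rightarrow> complex ^ 'N \<Rightarrow> ennreal" where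
  "cap_mass e y = (\<integral>\<^sup>+x. indicator {x. dist x y < e} x \<partial>sphere_measure)"

lemma cap_mass_eq:
  fixes y y' :: "complex ^ 'N"
  assumes "norm y = norm y'"
  shows "cap_mass e y = cap_mass e y'"
proof -
  obtain T where T: "unitary_map T" "T y = y'" using assms by (rule unitary_map_transitive)
  have lin: "linear T" using T by (simp add: unitary_map_linear)
  have d: "dist (T x) (T y) = dist x y" for x
    using T(1) by (simp add: dist_norm linear_diff[OF lin, symmetric] unitary_map_norm)
  have "cap_mass e y' = (\<integral>\<^sup>+x. indicator {x. dist x y' < e} (T x) \<partial>sphere_measure)"
    unfolding cap_mass_def by (rule nn_integral_sphere_unitary[OF T(1), symmetric]) measurable
  also have "\<dots> = cap_mass e y"
    unfolding cap_mass_def T(2)[symmetric] by (intro nn_integral_cong) (simp add: indicator_def d)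
  finally show ?thesis by simp
qed

text \<open>
  Finitely many caps cover the sphere, and all caps of one radius have the same mass.
\<close>
lemma cap_mass_pos:
  fixes y :: "complex ^ 'N"
  assumes "norm y = 1" "e > 0"
  shows "cap_mass e y > 0"
proof (rule ccontr)
  assume "\<not> cap_mass e y > 0"
  then have 0: "cap_mass e x = 0" if "norm x = 1" for x :: "complex ^ 'N"
    using cap_mass_eq[of x y e] assms that by (simp add: not_less)
  have "sphere (0 :: complex ^ 'N) 1 \<subseteq> (\<Union>x\<in>sphere 0 1. ball x e)" using assms(2) by auto
  then obtain D where D: "D \<subseteq> sphere (0 :: complex ^ 'N) 1" "finite D"
      "sphere (0 :: complex ^ 'N) 1 \<subseteq> (\<Union>x\<in>D. ball x e)"
    using compactE_image[of "sphere (0 :: complex ^ 'N) 1" "sphere 0 1" "\<lambda>x. ball x e"] by auto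
  have "1 = (\<integral>\<^sup>+x. 1 \<partial>(sphere_measure :: (complex ^ 'N) measure))"
    by (simp add: space_sphere_measure emeasure_sphere_measure_space)
  also have "\<dots> \<le> (\<integral>\<^sup>+x. (\<Sum>y\<in>D. indicator {x. dist x y < e} x) \<partial>sphere_measure)"
  proof (rule nn_integral_sphere_mono)
    fix x :: "complex ^ 'N" assume "norm x = 1"
    then obtain y where y: "y \<in> D" "dist x y < e" using D(3) by (auto simp: dist_commute)
    then have "(1::ennreal) = indicator {x. dist x y < e} x" by simp
    also have "\<dots> \<le> (\<Sum>y\<in>D. indicator {x. dist x y < e} x)"
      using y D(2) by (intro member_le_sum) auto
    finally show "(1::ennreal) \<le> (\<Sum>y\<in>D. indicator {x. dist x y < e} x)" .
  qed
  also have "\<dots> = (\<Sum>y\<in>D. cap_mass e y)"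
    unfolding cap_mass_def by (intro nn_integral_sum borel_measurable_sphereI) measurable
  also have "\<dots> = 0" using D(1) 0 by (intro sum.neutral) auto
  finally show False by simp
qed

text \<open>
  Caps have positive mass, so that an essential bound of a continuous function holds everywhere.
  This permits replacing the essential supremum by a pointwise bound in \<open>norm_le\<close> below.
\<close>
lemma AE_sphere_continuous_le:
  fixes u :: "complex ^ 'N \<Rightarrow> ennreal"
  assumes u: "continuous_on (sphere 0 1) u" and ae: "AE \<zeta> in sphere_measure. u \<zeta> \<le> A"
    and z: "norm z = 1"
  shows "u z \<le> A"
proof (rule ccontr)
  assume "\<not> u z \<le> A"
  have op: "openin (top_of_set (sphere 0 1)) (sphere 0 1 \<inter> u -` {A<..})"
    using u by (rule continuous_openin_preimage_gen) simp
  obtain e where e: "e > 0" "ball z e \<inter> sphere 0 1 \<subseteq> sphere 0 1 \<inter> u -` {A<..}"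
  proof -
    have "z \<in> sphere 0 1 \<inter> u -` {A<..}" using z \<open>\<not> u z \<le> A\<close> by (simp add: not_le)
    with op show ?thesis using that unfolding openin_contains_ball by blast
  qed
  have "AE \<zeta> in sphere_measure. indicator {x. dist x z < e} \<zeta> = (0 :: ennreal)"
    using ae AE_space
  proof eventually_elim
    case (elim x)
    then have "x \<notin> ball z e" using e(2) by (force simp: space_sphere_measure not_less)
    then show ?case by (simp add: dist_commute)
  qed
  then have "cap_mass e z = 0" unfolding cap_mass_def
    by (subst nn_integral_0_iff_AE) (auto intro!: borel_measurable_sphereI)
  then show False using cap_mass_pos[OF z e(1)] by simp
qed

text \<open>
  A unitarily invariant law integrates \<open>G\<close> like a mixture of uniform measures on spheres. The proof
  is the uniqueness argument for invariant measures on a homogeneous space: let \<open>k x y\<close> indicate that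
  \<open>x\<close> lies in the cap of radius \<open>e\<close> about the direction of \<open>y\<close>. Its integral over \<open>x\<close> is the mass
  \<open>m\<close> of a cap whatever \<open>y\<close> is, and by invariance its integral against a function of \<open>\<bar>y\<bar>\<close> is the same for
  every \<open>x\<close>. Uniform continuity replaces \<open>G y\<close> by the mean of \<open>G\<close> over the cap about \<open>y\<close> at the
  cost of \<open>\<eta>\<close>, and exchanging the integrals turns that mean into the mean over the whole sphere.
\<close>
lemma nn_integral_unitary_invariant_le:
  fixes G :: "complex ^ 'N \<Rightarrow> real" and \<mu> :: "(complex ^ 'N) measure"
  assumes mu: "prob_space \<mu>" and sets_mu [measurable_cong]: "sets \<mu> = sets borel"
    and inv: "\<And>T g. unitary_map T \<Longrightarrow> g \<in> borel_measurable borel \<Longrightarrow>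
        (\<integral>\<^sup>+x. g (T x) \<partial>\<mu>) = (\<integral>\<^sup>+x. (g x :: ennreal) \<partial>\<mu>)"
    and ae: "AE x in \<mu>. 0 < norm x \<and> norm x \<le> r" and r: "r \<le> 1"
    and G [measurable]: "G \<in> borel_measurable borel" and Gc: "continuous_on (cball 0 r) G"
    and A: "\<And>\<rho>. 0 < \<rho> \<Longrightarrow> \<rho> \<le> r \<Longrightarrow> (\<integral>\<^sup>+\<zeta>. ennreal (G (\<rho> *\<^sub>R \<zeta>)) \<partial>sphere_measure) \<le> A"
  shows "(\<integral>\<^sup>+x. ennreal (G x) \<partial>\<mu>) \<le> A"
proof (rule ennreal_le_epsilon)
  fix \<eta> :: real assume "\<eta> > 0"
  let ?\<sigma> = "sphere_measure :: (complex ^ 'N) measure"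
  interpret M: prob_space \<mu> by fact
  interpret S: prob_space ?\<sigma> by (rule prob_space_sphere_measure)
  interpret MS: pair_sigma_finite \<mu> ?\<sigma> ..
  have sets_S [measurable]: "id \<in> borel_measurable ?\<sigma>" by (rule borel_measurable_sphereI) simp
  have meas: "(\<lambda>(y, x). f y x) \<in> borel_measurable (\<mu> \<Otimes>\<^sub>M ?\<sigma>)"
    if "(\<lambda>(y, x). f y x) \<in> borel_measurable (borel \<Otimes>\<^sub>M borel)"
    for f :: "complex ^ 'N \<Rightarrow> complex ^ 'N \<Rightarrow> ennreal"
  proof -
    have "(\<lambda>w. (fst w, snd w)) \<in> \<mu> \<Otimes>\<^sub>M ?\<sigma> \<rightarrow>\<^sub>M borel \<Otimes>\<^sub>M borel"
    proof (rule measurable_Pair)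
      show "fst \<in> \<mu> \<Otimes>\<^sub>M ?\<sigma> \<rightarrow>\<^sub>M borel" by measurable
      have "(\<lambda>w. id (snd w)) \<in> \<mu> \<Otimes>\<^sub>M ?\<sigma> \<rightarrow>\<^sub>M borel" by measurable
      then show "snd \<in> \<mu> \<Otimes>\<^sub>M ?\<sigma> \<rightarrow>\<^sub>M borel" by simp
    qed
    from measurable_compose[OF this that] show ?thesis by (simp add: split_beta')
  qed
  have "uniformly_continuous_on (cball 0 r) G"
    using Gc by (rule compact_uniformly_continuous) simp
  then obtain e where e: "e > 0"
    and ue: "\<And>x x'. x \<in> cball 0 r \<Longrightarrow> x' \<in> cball 0 r \<Longrightarrow> dist x' x < e \<Longrightarrow> dist (G x') (G x) < \<eta>"
    using \<open>\<eta> > 0\<close> unfolding uniformly_continuous_on_def by metis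
  define k :: "complex ^ 'N \<Rightarrow> complex ^ 'N \<Rightarrow> ennreal"
    where "k x y = indicator {x. dist x (y /\<^sub>R norm y) < e} x" for x y
  have k_meas [measurable]: "(\<lambda>(y, x). k x y) \<in> borel_measurable (borel \<Otimes>\<^sub>M borel)"
    unfolding k_def indicator_def mem_Collect_eq by measurable
  obtain c :: "complex ^ 'N" where c: "norm c = 1" using vector_choose_size[of 1] by auto
  define m where "m = cap_mass e c"
  have m0: "m > 0" unfolding m_def using c e by (rule cap_mass_pos)
  have m1: "m < \<infinity>"
  proof -
    have "m \<le> (\<integral>\<^sup>+x. 1 \<partial>?\<sigma>)" unfolding m_def cap_mass_def
      by (rule nn_integral_mono) (simp add: indicator_def)
    then show ?thesis by (simp add: S.emeasure_space_1 order_le_less_trans)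
  qed
  have km: "(\<integral>\<^sup>+x. k x y \<partial>?\<sigma>) = m" if "norm y > 0" for y
    unfolding m_def k_def cap_mass_def[symmetric] using that c by (intro cap_mass_eq) simp
  have swap: "(\<integral>\<^sup>+y. (\<integral>\<^sup>+x. H (norm y) x * k x y \<partial>?\<sigma>) \<partial>\<mu>)
      = (\<integral>\<^sup>+y. k c y * (\<integral>\<^sup>+x. H (norm y) x \<partial>?\<sigma>) \<partial>\<mu>)"
    if [measurable]: "(\<lambda>(s, x). H s x) \<in> borel_measurable (borel \<Otimes>\<^sub>M borel)" for H :: "real \<Rightarrow> complex ^ 'N \<Rightarrow> ennreal"
  proof -
    have [measurable]: "H s \<in> borel_measurable borel" for s by measurable
    have "(\<integral>\<^sup>+y. (\<integral>\<^sup>+x. H (norm y) x * k x y \<partial>?\<sigma>) \<partial>\<mu>) = (\<integral>\<^sup>+x. (\<integral>\<^sup>+y. H (norm y) x * k x y \<partial>\<mu>) \<partial>?\<sigma>)"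
      by (rule MS.Fubini'[symmetric]) (rule meas, measurable)
    also have "\<dots> = (\<integral>\<^sup>+x. (\<integral>\<^sup>+y. H (norm y) x * k c y \<partial>\<mu>) \<partial>?\<sigma>)"
    proof (rule nn_integral_sphere_cong)
      fix x :: "complex ^ 'N" assume x: "norm x = 1"
      obtain T where T: "unitary_map T" "T c = x"
        using c x by (metis unitary_map_transitive)
      have lin: "linear T" using T by (simp add: unitary_map_linear)
      have "k x (T y) = k c y" for y
      proof -
        have "dist x (T y /\<^sub>R norm (T y)) = norm (T (c - y /\<^sub>R norm y))"
          using T by (simp add: dist_norm linear_diff[OF lin] linear_scale[OF lin] unitary_map_norm)
        also have "\<dots> = dist c (y /\<^sub>R norm y)" using T by (simp add: unitary_map_norm dist_norm)
        finally show ?thesis by (simp add: k_def indicator_def)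
      qed
      then show "(\<integral>\<^sup>+y. H (norm y) x * k x y \<partial>\<mu>) = (\<integral>\<^sup>+y. H (norm y) x * k c y \<partial>\<mu>)"
        using inv[OF T(1), of "\<lambda>y. H (norm y) x * k x y"] by (simp add: unitary_map_norm[OF T(1)])
    qed
    also have "\<dots> = (\<integral>\<^sup>+y. (\<integral>\<^sup>+x. H (norm y) x * k c y \<partial>?\<sigma>) \<partial>\<mu>)"
      by (rule MS.Fubini') (rule meas, measurable)
    also have "\<dots> = (\<integral>\<^sup>+y. k c y * (\<integral>\<^sup>+x. H (norm y) x \<partial>?\<sigma>) \<partial>\<mu>)"
      by (intro nn_integral_cong) (subst nn_integral_multc, auto intro!: borel_measurable_sphereI simp: mult.commute)
    finally show ?thesis .
  qed
  have kc: "(\<integral>\<^sup>+y. k c y \<partial>\<mu>) = m"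
  proof -
    have "(\<integral>\<^sup>+y. k c y \<partial>\<mu>) = (\<integral>\<^sup>+y. (\<integral>\<^sup>+x. k x y \<partial>?\<sigma>) \<partial>\<mu>)"
      using swap[of "\<lambda>_ _. 1"] by (simp add: S.emeasure_space_1)
    also have "\<dots> = (\<integral>\<^sup>+y. m \<partial>\<mu>)"
      using ae by (intro nn_integral_cong_AE) (auto elim!: eventually_mono simp: km)
    finally show ?thesis by (simp add: M.emeasure_space_1)
  qed
  have "(\<integral>\<^sup>+x. ennreal (G x) \<partial>\<mu>) * m = (\<integral>\<^sup>+y. ennreal (G y) * m \<partial>\<mu>)"
    by (rule nn_integral_multc[symmetric]) measurable
  also have "\<dots> \<le> (\<integral>\<^sup>+y. (\<integral>\<^sup>+x. (ennreal (G (norm y *\<^sub>R x)) + ennreal \<eta>) * k x y \<partial>?\<sigma>) \<partial>\<mu>)"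
  proof (rule nn_integral_mono_AE, use ae in eventually_elim)
    case (elim y)
    have "ennreal (G y) * m = (\<integral>\<^sup>+x. ennreal (G y) * k x y \<partial>?\<sigma>)"
      using elim by (subst nn_integral_cmult) (auto simp: km intro!: borel_measurable_sphereI)
    also have "\<dots> \<le> (\<integral>\<^sup>+x. (ennreal (G (norm y *\<^sub>R x)) + ennreal \<eta>) * k x y \<partial>?\<sigma>)"
    proof (rule nn_integral_sphere_mono)
      fix x :: "complex ^ 'N" assume x: "norm x = 1"
      show "ennreal (G y) * k x y \<le> (ennreal (G (norm y *\<^sub>R x)) + ennreal \<eta>) * k x y"
      proof (cases "dist x (y /\<^sub>R norm y) < e")
        case True
        have "dist (norm y *\<^sub>R x) y = norm y * dist x (y /\<^sub>R norm y)"
        proof -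
          have "norm y *\<^sub>R x - y = norm y *\<^sub>R (x - y /\<^sub>R norm y)"
            using elim by (simp add: scaleR_diff_right)
          then show ?thesis by (simp add: dist_norm)
        qed
        also have "\<dots> \<le> 1 * dist x (y /\<^sub>R norm y)"
          using elim r by (intro mult_right_mono) auto
        finally have "dist (norm y *\<^sub>R x) y < e" using True by simp
        then have "dist (G (norm y *\<^sub>R x)) (G y) < \<eta>"
          using elim x by (intro ue) auto
        then have "G y \<le> G (norm y *\<^sub>R x) + \<eta>" by (simp add: dist_real_def)
        then have "ennreal (G y) \<le> ennreal (G (norm y *\<^sub>R x) + \<eta>)" by (rule ennreal_leI)
        also have "\<dots> \<le> ennreal (G (norm y *\<^sub>R x)) + ennreal \<eta>"
          using \<open>\<eta> > 0\<close> by (cases "G (norm y *\<^sub>R x) \<ge> 0")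
            (auto simp: ennreal_plus[symmetric] ennreal_neg intro!: ennreal_leI simp del: ennreal_plus)
        finally show ?thesis by (rule mult_right_mono) simp
      qed (simp add: k_def)
    qed
    finally show ?case .
  qed
  also have "\<dots> = (\<integral>\<^sup>+y. k c y * (\<integral>\<^sup>+x. (ennreal (G (norm y *\<^sub>R x)) + ennreal \<eta>) \<partial>?\<sigma>) \<partial>\<mu>)"
    by (rule swap) measurable
  also have "\<dots> \<le> (\<integral>\<^sup>+y. k c y * (A + ennreal \<eta>) \<partial>\<mu>)"
  proof (rule nn_integral_mono_AE, use ae in eventually_elim)
    case (elim y)
    have "(\<integral>\<^sup>+x. (ennreal (G (norm y *\<^sub>R x)) + ennreal \<eta>) \<partial>?\<sigma>) = (\<integral>\<^sup>+x. ennreal (G (norm y *\<^sub>R x)) \<partial>?\<sigma>) + ennreal \<eta>"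
      by (subst nn_integral_add) (auto simp: S.emeasure_space_1 intro!: borel_measurable_sphereI)
    also have "\<dots> \<le> A + ennreal \<eta>" using elim by (intro add_right_mono A) auto
    finally show ?case by (rule mult_left_mono) simp
  qed
  also have "\<dots> = (A + ennreal \<eta>) * m"
    by (subst nn_integral_multc) (auto simp: kc mult.commute)
  finally show "(\<integral>\<^sup>+x. ennreal (G x) \<partial>\<mu>) \<le> A + ennreal \<eta>"
    using m0 m1 by (simp add: ennreal_mult_le_mult_iff mult.commute[of _ m])
qed

section \<open>Integral means and averages\<close>

text \<open>
  The right-hand side is the tangent at \<open>u = h\<close> of the convex function in question, rescaled so that
  \<open>u\<close> is bounded by a linear function of its power.
\<close>
lemma weighted_Young:
  fixes u h P :: real
  assumes "0 \<le> u" "0 < h" "1 \<le> P"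
  shows "u \<le> h powr (1 - P) / P * u powr P + (1 - 1 / P) * h"
proof (cases "u = 0")
  case True
  then show ?thesis using assms by simp
next
  case False
  have "(u powr P * h powr (1 - P)) powr (1 / P) * h powr (1 - 1 / P)
      \<le> (1 / P) * (u powr P * h powr (1 - P)) + (1 - 1 / P) * h"
    by (rule Youngs_inequality_0) (use assms False in auto)
  moreover have "(u powr P * h powr (1 - P)) powr (1 / P) * h powr (1 - 1 / P) = u"
  proof -
    have "(u powr P * h powr (1 - P)) powr (1 / P) = u * h powr ((1 - P) / P)"
      using assms by (simp add: powr_mult powr_powr)
    moreover have "h powr ((1 - P) / P) * h powr (1 - 1 / P) = 1"
    proof -
      have "(1 - P) / P + (1 - 1 / P) = 0" using assms by (simp add: field_simps)
      then show ?thesis using assms unfolding powr_add[symmetric] by simp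
    qed
    ultimately show ?thesis by (simp add: mult.assoc)
  qed
  ultimately show ?thesis by (simp add: mult.commute)
qed

text \<open>
  Using the value \<open>h\<close> itself as the point of tangency gives Jensen's inequality also when
  the integrals are infinite.
\<close>
lemma jensen_powr:
  assumes mu: "prob_space \<mu>" and u [measurable]: "u \<in> borel_measurable \<mu>"
    and u0: "\<And>x. x \<in> space \<mu> \<Longrightarrow> 0 \<le> u x" and P: "1 \<le> P" and h0: "0 \<le> h"
    and h: "ennreal h \<le> (\<integral>\<^sup>+x. ennreal (u x) \<partial>\<mu>)"
  shows "ennreal (h powr P) \<le> (\<integral>\<^sup>+x. ennreal (u x powr P) \<partial>\<mu>)"
proof (cases "h = 0 \<or> (\<integral>\<^sup>+x. ennreal (u x powr P) \<partial>\<mu>) = \<infinity>")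
  case False
  interpret prob_space \<mu> by fact
  have hp: "h > 0" using False h0 by simp
  obtain I where I: "I \<ge> 0" "(\<integral>\<^sup>+x. ennreal (u x powr P) \<partial>\<mu>) = ennreal I"
    using False by (cases "(\<integral>\<^sup>+x. ennreal (u x powr P) \<partial>\<mu>)") auto
  define k where "k = h powr (1 - P) / P"
  define d where "d = (1 - 1 / P) * h"
  have c: "k \<ge> 0" "d \<ge> 0" using P hp by (auto simp: k_def d_def)
  have "ennreal h \<le> (\<integral>\<^sup>+x. ennreal k * ennreal (u x powr P) + ennreal d \<partial>\<mu>)"
  proof (rule order_trans[OF h nn_integral_mono])
    fix x assume "x \<in> space \<mu>"
    then have "ennreal (u x) \<le> ennreal (k * u x powr P + d)"
      using weighted_Young[of "u x" h P] u0 hp P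
      by (intro ennreal_leI) (auto simp: k_def d_def)
    then show "ennreal (u x) \<le> ennreal k * ennreal (u x powr P) + ennreal d"
      using c by (simp add: ennreal_mult ennreal_plus)
  qed
  also have "\<dots> = ennreal k * ennreal I + ennreal d"
    by (subst nn_integral_add) (auto simp: nn_integral_cmult I emeasure_space_1)
  also have "\<dots> = ennreal (k * I + d)" using c I by (simp add: ennreal_mult ennreal_plus)
  finally have "h \<le> k * I + d" using c I by (simp add: ennreal_le_iff del: ennreal_plus)
  then have "h \<le> h powr (1 - P) * I" using P by (simp add: k_def d_def field_simps)
  then have "h powr (P - 1) * h \<le> h powr (P - 1) * (h powr (1 - P) * I)"
    by (rule mult_left_mono) simp
  moreover have "h powr (P - 1) * h = h powr P"
    using hp powr_mult_base[of h "P - 1"] by (simp add: mult.commute)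
  moreover have "h powr (P - 1) * (h powr (1 - P) * I) = I"
    using hp unfolding mult.assoc[symmetric] powr_add[symmetric] by simp
  ultimately show ?thesis using I by (simp add: ennreal_leI)
qed auto

lemma powr_add_le:
  fixes a b q :: real
  assumes "0 \<le> a" "0 \<le> b" "0 \<le> q"
  shows "(a + b) powr q \<le> 2 powr q * (a powr q + b powr q)"
proof -
  have "(a + b) powr q \<le> (2 * max a b) powr q" using assms by (intro powr_mono2) auto
  also have "\<dots> = 2 powr q * max a b powr q" using assms by (simp add: powr_mult)
  also have "max a b powr q \<le> a powr q + b powr q" by (simp add: max_def)
  finally show ?thesis by simp
qed

text \<open>
  The inequality \<open>\<parallel>u\<parallel>\<^sub>p \<le> A\<close> for a non-negative function on the sphere, as a predicate with a real bound:
  estimates are then implications between such bounds and need no extended arithmetic. For \<open>p = \<infinity>\<close>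
  the bound is pointwise, which agrees with the essential supremum for continuous functions
  (\<open>int_mean_le_iff\<close>).
\<close>
definition norm_le :: "ennreal \<Rightarrow> real \<Rightarrow> (complex ^ 'N \<Rightarrow> real) \<Rightarrow> bool" where
  "norm_le p A u \<longleftrightarrow>
     (if p = \<infinity> then \<forall>\<zeta>\<in>sphere 0 1. u \<zeta> \<le> A
      else (\<integral>\<^sup>+\<zeta>. ennreal (u \<zeta> powr enn2real p) \<partial>sphere_measure) \<le> ennreal (A powr enn2real p))"

lemma one_le_enn2real: "1 \<le> p \<Longrightarrow> p \<noteq> \<infinity> \<Longrightarrow> 1 \<le> enn2real p"
  using enn2real_mono[of 1 p] by (simp add: less_top)

text \<open>
  Minkowski's integral inequality for averages. For finite \<open>p\<close> it is Jensen's inequality at each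
  \<open>\<zeta>\<close> followed by Tonelli's theorem; hence it suffices to bound the \<open>p\<close>-th powers in the mean over the
  parameter \<open>x\<close>, which matters when \<open>x\<close> contains a random displacement.
\<close>
lemma norm_le_average:
  fixes U :: "'a \<Rightarrow> complex ^ 'N \<Rightarrow> real" and h :: "complex ^ 'N \<Rightarrow> real"
  assumes p: "1 \<le> p" and mu: "prob_space \<mu>"
    and U [measurable]: "(\<lambda>(x, \<zeta>). U x \<zeta>) \<in> borel_measurable (\<mu> \<Otimes>\<^sub>M sphere_measure)"
    and U0: "\<And>x \<zeta>. 0 \<le> U x \<zeta>" and A: "0 \<le> A" and c: "0 \<le> c"
    and h0: "\<And>\<zeta>. norm \<zeta> = 1 \<Longrightarrow> 0 \<le> h \<zeta>"
    and h: "\<And>\<zeta>. norm \<zeta> = 1 \<Longrightarrow> ennreal (h \<zeta>) \<le> ennreal c * (\<integral>\<^sup>+x. ennreal (U x \<zeta>) \<partial>\<mu>)"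
    and inf: "\<And>x \<zeta>. p = \<infinity> \<Longrightarrow> x \<in> space \<mu> \<Longrightarrow> norm \<zeta> = 1 \<Longrightarrow> U x \<zeta> \<le> A"
    and fin: "p \<noteq> \<infinity> \<Longrightarrow> (\<integral>\<^sup>+x. (\<integral>\<^sup>+\<zeta>. ennreal (U x \<zeta> powr enn2real p) \<partial>sphere_measure) \<partial>\<mu>)
                \<le> ennreal (A powr enn2real p)"
  shows "norm_le p (c * A) h"
proof (cases "p = \<infinity>")
  case True
  interpret prob_space \<mu> by fact
  have "h \<zeta> \<le> c * A" if "norm \<zeta> = 1" for \<zeta>
  proof -
    have "ennreal (h \<zeta>) \<le> ennreal c * (\<integral>\<^sup>+x. ennreal A \<partial>\<mu>)"
      by (rule order_trans[OF h[OF that]] mult_left_mono nn_integral_mono)+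
         (use inf[OF True _ that] in \<open>auto intro!: ennreal_leI\<close>)
    also have "\<dots> = ennreal (c * A)" using c A by (simp add: emeasure_space_1 ennreal_mult)
    finally show ?thesis using c A by (simp add: ennreal_le_iff)
  qed
  then show ?thesis using True by (simp add: norm_le_def)
next
  case False
  let ?P = "enn2real p"
  interpret M: prob_space \<mu> by fact
  interpret S: prob_space "sphere_measure :: (complex ^ 'N) measure" by (rule prob_space_sphere_measure)
  interpret MS: pair_sigma_finite \<mu> "sphere_measure :: (complex ^ 'N) measure" ..
  have P: "1 \<le> ?P" using p False by (rule one_le_enn2real)
  have "ennreal (h \<zeta> powr ?P) \<le> ennreal (c powr ?P) * (\<integral>\<^sup>+x. ennreal (U x \<zeta> powr ?P) \<partial>\<mu>)"
    if z: "norm \<zeta> = 1" for \<zeta>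
  proof (cases "c = 0")
    case True
    then have "h \<zeta> = 0" using h[OF z] h0[OF z] by (simp add: ennreal_eq_0_iff)
    then show ?thesis using P by simp
  next
    case False
    then have c: "c > 0" using c by simp
    have [measurable]: "(\<lambda>x. U x \<zeta>) \<in> borel_measurable \<mu>"
      using measurable_compose[OF measurable_Pair2' U] z by (simp add: space_sphere_measure)
    have "ennreal (h \<zeta> / c) \<le> (\<integral>\<^sup>+x. ennreal (U x \<zeta>) \<partial>\<mu>)"
    proof -
      have "ennreal (h \<zeta> / c) = ennreal (1 / c) * ennreal (h \<zeta>)"
        using c h0[OF z] by (simp add: ennreal_mult[symmetric])
      also have "\<dots> \<le> ennreal (1 / c) * (ennreal c * (\<integral>\<^sup>+x. ennreal (U x \<zeta>) \<partial>\<mu>))"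
        by (intro mult_left_mono h z) simp
      also have "\<dots> = (\<integral>\<^sup>+x. ennreal (U x \<zeta>) \<partial>\<mu>)"
        using c by (simp add: mult.assoc[symmetric] ennreal_mult[symmetric])
      finally show ?thesis .
    qed
    then have "ennreal ((h \<zeta> / c) powr ?P) \<le> (\<integral>\<^sup>+x. ennreal (U x \<zeta> powr ?P) \<partial>\<mu>)"
      using c h0[OF z] U0 P by (intro jensen_powr[OF mu]) auto
    then have "ennreal (c powr ?P) * ennreal ((h \<zeta> / c) powr ?P)
      \<le> ennreal (c powr ?P) * (\<integral>\<^sup>+x. ennreal (U x \<zeta> powr ?P) \<partial>\<mu>)"
      by (rule mult_left_mono) simp
    also have "ennreal (c powr ?P) * ennreal ((h \<zeta> / c) powr ?P) = ennreal (h \<zeta> powr ?P)"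
      using c h0[OF z] by (simp add: ennreal_mult[symmetric] powr_mult[symmetric])
    finally show ?thesis .
  qed
  then have "(\<integral>\<^sup>+\<zeta>. ennreal (h \<zeta> powr ?P) \<partial>sphere_measure)
    \<le> (\<integral>\<^sup>+\<zeta>. ennreal (c powr ?P) * (\<integral>\<^sup>+x. ennreal (U x \<zeta> powr ?P) \<partial>\<mu>) \<partial>sphere_measure)"
    by (rule nn_integral_sphere_mono)
  also have "\<dots> = ennreal (c powr ?P) * (\<integral>\<^sup>+\<zeta>. (\<integral>\<^sup>+x. ennreal (U x \<zeta> powr ?P) \<partial>\<mu>) \<partial>sphere_measure)"
    by (rule nn_integral_cmult) measurable
  also have "(\<integral>\<^sup>+\<zeta>. (\<integral>\<^sup>+x. ennreal (U x \<zeta> powr ?P) \<partial>\<mu>) \<partial>sphere_measure)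
    = (\<integral>\<^sup>+x. (\<integral>\<^sup>+\<zeta>. ennreal (U x \<zeta> powr ?P) \<partial>sphere_measure) \<partial>\<mu>)"
    by (rule MS.Fubini') measurable
  also have "ennreal (c powr ?P) * \<dots> \<le> ennreal (c powr ?P) * ennreal (A powr ?P)"
    by (rule mult_left_mono[OF fin[OF False]]) simp
  also have "\<dots> = ennreal ((c * A) powr ?P)" using c A by (simp add: ennreal_mult powr_mult)
  finally show ?thesis using False by (simp add: norm_le_def)
qed

lemma norm_le_mono:
  assumes "norm_le p A u" "\<And>\<zeta>. norm \<zeta> = 1 \<Longrightarrow> 0 \<le> v \<zeta> \<and> v \<zeta> \<le> u \<zeta>" "0 \<le> A" "A \<le> B"
  shows "norm_le p B v"
proof (cases "p = \<infinity>")
  case True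
  then show ?thesis using assms by (force simp: norm_le_def)
next
  case False
  have "(\<integral>\<^sup>+\<zeta>. ennreal (v \<zeta> powr enn2real p) \<partial>sphere_measure) \<le> (\<integral>\<^sup>+\<zeta>. ennreal (u \<zeta> powr enn2real p) \<partial>sphere_measure)"
    using assms(2) by (intro nn_integral_sphere_mono ennreal_leI powr_mono2) auto
  also have "\<dots> \<le> ennreal (A powr enn2real p)" using assms(1) False by (simp add: norm_le_def)
  also have "\<dots> \<le> ennreal (B powr enn2real p)" using assms by (intro ennreal_leI powr_mono2) auto
  finally show ?thesis using False by (simp add: norm_le_def)
qed

lemma norm_le_scale:
  assumes "norm_le p A u" "0 \<le> A" "0 \<le> c" "\<And>\<zeta>. norm \<zeta> = 1 \<Longrightarrow> 0 \<le> u \<zeta>"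
    "u \<in> borel_measurable sphere_measure"
  shows "norm_le p (c * A) (\<lambda>\<zeta>. c * u \<zeta>)"
proof (cases "p = \<infinity>")
  case True
  then show ?thesis using assms by (auto simp: norm_le_def intro!: mult_left_mono)
next
  case False
  have "(\<integral>\<^sup>+\<zeta>. ennreal ((c * u \<zeta>) powr enn2real p) \<partial>sphere_measure)
     = (\<integral>\<^sup>+\<zeta>. ennreal (c powr enn2real p) * ennreal (u \<zeta> powr enn2real p) \<partial>sphere_measure)"
    using assms(3,4) by (intro nn_integral_sphere_cong) (simp add: powr_mult ennreal_mult)
  also have "\<dots> = ennreal (c powr enn2real p) * (\<integral>\<^sup>+\<zeta>. ennreal (u \<zeta> powr enn2real p) \<partial>sphere_measure)"
    using assms(5) by (intro nn_integral_cmult) measurable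
  also have "\<dots> \<le> ennreal (c powr enn2real p) * ennreal (A powr enn2real p)"
    using assms(1) False by (intro mult_left_mono) (auto simp: norm_le_def)
  also have "\<dots> = ennreal ((c * A) powr enn2real p)" using assms by (simp add: ennreal_mult powr_mult)
  finally show ?thesis using False by (simp add: norm_le_def)
qed

text \<open>
  The factor 2 comes from \<open>a + b \<le> 2 max a b\<close>, which is cruder than Minkowski's inequality but good
  enough for estimates up to constants.
\<close>
lemma norm_le_add:
  assumes p: "1 \<le> p" and u: "norm_le p A u" and v: "norm_le p B v" and AB: "0 \<le> A" "0 \<le> B"
    and [measurable]: "u \<in> borel_measurable sphere_measure" "v \<in> borel_measurable sphere_measure"
    and nn: "\<And>\<zeta>. norm \<zeta> = 1 \<Longrightarrow> 0 \<le> u \<zeta> \<and> 0 \<le> v \<zeta>"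
  shows "norm_le p (2 * (A + B)) (\<lambda>\<zeta>. u \<zeta> + v \<zeta>)"
proof (cases "p = \<infinity>")
  case True
  then show ?thesis using u v AB by (force simp: norm_le_def)
next
  case False
  let ?P = "enn2real p"
  have P: "1 \<le> ?P" using p False by (rule one_le_enn2real)
  have "(\<integral>\<^sup>+\<zeta>. ennreal ((u \<zeta> + v \<zeta>) powr ?P) \<partial>sphere_measure)
    \<le> (\<integral>\<^sup>+\<zeta>. ennreal (2 powr ?P) * (ennreal (u \<zeta> powr ?P) + ennreal (v \<zeta> powr ?P)) \<partial>sphere_measure)"
    using nn by (intro nn_integral_sphere_mono)
      (auto simp: ennreal_mult[symmetric] ennreal_plus[symmetric] simp del: ennreal_plus intro!: ennreal_leI powr_add_le)
  also have "\<dots> = ennreal (2 powr ?P) * ((\<integral>\<^sup>+\<zeta>. ennreal (u \<zeta> powr ?P) \<partial>sphere_measure)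
        + (\<integral>\<^sup>+\<zeta>. ennreal (v \<zeta> powr ?P) \<partial>sphere_measure))"
    by (simp add: nn_integral_cmult nn_integral_add)
  also have "\<dots> \<le> ennreal (2 powr ?P) * (ennreal (A powr ?P) + ennreal (B powr ?P))"
    using u v False by (intro mult_left_mono add_mono) (auto simp: norm_le_def)
  also have "\<dots> = ennreal (2 powr ?P * (A powr ?P + B powr ?P))"
    by (simp add: ennreal_mult ennreal_plus)
  also have "\<dots> \<le> ennreal ((2 * (A + B)) powr ?P)"
  proof (rule ennreal_leI)
    have sup: "A powr ?P + B powr ?P \<le> (A + B) powr ?P"
    proof (cases "A + B = 0")
      case True
      then have "A = 0" "B = 0" using AB by auto
      then show ?thesis by simp
    next
      case False
      have "A powr ?P = A * A powr (?P - 1)" "B powr ?P = B * B powr (?P - 1)"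
        "(A + B) powr ?P = (A + B) * (A + B) powr (?P - 1)"
        using AB False by (simp_all add: powr_mult_base)
      moreover have "A * A powr (?P - 1) \<le> A * (A + B) powr (?P - 1)"
        "B * B powr (?P - 1) \<le> B * (A + B) powr (?P - 1)"
        using AB P by (auto intro!: mult_left_mono powr_mono2)
      ultimately show ?thesis by (simp add: distrib_right)
    qed
    have "(2 * (A + B)) powr ?P = 2 powr ?P * (A + B) powr ?P"
      by (subst powr_mult) (use AB in auto)
    then show "2 powr ?P * (A powr ?P + B powr ?P) \<le> (2 * (A + B)) powr ?P"
      using sup by simp
  qed
  finally show ?thesis using False by (simp add: norm_le_def)
qed

lemma enn_powr_inverse_le_iff:
  assumes "P > 0" "0 \<le> A"
  shows "enn_powr x (1 / P) \<le> ennreal A \<longleftrightarrow> x \<le> ennreal (A powr P)"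
proof (cases x)
  case (real r)
  have "r powr (1 / P) \<le> A \<longleftrightarrow> r \<le> A powr P"
  proof
    assume "r powr (1 / P) \<le> A"
    then have "(r powr (1 / P)) powr P \<le> A powr P" using assms by (intro powr_mono2) auto
    then show "r \<le> A powr P" using assms real by (simp add: powr_powr)
  next
    assume "r \<le> A powr P"
    then have "r powr (1 / P) \<le> (A powr P) powr (1 / P)" using assms real by (intro powr_mono2) auto
    then show "r powr (1 / P) \<le> A" using assms by (simp add: powr_powr)
  qed
  then show ?thesis using real assms by (simp add: enn_powr_def ennreal_le_iff)
next
  case top
  have "enn_powr x (1 / P) = \<infinity>" by (simp only: top enn_powr_def infinity_ennreal_def if_True refl)
  then have "\<not> enn_powr x (1 / P) \<le> ennreal A" by (simp add: not_le)
  moreover have "\<not> x \<le> ennreal (A powr P)" unfolding top by (simp add: not_le)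
  ultimately show ?thesis by blast
qed

lemma measurable_sphere_continuous:
  "continuous_on (sphere 0 1) u \<Longrightarrow> u \<in> borel_measurable sphere_measure"
  using borel_measurable_continuous_on_restrict[of "sphere 0 1" u]
  unfolding measurable_cong_sets[OF sets_sphere_measure refl] by blast

lemma continuous_on_sphere_scale:
  fixes g :: "complex ^ 'N \<Rightarrow> 'b::topological_space"
  assumes "continuous_on (ball 0 1) g" "0 < r" "r < 1"
  shows "continuous_on (sphere 0 1) (\<lambda>\<zeta>. g (r *\<^sub>R \<zeta>))"
  by (rule continuous_on_compose2[OF assms(1)]) (use assms in \<open>auto intro!: continuous_intros\<close>)

lemma int_mean_le_iff:
  fixes g :: "complex ^ 'N \<Rightarrow> 'b::real_normed_vector"
  assumes p: "1 \<le> p" and g: "continuous_on (ball 0 1) g" and r: "0 < r" "r < 1" and A: "0 \<le> A"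
  shows "int_mean p r g \<le> ennreal A \<longleftrightarrow> norm_le p A (\<lambda>\<zeta>. norm (g (r *\<^sub>R \<zeta>)))"
proof (cases "p = \<infinity>")
  case True
  let ?u = "\<lambda>\<zeta>. ennreal (norm (g (r *\<^sub>R \<zeta>)))"
  have c: "continuous_on (sphere 0 1) ?u"
    by (intro continuous_on_ennreal continuous_on_norm continuous_on_sphere_scale g r)
  have m: "?u \<in> borel_measurable sphere_measure" by (rule measurable_sphere_continuous[OF c])
  have "esssup sphere_measure ?u \<le> ennreal A \<longleftrightarrow> (\<forall>\<zeta>\<in>sphere 0 1. ?u \<zeta> \<le> ennreal A)"
  proof
    assume le: "esssup sphere_measure ?u \<le> ennreal A"
    have "AE \<zeta> in sphere_measure. ?u \<zeta> \<le> ennreal A"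
      using esssup_AE[of ?u sphere_measure] by eventually_elim (use le in auto)
    from AE_sphere_continuous_le[OF c this] show "\<forall>\<zeta>\<in>sphere 0 1. ?u \<zeta> \<le> ennreal A" by auto
  next
    assume "\<forall>\<zeta>\<in>sphere 0 1. ?u \<zeta> \<le> ennreal A"
    then show "esssup sphere_measure ?u \<le> ennreal A"
      using m by (intro esssup_I AE_I2) (auto simp: space_sphere_measure)
  qed
  then show ?thesis using True A by (simp add: int_mean_def norm_le_def ennreal_le_iff)
next
  case False
  then have "1 \<le> enn2real p" using p by (intro one_le_enn2real)
  then show ?thesis using False A
    by (simp add: int_mean_def norm_le_def enn_powr_inverse_le_iff)
qed

section \<open>Holomorphic functions of several variables\<close>

abbreviation circ :: "real \<Rightarrow> real \<Rightarrow> complex" where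
  "circ \<delta> x \<equiv> of_real \<delta> * cis (2 * pi * x)"

text \<open>
  Circles are parametrized by the unit interval, so that a mean over a circle is an integral over a
  probability space.
\<close>
lemma Cauchy_integral_unit_interval:
  assumes F: "continuous_on (cball c \<delta>) F" "F holomorphic_on ball c \<delta>" and d: "\<delta> > 0"
  shows "((\<lambda>x. F (c + circ \<delta> x) / (circ \<delta> x) ^ k)
    has_integral (deriv ^^ k) F c / fact k) {0..1}"
proof -
  have e: "exp (2 * of_real pi * \<i> * of_real x) = cis (2 * pi * x)" for x
    by (simp add: cis_conv_exp mult.commute mult.left_commute)
  have cp: "circlepath c \<delta> x = c + circ \<delta> x" for x
    by (simp add: circlepath e)
  have "((\<lambda>u. F u / (u - c) ^ Suc k) has_contour_integral 2 * pi * \<i> / fact k * (deriv ^^ k) F c) (circlepath c \<delta>)"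
    using F d by (intro Cauchy_has_contour_integral_higher_derivative_circlepath) auto
  then have "((\<lambda>x. F (c + circ \<delta> x) / (circ \<delta> x) ^ Suc k
      * (2 * pi * \<i> * \<delta> * cis (2 * pi * x))) has_integral 2 * pi * \<i> / fact k * (deriv ^^ k) F c) {0..1}"
    unfolding has_contour_integral_def
    by (rule has_integral_cong[THEN iffD1, rotated])
       (simp add: vector_derivative_circlepath01 cp e)
  then have "((\<lambda>x. 1 / (2 * pi * \<i>) * (F (c + circ \<delta> x) / (circ \<delta> x) ^ Suc k
      * (2 * pi * \<i> * \<delta> * cis (2 * pi * x)))) has_integral
      1 / (2 * pi * \<i>) * (2 * pi * \<i> / fact k * (deriv ^^ k) F c)) {0..1}"
    by (rule has_integral_mult_right)
  moreover have "1 / (2 * pi * \<i>) * (2 * pi * \<i> / fact k * (deriv ^^ k) F c) = (deriv ^^ k) F c / fact k"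
    by (simp add: divide_simps)
  moreover have "1 / (2 * pi * \<i>) * (F (c + circ \<delta> x) / (circ \<delta> x) ^ Suc k
      * (2 * pi * \<i> * \<delta> * cis (2 * pi * x))) = F (c + circ \<delta> x) / (circ \<delta> x) ^ k" for x
    using d by (simp add: divide_simps)
  ultimately show ?thesis by simp
qed

abbreviation hol :: "(complex ^ 'N \<Rightarrow> complex) \<Rightarrow> bool" where
  "hol f \<equiv> mv_holomorphic_on f (ball 0 1)"

definition dir_deriv :: "complex ^ 'N \<Rightarrow> (complex ^ 'N \<Rightarrow> complex) \<Rightarrow> complex ^ 'N \<Rightarrow> complex" where
  "dir_deriv v f z = (\<Sum>j\<in>UNIV. v $ j * partial_deriv j f z)"

definition radial :: "(complex ^ 'N \<Rightarrow> complex) \<Rightarrow> complex ^ 'N \<Rightarrow> complex" where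
  "radial f z = dir_deriv z f z"

lemma axis_scale: "axis j (c :: complex) = c *s axis j 1"
  by (simp add: axis_def vec_eq_iff)

lemma norm_axis_complex: "norm (axis j (c :: complex)) = cmod c"
  unfolding axis_scale[of j c] norm_vector_scale by (simp add: norm_vec_def L2_set_def axis_def if_distrib[of cmod] if_distrib[of "\<lambda>x. x\<^sup>2"] cong: if_cong)

lemma bounded_linear_vector_scale: "bounded_linear (\<lambda>w::complex. w *s (v :: complex ^ 'N))"
  by (rule bounded_linear_intro[of _ "norm v"])
     (simp_all add: norm_vector_scale vec_eq_iff algebra_simps)

lemma has_derivative_line:
  fixes f :: "complex ^ 'N \<Rightarrow> complex"
  assumes "(f has_derivative D) (at (z + w *s v))" "\<And>c v. D (c *s v) = c * D v"
  shows "((\<lambda>w. f (z + w *s v)) has_field_derivative D v) (at w)"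
proof -
  have "((\<lambda>w. z + w *s v) has_derivative (\<lambda>w. 0 + w *s v)) (at w)"
    by (intro has_derivative_add has_derivative_const bounded_linear_imp_has_derivative
        bounded_linear_vector_scale)
  from has_derivative_compose[OF this assms(1)]
  have "((\<lambda>w. f (z + w *s v)) has_derivative (\<lambda>x. x * D v)) (at w)" by (simp add: assms(2))
  then show ?thesis by (simp add: has_field_derivative_def mult.commute[of _ "D v"] mult_commute_abs)
qed

lemma partial_deriv_eqI:
  assumes "(f has_derivative D) (at z)" "\<And>c v. D (c *s v) = c * D v"
  shows "partial_deriv j f z = D (axis j 1)"
proof -
  have "((\<lambda>w. f (z + w *s axis j 1)) has_field_derivative D (axis j 1)) (at 0)"
    by (rule has_derivative_line) (use assms in simp_all)
  then show ?thesis unfolding partial_deriv_def axis_scale[of j, symmetric] by (rule DERIV_imp_deriv)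
qed

lemma hol_has_derivative:
  fixes f :: "complex ^ 'N \<Rightarrow> complex"
  assumes "hol f" "norm z < 1"
  shows "(f has_derivative (\<lambda>v. dir_deriv v f z)) (at z)"
proof -
  have zb: "z \<in> ball 0 1" using assms(2) by simp
  obtain D where D: "(f has_derivative D) (at z within ball 0 1)" "\<And>c v. D (c *s v) = c * D v"
    using bspec[OF assms(1)[unfolded mv_holomorphic_on_def] zb] by blast
  have D1: "(f has_derivative D) (at z)" using D(1) unfolding at_within_open[OF zb open_ball] .
  have "D v = dir_deriv v f z" for v
  proof -
    have lin: "linear D" using D1 by (rule has_derivative_linear)
    have "D v = D (\<Sum>j\<in>UNIV. v $ j *s axis j 1)" by (simp only: basis_expansion)
    also have "\<dots> = (\<Sum>j\<in>UNIV. v $ j * D (axis j 1))" by (simp only: linear_sum[OF lin] D(2))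
    also have "\<dots> = dir_deriv v f z"
      unfolding dir_deriv_def by (intro sum.cong refl arg_cong2[where f = times] partial_deriv_eqI[OF D1 D(2), symmetric])
    finally show ?thesis .
  qed
  then have "D = (\<lambda>v. dir_deriv v f z)" by (rule ext)
  then show ?thesis using D1 by simp
qed

lemma holI:
  fixes f :: "complex ^ 'N \<Rightarrow> complex"
  assumes "\<And>z. norm z < 1 \<Longrightarrow> (f has_derivative D z) (at z)"
    "\<And>z c v. norm z < 1 \<Longrightarrow> D z (c *s v) = c * D z v"
  shows "hol f"
  unfolding mv_holomorphic_on_def
proof
  fix z :: "complex ^ 'N" assume "z \<in> ball 0 1"
  then show "\<exists>D. (f has_derivative D) (at z within ball 0 1) \<and> (\<forall>c v. D (c *s v) = c * D v)"
    using assms(1)[of z] assms(2)[of z]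
    by (intro exI[of _ "D z"]) (simp add: has_derivative_at_withinI)
qed

lemma dir_deriv_scale: "dir_deriv (c *s v) f z = c * dir_deriv v f z"
  by (simp add: dir_deriv_def sum_distrib_left mult.assoc)

lemma dir_deriv_add: "dir_deriv (v + w) f z = dir_deriv v f z + dir_deriv w f z"
  by (simp add: dir_deriv_def sum.distrib distrib_right)

lemma dir_deriv_axis: "dir_deriv (axis j c) f z = c * partial_deriv j f z"
proof -
  have "dir_deriv (axis j c) f z = (\<Sum>i\<in>UNIV. if i = j then c * partial_deriv j f z else 0)"
    unfolding dir_deriv_def by (intro sum.cong) (auto simp: axis_def)
  then show ?thesis by simp
qed

lemma hol_continuous: "hol f \<Longrightarrow> continuous_on (ball 0 1) f"
  by (intro continuous_at_imp_continuous_on)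
     (auto intro!: has_derivative_continuous[OF hol_has_derivative])

lemma hol_line:
  assumes "hol f" "norm (z + w *s v) < 1"
  shows "((\<lambda>w. f (z + w *s v)) has_field_derivative dir_deriv v f (z + w *s v)) (at w)"
  by (rule has_derivative_line[OF hol_has_derivative[OF assms]]) (rule dir_deriv_scale)

lemma hol_const: "hol (\<lambda>_. c)"
  by (rule holI[of _ "\<lambda>_ _. 0"]) auto

lemma hol_coord: "hol (\<lambda>z. z $ j)"
  by (rule holI[of _ "\<lambda>_ v. v $ j"]) (auto intro: bounded_linear_imp_has_derivative bounded_linear_vec_nth)

lemma hol_add:
  assumes "hol f" "hol g" shows "hol (\<lambda>z. f z + g z)"
  by (rule holI[of _ "\<lambda>z v. dir_deriv v f z + dir_deriv v g z"])
     (use assms in \<open>auto intro!: has_derivative_add hol_has_derivative simp: dir_deriv_scale distrib_left\<close>)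

lemma hol_mult:
  assumes "hol f" "hol g" shows "hol (\<lambda>z. f z * g z)"
  by (rule holI[of _ "\<lambda>z v. f z * dir_deriv v g z + dir_deriv v f z * g z"])
     (use assms in \<open>auto intro!: has_derivative_mult hol_has_derivative simp: dir_deriv_scale distrib_left\<close>)

lemma hol_sum: "finite I \<Longrightarrow> (\<And>i. i \<in> I \<Longrightarrow> hol (f i)) \<Longrightarrow> hol (\<lambda>z. \<Sum>i\<in>I. f i z)"
  by (induction I rule: finite_induct) (auto intro: hol_const hol_add)

lemma partial_deriv_add:
  assumes "hol f" "hol g" "norm z < 1"
  shows "partial_deriv j (\<lambda>z. f z + g z) z = partial_deriv j f z + partial_deriv j g z"
  using partial_deriv_eqI[OF has_derivative_add[OF hol_has_derivative hol_has_derivative], OF assms(1,3) assms(2,3)]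
  by (simp add: dir_deriv_scale distrib_left dir_deriv_axis)

lemma partial_deriv_mult:
  assumes "hol f" "hol g" "norm z < 1"
  shows "partial_deriv j (\<lambda>z. f z * g z) z = f z * partial_deriv j g z + partial_deriv j f z * g z"
  using partial_deriv_eqI[OF has_derivative_mult[OF hol_has_derivative hol_has_derivative], OF assms(1,3) assms(2,3)]
  by (simp add: dir_deriv_scale distrib_left dir_deriv_axis)

lemma partial_deriv_const: "partial_deriv j (\<lambda>_. c) z = 0"
  by (simp add: partial_deriv_def)

lemma partial_deriv_coord: "partial_deriv j (\<lambda>z. z $ k) z = (if j = k then 1 else 0)"
proof -
  have "partial_deriv j (\<lambda>z. z $ k) z = axis j 1 $ k"
    by (rule partial_deriv_eqI) (auto intro: bounded_linear_imp_has_derivative bounded_linear_vec_nth)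
  then show ?thesis by (simp add: axis_def)
qed

lemma partial_deriv_sum:
  assumes "finite I" "\<And>i. i \<in> I \<Longrightarrow> hol (f i)" "norm z < 1"
  shows "partial_deriv j (\<lambda>z. \<Sum>i\<in>I. f i z) z = (\<Sum>i\<in>I. partial_deriv j (f i) z)"
  using assms by (induction I rule: finite_induct) (auto simp: partial_deriv_const partial_deriv_add hol_sum)

text \<open>
  The hypothesis only asks that the disc lies in the ball. For \<open>v\<close> orthogonal to \<open>z\<close> this admits
  radii far larger than \<open>1 - \<bar>z\<bar>\<close>.
\<close>
lemma hol_disc:
  assumes f: "hol f" and n: "\<And>w. cmod w \<le> \<delta> \<Longrightarrow> norm (z + w *s v) < 1" and d: "\<delta> > 0"
  shows "(\<lambda>w. f (z + w *s v)) holomorphic_on ball 0 \<delta>" "continuous_on (cball 0 \<delta>) (\<lambda>w. f (z + w *s v))"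
    "deriv (\<lambda>w. f (z + w *s v)) 0 = dir_deriv v f z"
proof -
  have der: "((\<lambda>w. f (z + w *s v)) has_field_derivative dir_deriv v f (z + w *s v)) (at w)"
    if "w \<in> cball 0 \<delta>" for w
    using that by (intro hol_line[OF f n]) simp
  show "(\<lambda>w. f (z + w *s v)) holomorphic_on ball 0 \<delta>"
    unfolding holomorphic_on_open[OF open_ball] using der by (metis ball_subset_cball subset_iff)
  show "continuous_on (cball 0 \<delta>) (\<lambda>w. f (z + w *s v))"
    using der by (meson DERIV_isCont continuous_at_imp_continuous_on)
  show "deriv (\<lambda>w. f (z + w *s v)) 0 = dir_deriv v f z"
    using DERIV_imp_deriv[OF der[of 0]] d by simp
qed

lemma dir_deriv_integral:
  assumes "hol f" "\<And>w. cmod w \<le> \<delta> \<Longrightarrow> norm (z + w *s v) < 1" "\<delta> > 0"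
  shows "((\<lambda>x. f (z + (circ \<delta> x) *s v) / (circ \<delta> x))
    has_integral dir_deriv v f z) {0..1}"
  using Cauchy_integral_unit_interval[OF hol_disc(2,1)[OF assms] assms(3), of 1] hol_disc(3)[OF assms]
  by simp

lemma mean_value_integral:
  assumes "hol f" "\<And>w. cmod w \<le> \<delta> \<Longrightarrow> norm (z + w *s v) < 1" "\<delta> > 0"
  shows "((\<lambda>x. f (z + (circ \<delta> x) *s v)) has_integral f z) {0..1}"
  using Cauchy_integral_unit_interval[OF hol_disc(2,1)[OF assms] assms(3), of 0] by simp

lemma norm_disc_less:
  assumes "norm z + \<delta> * norm v < 1" "cmod w \<le> \<delta>"
  shows "norm (z + w *s (v :: complex ^ 'N)) < 1"
proof -
  have "norm (z + w *s v) \<le> norm z + cmod w * norm v"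
    using norm_triangle_ineq[of z "w *s v"] by (simp add: norm_vector_scale)
  also have "\<dots> \<le> norm z + \<delta> * norm v" using assms(2) by (intro add_left_mono mult_right_mono) auto
  finally show ?thesis using assms(1) by simp
qed

lemma continuous_circle_shift:
  fixes f :: "complex ^ 'N \<Rightarrow> complex"
  assumes "continuous_on (ball 0 1) f" "\<rho> + \<delta> * norm v \<le> 1" "\<delta> > 0"
  shows "continuous_on (ball 0 \<rho> \<times> cbox 0 1)
    (\<lambda>(z, x). f (z + (circ \<delta> x) *s v) / (circ \<delta> x))"
proof -
  have "continuous_on (ball 0 \<rho> \<times> cbox 0 1) (\<lambda>p. f (fst p + (circ \<delta> (snd p)) *s v))"
  proof (rule continuous_on_compose2[OF assms(1)])
    show "continuous_on (ball 0 \<rho> \<times> cbox 0 1) (\<lambda>p. fst p + (circ \<delta> (snd p)) *s v)"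
      by (intro continuous_intros bounded_linear.continuous_on[OF bounded_linear_vector_scale])
    show "(\<lambda>p. fst p + (circ \<delta> (snd p)) *s v) ` (ball 0 \<rho> \<times> cbox 0 1) \<subseteq> ball 0 1"
    proof safe
      fix z :: "complex ^ 'N" and x :: real assume "z \<in> ball 0 \<rho>"
      then have "norm (z + (circ \<delta> x) *s v) < \<rho> + \<delta> * norm v"
        using norm_triangle_ineq[of z "(circ \<delta> x) *s v"] assms(3)
        by (simp add: norm_vector_scale norm_mult)
      then show "fst (z, x) + (circ \<delta> (snd (z, x))) *s v \<in> ball 0 1" using assms(2) by simp
    qed
  qed
  then show ?thesis using assms(3) by (auto simp: split_beta' intro!: continuous_intros)
qed

lemma ball_margin:
  fixes z :: "complex ^ 'N"
  assumes "norm z < 1"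
  obtains \<rho> \<delta> where "norm z < \<rho>" "\<delta> > 0" "\<rho> + \<delta> \<le> 1"
  using assms that[of "(1 + norm z) / 2" "(1 - norm z) / 2"] by (simp add: field_simps)

lemma partial_deriv_eq_integral:
  fixes f :: "complex ^ 'N \<Rightarrow> complex"
  assumes "hol f" "norm z < \<rho>" "\<delta> > 0" "\<rho> + \<delta> \<le> 1"
  shows "partial_deriv j f z = integral (cbox 0 1)
      (\<lambda>x. f (z + (circ \<delta> x) *s axis j 1) / (circ \<delta> x))"
proof -
  have "norm z + \<delta> * norm (axis j 1 :: complex ^ 'N) < 1" using assms by (simp add: norm_axis_complex)
  from dir_deriv_integral[OF assms(1) norm_disc_less[OF this] assms(3)]
  show ?thesis by (simp add: dir_deriv_axis integral_unique)
qed

text \<open>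
  By Cauchy's formula a partial derivative is an integral of \<open>f\<close> over a circle, with a fixed radius
  near a given point.
\<close>
lemma partial_deriv_continuous:
  fixes f :: "complex ^ 'N \<Rightarrow> complex"
  assumes "hol f" shows "continuous_on (ball 0 1) (partial_deriv j f)"
proof (rule continuous_at_imp_continuous_on, rule ballI)
  fix z :: "complex ^ 'N" assume "z \<in> ball 0 1"
  then obtain \<rho> \<delta> where r: "norm z < \<rho>" "\<delta> > 0" "\<rho> + \<delta> \<le> 1" using ball_margin by auto
  have "continuous_on (ball 0 \<rho>) (\<lambda>z. integral (cbox 0 1)
      (\<lambda>x. f (z + (circ \<delta> x) *s axis j 1) / (circ \<delta> x)))"
    using r by (intro integral_continuous_on_param continuous_circle_shift hol_continuous assms)
      (auto simp: norm_axis_complex)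
  then have "continuous_on (ball 0 \<rho>) (partial_deriv j f)"
    by (rule continuous_on_eq) (use partial_deriv_eq_integral[OF assms _ r(2,3)] in auto)
  then show "isCont (partial_deriv j f) z"
    using r by (auto simp: continuous_on_eq_continuous_at)
qed

text \<open>
  Differentiation under the integral sign in Cauchy's formula. The derivative is complex linear, so
  that \<open>\<partial>\<^sub>jf\<close> is holomorphic again; and its coefficients are Cauchy integrals of the \<open>\<partial>\<^sub>kf\<close>, which
  gives \<open>\<partial>\<^sub>k\<partial>\<^sub>jf = \<partial>\<^sub>j\<partial>\<^sub>kf\<close>.
\<close>
lemma partial_deriv_has_derivative:
  fixes f :: "complex ^ 'N \<Rightarrow> complex"
  assumes f: "hol f" and r: "norm z < \<rho>" "\<delta> > 0" "\<rho> + \<delta> \<le> 1"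
  shows "(partial_deriv j f has_derivative (\<lambda>v. \<Sum>k\<in>UNIV. v $ k * integral (cbox 0 1)
     (\<lambda>x. partial_deriv k f (z + (circ \<delta> x) *s axis j 1) / (circ \<delta> x)))) (at z)"
proof -
  define s where "s x = (circ \<delta> x) *s (axis j 1 :: complex ^ 'N)" for x
  define e where "e x = circ \<delta> x" for x
  define D where "D y x = Blinfun (\<lambda>v. dir_deriv v f (y + s x) / e x)" for y x
  have bl: "bounded_linear (\<lambda>v. dir_deriv v f y / w)" for y w
    unfolding dir_deriv_def divide_inverse sum_distrib_right
    by (intro bounded_linear_sum bounded_linear_mult_const bounded_linear_vec_nth)
  have D: "blinfun_apply (D y x) v = dir_deriv v f (y + s x) / e x" for y x v
    unfolding D_def by (simp add: bounded_linear_Blinfun_apply[OF bl])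
  have cpd: "continuous_on (ball 0 \<rho> \<times> cbox 0 1) (\<lambda>(y, x). partial_deriv k f (y + s x) / e x)" for k
    unfolding s_def e_def using r
    by (intro continuous_circle_shift partial_deriv_continuous f) (auto simp: norm_axis_complex)
  have cD: "continuous_on (ball 0 \<rho> \<times> cbox 0 1) (\<lambda>(y, x). D y x)"
  proof (rule continuous_on_blinfun_componentwise)
    fix i :: "complex ^ 'N"
    have "continuous_on (ball 0 \<rho> \<times> cbox 0 1) (\<lambda>p. \<Sum>k\<in>UNIV. i $ k * (partial_deriv k f (fst p + s (snd p)) / e (snd p)))"
      using cpd by (intro continuous_on_sum continuous_on_mult continuous_on_const) (simp add: split_beta')
    then show "continuous_on (ball 0 \<rho> \<times> cbox 0 1) (\<lambda>p. blinfun_apply (case p of (y, x) \<Rightarrow> D y x) i)"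
      by (simp add: D split_beta' dir_deriv_def sum_divide_distrib)
  qed
  have ns: "norm (y + s x) < 1" if "y \<in> ball 0 \<rho>" for y x
  proof -
    have "norm (s x) = \<delta>" using r by (simp add: s_def norm_vector_scale norm_mult norm_axis_complex)
    then show ?thesis using that r norm_triangle_ineq[of y "s x"] by simp
  qed
  have zr: "z \<in> ball 0 \<rho>" using r by simp
  have sl: "continuous_on (cbox 0 1) (\<lambda>x. F (y, x))" if "continuous_on (ball 0 \<rho> \<times> cbox 0 1) F" "y \<in> ball 0 \<rho>"
    for F :: "(complex ^ 'N) \<times> real \<Rightarrow> 'b::topological_space" and y
    by (rule continuous_on_compose2[OF that(1)]) (use that(2) in \<open>auto intro!: continuous_intros\<close>)
  have "((\<lambda>y. integral (cbox 0 1) (\<lambda>x. f (y + s x) / e x)) has_derivative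
      blinfun_apply (integral (cbox 0 1) (D z))) (at z within ball 0 \<rho>)"
  proof (rule leibniz_rule[OF _ _ cD zr])
    fix y x assume y: "y \<in> ball (0 :: complex ^ 'N) \<rho>" and "x \<in> cbox (0::real) 1"
    have "((\<lambda>y. y + s x) has_derivative (\<lambda>v. v)) (at y)"
      by (auto intro!: derivative_eq_intros)
    from has_derivative_compose[OF this hol_has_derivative[OF f ns[OF y]]]
    have "((\<lambda>y. f (y + s x)) has_derivative (\<lambda>v. dir_deriv v f (y + s x))) (at y)" .
    then have "((\<lambda>y. inverse (e x) * f (y + s x)) has_derivative (\<lambda>v. inverse (e x) * dir_deriv v f (y + s x))) (at y)"
      by (rule has_derivative_mult_right)
    moreover have "(\<lambda>v. inverse (e x) * dir_deriv v f (y + s x)) = blinfun_apply (D y x)"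
      by (rule ext) (simp add: D divide_inverse mult.commute)
    moreover have "(\<lambda>y. inverse (e x) * f (y + s x)) = (\<lambda>y. f (y + s x) / e x)"
      by (rule ext) (simp add: divide_inverse mult.commute)
    ultimately have "((\<lambda>y. f (y + s x) / e x) has_derivative blinfun_apply (D y x)) (at y)" by (simp only:)
    then show "((\<lambda>y. f (y + s x) / e x) has_derivative blinfun_apply (D y x)) (at y within ball 0 \<rho>)"
      by (rule has_derivative_at_withinI)
  next
    show "convex (ball (0 :: complex ^ 'N) \<rho>)" by (rule convex_ball)
  next
    fix y assume y: "y \<in> ball (0 :: complex ^ 'N) \<rho>"
    have "continuous_on (ball 0 \<rho> \<times> cbox 0 1) (\<lambda>(y, x). f (y + s x) / e x)"
      unfolding s_def e_def using r
      by (intro continuous_circle_shift hol_continuous f) (auto simp: norm_axis_complex)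
    from sl[OF this y] show "(\<lambda>x. f (y + s x) / e x) integrable_on cbox 0 1"
      by (intro integrable_continuous) simp
  qed
  moreover have "blinfun_apply (integral (cbox 0 1) (D z)) = (\<lambda>v. (\<Sum>k\<in>UNIV. v $ k * integral (cbox 0 1)
     (\<lambda>x. partial_deriv k f (z + s x) / e x)))"
  proof
    fix v
    have "D z integrable_on cbox 0 1"
      using sl[OF cD zr] by (intro integrable_continuous) simp
    then have "blinfun_apply (integral (cbox 0 1) (D z)) v
        = integral (cbox 0 1) (\<lambda>x. \<Sum>k\<in>UNIV. v $ k * (partial_deriv k f (z + s x) / e x))"
      by (simp add: blinfun_apply_integral D dir_deriv_def sum_divide_distrib)
    also have "\<dots> = (\<Sum>k\<in>UNIV. integral (cbox 0 1) (\<lambda>x. v $ k * (partial_deriv k f (z + s x) / e x)))"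
      using sl[OF cpd zr]
      by (intro integral_sum integrable_continuous continuous_on_mult continuous_on_const) simp_all
    finally show "blinfun_apply (integral (cbox 0 1) (D z)) v = (\<Sum>k\<in>UNIV. v $ k * integral (cbox 0 1)
        (\<lambda>x. partial_deriv k f (z + s x) / e x))" unfolding integral_mult_right .
  qed
  ultimately have der: "((\<lambda>y. integral (cbox 0 1) (\<lambda>x. f (y + s x) / e x)) has_derivative
      (\<lambda>v. \<Sum>k\<in>UNIV. v $ k * integral (cbox 0 1) (\<lambda>x. partial_deriv k f (z + s x) / e x))) (at z within ball 0 \<rho>)"
    by (simp only:)
  have eq: "partial_deriv j f y = integral (cbox 0 1) (\<lambda>x. f (y + s x) / e x)" if "y \<in> ball 0 \<rho>" for y
    unfolding s_def e_def using that by (intro partial_deriv_eq_integral[OF f _ r(2,3)]) simp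
  have "(partial_deriv j f has_derivative
      (\<lambda>v. \<Sum>k\<in>UNIV. v $ k * integral (cbox 0 1) (\<lambda>x. partial_deriv k f (z + s x) / e x))) (at z within ball 0 \<rho>)"
    by (rule has_derivative_transform[OF zr eq der])
  then show ?thesis unfolding s_def e_def at_within_open[OF zr open_ball] .
qed

lemma hol_partial_deriv:
  fixes f :: "complex ^ 'N \<Rightarrow> complex"
  assumes "hol f" shows "hol (partial_deriv j f)"
  unfolding mv_holomorphic_on_def
proof
  fix z :: "complex ^ 'N" assume "z \<in> ball 0 1"
  then obtain \<rho> \<delta> where r: "norm z < \<rho>" "\<delta> > 0" "\<rho> + \<delta> \<le> 1" using ball_margin by auto
  show "\<exists>D. (partial_deriv j f has_derivative D) (at z within ball 0 1) \<and> (\<forall>c v. D (c *s v) = c * D v)"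
    by (rule exI, rule conjI, rule has_derivative_at_withinI, rule partial_deriv_has_derivative[OF assms r])
       (simp add: sum_distrib_left mult.assoc)
qed

lemma partial_deriv_commute:
  assumes f: "hol f" and z: "norm z < 1"
  shows "partial_deriv k (partial_deriv j f) z = partial_deriv j (partial_deriv k f) z"
proof -
  obtain \<rho> \<delta> where r: "norm z < \<rho>" "\<delta> > 0" "\<rho> + \<delta> \<le> 1" using ball_margin[OF z] by auto
  let ?I = "\<lambda>k. integral (cbox 0 1)
     (\<lambda>x. partial_deriv k f (z + (circ \<delta> x) *s axis j 1) / (circ \<delta> x))"
  have "partial_deriv k (partial_deriv j f) z = (\<Sum>i\<in>UNIV. axis k 1 $ i * ?I i)"
    by (rule partial_deriv_eqI[OF partial_deriv_has_derivative[OF f r]])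
       (simp add: sum_distrib_left mult.assoc)
  also have "\<dots> = (\<Sum>i\<in>UNIV. if i = k then ?I k else 0)"
    by (intro sum.cong) (auto simp: axis_def)
  also have "\<dots> = ?I k" by simp
  also have "\<dots> = partial_deriv j (partial_deriv k f) z"
    by (rule partial_deriv_eq_integral[OF hol_partial_deriv[OF f] r, symmetric])
  finally show ?thesis .
qed

lemma hol_radial: "hol f \<Longrightarrow> hol (radial f)"
  unfolding radial_def[abs_def] dir_deriv_def
  by (intro hol_sum hol_mult hol_coord hol_partial_deriv) auto

lemma partial_deriv_radial:
  assumes f: "hol f" and z: "norm z < 1"
  shows "partial_deriv j (radial f) z = partial_deriv j f z + radial (partial_deriv j f) z"
proof -
  have c: "partial_deriv j (partial_deriv k f) z = partial_deriv k (partial_deriv j f) z" for k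
    by (rule partial_deriv_commute[OF f z])
  have "partial_deriv j (radial f) z = (\<Sum>k\<in>UNIV. partial_deriv j (\<lambda>z. z $ k * partial_deriv k f z) z)"
    unfolding radial_def[abs_def] dir_deriv_def
    using z by (intro partial_deriv_sum hol_mult hol_coord hol_partial_deriv f) simp_all
  also have "\<dots> = (\<Sum>k\<in>UNIV. z $ k * partial_deriv k (partial_deriv j f) z
      + (if j = k then partial_deriv k f z else 0))"
    by (intro sum.cong refl)
      (simp add: partial_deriv_mult[OF hol_coord hol_partial_deriv[OF f] z] partial_deriv_coord c)
  also have "\<dots> = (\<Sum>k\<in>UNIV. z $ k * partial_deriv k (partial_deriv j f) z) + partial_deriv j f z"
    by (simp add: sum.distrib)
  finally show ?thesis by (simp add: radial_def dir_deriv_def)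
qed

section \<open>Means over spheres and circle orbits\<close>

text \<open>
  A bound for the means at all radii below \<open>r\<close>. Ranging over all smaller radii makes the bound monotone
  in \<open>r\<close> by definition, and leaving out \<open>r\<close> itself makes the least bound continuous from the left.
\<close>
definition mean_le :: "ennreal \<Rightarrow> real \<Rightarrow> real \<Rightarrow> (complex ^ 'N \<Rightarrow> complex) \<Rightarrow> bool" where
  "mean_le p r A g \<longleftrightarrow> (\<forall>\<rho>. 0 < \<rho> \<longrightarrow> \<rho> < r \<longrightarrow> norm_le p A (\<lambda>\<zeta>. cmod (g (\<rho> *\<^sub>R \<zeta>))))"

text \<open>
  Extension by zero makes the function Borel on the whole space, hence measurable after composition
  with any Borel map of several parameters.
\<close>
definition ball_norm :: "(complex ^ 'N \<Rightarrow> complex) \<Rightarrow> complex ^ 'N \<Rightarrow> real" where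
  "ball_norm g z = (if z \<in> ball 0 1 then cmod (g z) else 0)"

lemma ball_norm_nonneg: "0 \<le> ball_norm g z"
  by (simp add: ball_norm_def)

lemma ball_norm_eq: "norm z < 1 \<Longrightarrow> ball_norm g z = cmod (g z)"
  by (simp add: ball_norm_def)

lemma ball_norm_measurable:
  assumes "continuous_on (ball 0 1) g" shows "ball_norm g \<in> borel_measurable borel"
  unfolding ball_norm_def[abs_def]
  by (rule borel_measurable_continuous_on_if) (use assms in \<open>auto intro: continuous_on_norm\<close>)

lemma norm_le_cong:
  assumes "\<And>\<zeta>. norm \<zeta> = 1 \<Longrightarrow> u \<zeta> = v \<zeta>"
  shows "norm_le p A u \<longleftrightarrow> norm_le p A v"
proof -
  have "(\<integral>\<^sup>+\<zeta>. ennreal (u \<zeta> powr enn2real p) \<partial>sphere_measure) = (\<integral>\<^sup>+\<zeta>. ennreal (v \<zeta> powr enn2real p) \<partial>sphere_measure)"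
    by (rule nn_integral_sphere_cong) (simp add: assms)
  then show ?thesis using assms by (simp add: norm_le_def)
qed

lemma mean_le_cong:
  assumes "\<And>z. norm z < 1 \<Longrightarrow> g z = h z" "r \<le> 1"
  shows "mean_le p r A g \<longleftrightarrow> mean_le p r A h"
  unfolding mean_le_def using assms by (auto cong: norm_le_cong)

lemma mean_le_mono:
  assumes "mean_le p r A g" "r' \<le> r" "0 \<le> A" "A \<le> B"
  shows "mean_le p r' B g"
  unfolding mean_le_def
proof (intro allI impI)
  fix \<rho> assume "0 < \<rho>" "\<rho> < r'"
  then have "norm_le p A (\<lambda>\<zeta>. cmod (g (\<rho> *\<^sub>R \<zeta>)))" using assms by (simp add: mean_le_def)
  then show "norm_le p B (\<lambda>\<zeta>. cmod (g (\<rho> *\<^sub>R \<zeta>)))"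
    by (rule norm_le_mono[OF _ _ assms(3,4)]) simp
qed

lemma measurable_mean:
  assumes "continuous_on (ball 0 1) g" "0 < \<rho>" "\<rho> < 1"
  shows "(\<lambda>\<zeta>. cmod (g (\<rho> *\<^sub>R \<zeta>))) \<in> borel_measurable sphere_measure"
  by (intro measurable_sphere_continuous continuous_on_norm continuous_on_sphere_scale assms)

lemma mean_le_scale:
  assumes "mean_le p r A g" "continuous_on (ball 0 1) g" "r \<le> 1" "0 \<le> A"
  shows "mean_le p r (cmod c * A) (\<lambda>z. c * g z)"
  using assms unfolding mean_le_def norm_mult
  by (auto intro!: norm_le_scale measurable_mean)

lemma mean_le_add:
  assumes "1 \<le> p" "mean_le p r A g" "mean_le p r B h" "continuous_on (ball 0 1) g"
    "continuous_on (ball 0 1) h" "r \<le> 1" "0 \<le> A" "0 \<le> B"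
  shows "mean_le p r (2 * (A + B)) (\<lambda>z. g z + h z)"
  unfolding mean_le_def
proof (intro allI impI)
  fix \<rho> assume r: "0 < \<rho>" "\<rho> < r"
  have "norm_le p (2 * (A + B)) (\<lambda>\<zeta>. cmod (g (\<rho> *\<^sub>R \<zeta>)) + cmod (h (\<rho> *\<^sub>R \<zeta>)))"
    using assms r by (intro norm_le_add measurable_mean) (auto simp: mean_le_def)
  then show "norm_le p (2 * (A + B)) (\<lambda>\<zeta>. cmod (g (\<rho> *\<^sub>R \<zeta>) + h (\<rho> *\<^sub>R \<zeta>)))"
    by (rule norm_le_mono) (use assms in \<open>auto intro: norm_triangle_ineq\<close>)
qed

lemma bounded_bilinear_vector_scale:
  "bounded_bilinear (\<lambda>(w::complex) (v :: complex ^ 'N). w *s v)"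
  by (rule bounded_bilinear.intro)
     (auto simp: vec_eq_iff algebra_simps norm_vector_scale intro!: exI[of _ 1])

lemma borel_measurable_vector_scale [measurable (raw)]:
  fixes g :: "'a \<Rightarrow> complex ^ 'N"
  assumes "f \<in> borel_measurable M" "g \<in> borel_measurable M"
  shows "(\<lambda>x. f x *s g x) \<in> borel_measurable M"
  using assms
  by (rule borel_measurable_continuous_Pair)
     (intro bounded_bilinear.continuous_on[OF bounded_bilinear_vector_scale] continuous_intros)

text \<open>
  The measure is invariant under multiplication by unimodular numbers, so that only the modulus of
  the factor matters.
\<close>
lemma norm_le_rotate:
  fixes g :: "complex ^ 'N \<Rightarrow> complex"
  assumes g: "continuous_on (ball 0 1) g" and w: "0 < cmod w" "cmod w < 1"
    and n: "norm_le p A (\<lambda>\<zeta>. cmod (g (cmod w *\<^sub>R \<zeta>)))"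
  shows "norm_le p A (\<lambda>\<zeta>. cmod (g (w *s \<zeta>)))"
proof -
  define c where "c = sgn w"
  have c: "cmod c = 1" using w by (simp add: c_def norm_sgn)
  have wc: "w *s \<zeta> = cmod w *\<^sub>R (c *s \<zeta>)" for \<zeta> :: "complex ^ 'N"
  proof -
    have "w = complex_of_real (cmod w) * c" using w by (simp add: c_def sgn_eq)
    then have "w *s \<zeta> = complex_of_real (cmod w) *s (c *s \<zeta>)" by (metis vector_smult_assoc)
    then show ?thesis by (simp only: of_real_scale)
  qed
  have U: "unitary_map (\<lambda>\<zeta> :: complex ^ 'N. c *s \<zeta>)" using c by (rule unitary_map_scale)
  show ?thesis
  proof (cases "p = \<infinity>")
    case True
    then show ?thesis using n c unfolding norm_le_def wc by (simp add: norm_vector_scale)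
  next
    case False
    have m: "(\<lambda>\<zeta>. ennreal (ball_norm g (cmod w *\<^sub>R \<zeta>) powr enn2real p)) \<in> borel_measurable borel"
      using ball_norm_measurable[OF g] by measurable
    have eq: "(\<integral>\<^sup>+\<zeta>. ennreal (cmod (g (cmod w *\<^sub>R T \<zeta>)) powr enn2real p) \<partial>sphere_measure)
      = (\<integral>\<^sup>+\<zeta>. ennreal (ball_norm g (cmod w *\<^sub>R T \<zeta>) powr enn2real p) \<partial>sphere_measure)"
      if "\<And>\<zeta>. norm (T \<zeta>) = norm \<zeta>" for T :: "complex ^ 'N \<Rightarrow> complex ^ 'N"
      using w that by (intro nn_integral_sphere_cong) (simp add: ball_norm_eq)
    show ?thesis
      using n False eq[of "\<lambda>x. x"] eq[of "\<lambda>\<zeta>. c *s \<zeta>"] nn_integral_sphere_unitary[OF U m] c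
      unfolding norm_le_def wc by (simp add: norm_vector_scale)
  qed
qed

lemma nn_integral_unit_interval:
  assumes "continuous_on {0..1} u" "\<And>x. x \<in> {0..1} \<Longrightarrow> 0 \<le> u x"
  shows "(\<integral>\<^sup>+x. ennreal (u x) \<partial>restrict_space lborel {0..1::real}) = ennreal (integral {0..1} u)"
proof -
  have "(\<integral>\<^sup>+x. ennreal (u x) \<partial>restrict_space lborel {0..1}) = (\<integral>\<^sup>+x\<in>{0..1}. ennreal (u x) \<partial>lborel)"
    by (rule nn_integral_restrict_space) simp
  also have "\<dots> = (\<integral>\<^sup>+x. ennreal (if x \<in> {0..1} then u x else 0) \<partial>lborel)"
    by (intro nn_integral_cong) (simp add: indicator_def)
  also have "\<dots> = ennreal (integral {0..1} u)"
  proof (rule nn_integral_has_integral_lborel)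
    show "(\<lambda>x. if x \<in> {0..1} then u x else 0) \<in> borel_measurable borel"
      by (rule borel_measurable_continuous_on_if) (use assms in auto)
    show "((\<lambda>x. if x \<in> {0..1} then u x else 0) has_integral integral {0..1} u) UNIV"
      unfolding has_integral_restrict_UNIV using assms
      by (intro integrable_integral integrable_continuous_interval)
  qed (use assms in auto)
  finally show ?thesis .
qed

lemma prob_space_unit_interval: "prob_space (restrict_space lborel {0..1::real})"
  by (rule prob_spaceI) (simp add: space_restrict_space emeasure_restrict_space)

lemma norm_le_interval_average:
  fixes g :: "complex ^ 'N \<Rightarrow> complex" and \<tau> :: "real \<Rightarrow> complex"
  assumes p: "1 \<le> p" and g: "continuous_on (ball 0 1) g" and m: "mean_le p r A g" and r: "r \<le> 1"
    and A: "0 \<le> A" and c: "0 \<le> c" and tc: "continuous_on {0..1} \<tau>"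
    and t: "\<And>x. x \<in> {0..1} \<Longrightarrow> 0 < cmod (\<tau> x) \<and> cmod (\<tau> x) < r"
    and h: "\<And>\<zeta>. norm \<zeta> = 1 \<Longrightarrow> 0 \<le> h \<zeta> \<and> h \<zeta> \<le> c * integral {0..1} (\<lambda>x. cmod (g (\<tau> x *s \<zeta>)))"
  shows "norm_le p (c * A) h"
proof (rule norm_le_average[OF p prob_space_unit_interval, where U = "\<lambda>x \<zeta>. ball_norm g ((if x \<in> {0..1} then \<tau> x else 0) *s \<zeta>)"])
  let ?M = "restrict_space lborel {0..1::real} \<Otimes>\<^sub>M (sphere_measure :: (complex ^ 'N) measure)"
  have t1: "cmod (\<tau> x) < 1" if "x \<in> {0..1}" for x using t[OF that] r by simp
  have "(\<lambda>x. if x \<in> {0..1} then \<tau> x else 0) \<in> borel_measurable borel"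
    using tc by (intro borel_measurable_continuous_on_if) auto
  then have [measurable]: "(\<lambda>x. if x \<in> {0..1} then \<tau> x else 0) \<in> borel_measurable (restrict_space lborel {0..1::real})"
    by (intro measurable_restrict_space1) simp
  have [measurable]: "(\<lambda>\<zeta>. \<zeta>) \<in> borel_measurable (sphere_measure :: (complex ^ 'N) measure)"
    by (rule borel_measurable_sphereI) simp
  have "(\<lambda>w. (if fst w \<in> {0..1} then \<tau> (fst w) else 0) *s snd w) \<in> borel_measurable ?M"
    by (rule borel_measurable_vector_scale) measurable
  from measurable_compose[OF this ball_norm_measurable[OF g]]
  show "(\<lambda>(x, \<zeta>). ball_norm g ((if x \<in> {0..1} then \<tau> x else 0) *s \<zeta>)) \<in> borel_measurable ?M"
    by (simp add: split_beta')
  have sec: "norm_le p A (\<lambda>\<zeta>. ball_norm g ((if x \<in> {0..1} then \<tau> x else 0) *s \<zeta>))" if x: "x \<in> {0..1}" for x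
  proof -
    have "norm_le p A (\<lambda>\<zeta>. cmod (g (\<tau> x *s \<zeta>)))"
      using m t[OF x] t1[OF x] by (intro norm_le_rotate[OF g]) (auto simp: mean_le_def)
    then show ?thesis using x t1[OF x]
      by (subst norm_le_cong[where v = "\<lambda>\<zeta>. cmod (g (\<tau> x *s \<zeta>))"]) (auto simp: ball_norm_eq norm_vector_scale)
  qed
  show "ball_norm g ((if x \<in> {0..1} then \<tau> x else 0) *s \<zeta>) \<le> A"
    if "p = \<infinity>" "x \<in> space (restrict_space lborel {0..1::real})" "norm \<zeta> = 1" for x and \<zeta> :: "complex ^ 'N"
    using sec[of x] that by (simp add: space_restrict_space norm_le_def)
  show "(\<integral>\<^sup>+x. (\<integral>\<^sup>+\<zeta>. ennreal (ball_norm g ((if x \<in> {0..1} then \<tau> x else 0) *s \<zeta>) powr enn2real p)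
      \<partial>sphere_measure) \<partial>restrict_space lborel {0..1::real}) \<le> ennreal (A powr enn2real p)" if "p \<noteq> \<infinity>"
  proof -
    interpret prob_space "restrict_space lborel {0..1::real}" by (rule prob_space_unit_interval)
    have "(\<integral>\<^sup>+x. (\<integral>\<^sup>+\<zeta>. ennreal (ball_norm g ((if x \<in> {0..1} then \<tau> x else 0) *s \<zeta>) powr enn2real p)
      \<partial>sphere_measure) \<partial>restrict_space lborel {0..1::real}) \<le> (\<integral>\<^sup>+x. ennreal (A powr enn2real p) \<partial>restrict_space lborel {0..1::real})"
      using sec that by (intro nn_integral_mono) (auto simp: norm_le_def space_restrict_space)
    then show ?thesis by (simp only: nn_integral_const emeasure_space_1 mult_1_right)
  qed
  fix \<zeta> :: "complex ^ 'N" assume z: "norm \<zeta> = 1"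
  have "continuous_on {0..1} (\<lambda>x. cmod (g (\<tau> x *s \<zeta>)))"
    by (intro continuous_on_norm continuous_on_compose2[OF g]
        bounded_linear.continuous_on[OF bounded_linear_vector_scale] tc)
       (use t1 z in \<open>auto simp: norm_vector_scale\<close>)
  then have "(\<integral>\<^sup>+x. ennreal (cmod (g (\<tau> x *s \<zeta>))) \<partial>restrict_space lborel {0..1::real})
      = ennreal (integral {0..1} (\<lambda>x. cmod (g (\<tau> x *s \<zeta>))))"
    by (rule nn_integral_unit_interval) simp
  moreover have "(\<integral>\<^sup>+x. ennreal (ball_norm g ((if x \<in> {0..1} then \<tau> x else 0) *s \<zeta>)) \<partial>restrict_space lborel {0..1::real})
      = (\<integral>\<^sup>+x. ennreal (cmod (g (\<tau> x *s \<zeta>))) \<partial>restrict_space lborel {0..1::real})"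
    using t1 z by (intro nn_integral_cong) (auto simp: space_restrict_space ball_norm_eq norm_vector_scale)
  ultimately show "ennreal (h \<zeta>) \<le> ennreal c * (\<integral>\<^sup>+x. ennreal (ball_norm g ((if x \<in> {0..1} then \<tau> x else 0) *s \<zeta>)) \<partial>restrict_space lborel {0..1::real})"
    using h[OF z] c by (simp add: ennreal_mult'[symmetric] ennreal_leI)
qed (use A c h in \<open>auto simp: ball_norm_nonneg\<close>)

lemma mean_le_interval_average:
  fixes g h :: "complex ^ 'N \<Rightarrow> complex" and \<tau> :: "real \<Rightarrow> complex"
  assumes p: "1 \<le> p" and g: "continuous_on (ball 0 1) g" and m: "mean_le p s A g" and s: "s \<le> 1"
    and A: "0 \<le> A" and c: "0 \<le> c" and tc: "continuous_on {0..1} \<tau>"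
    and t: "\<And>x \<rho>. x \<in> {0..1} \<Longrightarrow> 0 < \<rho> \<Longrightarrow> \<rho> < r \<Longrightarrow> 0 < cmod (\<tau> x) \<and> cmod (\<tau> x) * \<rho> < s"
    and h: "\<And>z. norm z < r \<Longrightarrow> cmod (h z) \<le> c * integral {0..1} (\<lambda>x. cmod (g (\<tau> x *s z)))"
  shows "mean_le p r (c * A) h"
  unfolding mean_le_def
proof (intro allI impI)
  fix \<rho> assume rho: "0 < \<rho>" "\<rho> < r"
  show "norm_le p (c * A) (\<lambda>\<zeta>. cmod (h (\<rho> *\<^sub>R \<zeta>)))"
  proof (rule norm_le_interval_average[OF p g m s A c, where \<tau> = "\<lambda>x. \<tau> x * of_real \<rho>"])
    fix \<zeta> :: "complex ^ 'N" assume "norm \<zeta> = 1"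
    then have "cmod (h (\<rho> *\<^sub>R \<zeta>)) \<le> c * integral {0..1} (\<lambda>x. cmod (g (\<tau> x *s (\<rho> *\<^sub>R \<zeta>))))"
      using rho by (intro h) simp
    moreover have "\<tau> x *s (\<rho> *\<^sub>R \<zeta>) = (\<tau> x * of_real \<rho>) *s \<zeta>" for x
      by (simp only: vector_smult_assoc[symmetric] of_real_scale)
    ultimately show "0 \<le> cmod (h (\<rho> *\<^sub>R \<zeta>)) \<and> cmod (h (\<rho> *\<^sub>R \<zeta>))
       \<le> c * integral {0..1} (\<lambda>x. cmod (g ((\<tau> x * of_real \<rho>) *s \<zeta>)))"
      by (simp only: norm_ge_zero simp_thms)
  qed (use rho t in \<open>auto simp: norm_mult intro!: continuous_intros tc\<close>)
qed

lemma norm_has_integral_le: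
  fixes F :: "real \<Rightarrow> complex"
  assumes F: "(F has_integral I) {0..1}" and G: "continuous_on {0..1} G"
    and le: "\<And>x. x \<in> {0..1} \<Longrightarrow> cmod (F x) \<le> c * G x"
  shows "cmod I \<le> c * integral {0..1} G"
proof -
  have "cmod (integral {0..1} F) \<le> integral {0..1} (\<lambda>x. c * G x)"
    by (rule integral_norm_bound_integral[OF has_integral_integrable[OF F]
          integrable_continuous_interval[OF continuous_on_mult[OF continuous_on_const G]] le])
  then show ?thesis by (simp add: integral_unique[OF F])
qed

lemma hol_curve:
  assumes "hol u" "(\<gamma> has_vector_derivative \<gamma>') (at x)" "norm (\<gamma> x) < 1"
  shows "((\<lambda>x. u (\<gamma> x)) has_vector_derivative dir_deriv \<gamma>' u (\<gamma> x)) (at x)"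
proof -
  have "((\<lambda>x. u (\<gamma> x)) has_derivative (\<lambda>h. dir_deriv (h *\<^sub>R \<gamma>') u (\<gamma> x))) (at x)"
    using has_derivative_compose[OF assms(2)[unfolded has_vector_derivative_def] hol_has_derivative[OF assms(1,3)]] .
  moreover have "dir_deriv (h *\<^sub>R \<gamma>') u (\<gamma> x) = h *\<^sub>R dir_deriv \<gamma>' u (\<gamma> x)" for h
    using dir_deriv_scale[of "complex_of_real h" \<gamma>' u "\<gamma> x"] by (simp only: of_real_scale scaleR_conv_of_real)
  ultimately show ?thesis by (simp only: has_vector_derivative_def)
qed

lemma cis_vector_derivative:
  "((\<lambda>x. cis (s * x) *s z) has_vector_derivative (\<i> * s) *s (cis (s * x) *s z)) (at x)"
proof -
  have "((\<lambda>x. cis (s * x)) has_vector_derivative \<i> * s * cis (s * x)) (at x)"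
    unfolding has_vector_derivative_def
    by (auto intro!: derivative_eq_intros simp: scaleR_conv_of_real algebra_simps)
  from bounded_linear.has_vector_derivative[OF bounded_linear_vector_scale this]
  show ?thesis by (simp add: vector_smult_assoc)
qed

lemma norm_rotate: "norm (cis t *s z) = norm z"
  by (simp add: norm_vector_scale)

lemma hol_rotation_derivative:
  assumes "hol u" "norm z < 1"
  shows "((\<lambda>x. u (cis (s * x) *s z)) has_vector_derivative \<i> * s * radial u (cis (s * x) *s z)) (at x)"
  using hol_curve[OF assms(1) cis_vector_derivative, of s x z] assms(2)
  by (simp add: norm_rotate dir_deriv_scale radial_def mult.assoc)

lemma continuous_rotation:
  assumes "continuous_on (ball 0 1) u" "norm z < 1"
  shows "continuous_on S (\<lambda>x. u (cis (s * x) *s z))"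
  by (intro continuous_on_compose2[OF assms(1)]
        bounded_linear.continuous_on[OF bounded_linear_vector_scale] continuous_intros)
     (use assms(2) in \<open>auto simp: norm_rotate\<close>)

text \<open>
  On the circle through \<open>z\<close>, the derivative of \<open>u\<close> with respect to the angle is \<open>i R u\<close>.
\<close>
lemma rotation_difference_bound:
  assumes u: "hol u" and z: "norm z < 1" and s: "0 \<le> s" and x: "x \<in> {0..1}"
  shows "cmod (u (cis (s * x) *s z) - u z) \<le> s * integral {0..1} (\<lambda>y. cmod (radial u (cis (s * y) *s z)))"
proof -
  let ?v = "\<lambda>y. \<i> * s * radial u (cis (s * y) *s z)" and ?w = "\<lambda>y. s * cmod (radial u (cis (s * y) *s z))"
  have c: "continuous_on S (\<lambda>y. radial u (cis (s * y) *s z))" for S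
    by (rule continuous_rotation[OF hol_continuous[OF hol_radial[OF u]] z])
  have "(?v has_integral u (cis (s * x) *s z) - u (cis (s * 0) *s z)) {0..x}"
    using x by (intro fundamental_theorem_of_calculus)
      (auto intro: has_vector_derivative_at_within hol_rotation_derivative u z)
  from integral_unique[OF this] have I: "integral {0..x} ?v = u (cis (s * x) *s z) - u z"
    by (simp only: mult_zero_right cis_zero vector_smult_lid)
  have "cmod (integral {0..x} ?v) \<le> integral {0..x} ?w"
    by (intro integral_norm_bound_integral integrable_continuous_interval continuous_intros c)
       (use s in \<open>auto simp: norm_mult\<close>)
  also have "\<dots> \<le> integral {0..1} ?w"
    using x s by (intro integral_subset_le integrable_continuous_interval continuous_intros c) auto
  finally show ?thesis unfolding I by simp
qed

lemma mean_le_rot_diff: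
  fixes u :: "complex ^ 'N \<Rightarrow> complex"
  assumes p: "1 \<le> p" and u: "hol u" and m: "mean_le p r A (radial u)" and r: "r \<le> 1" and A: "0 \<le> A" and s: "0 \<le> s"
  shows "mean_le p r (s * A) (rot_diff s u)"
proof (rule mean_le_interval_average[OF p hol_continuous[OF hol_radial[OF u]] m r A s, where \<tau> = "\<lambda>y. cis (s * y)"])
  fix z :: "complex ^ 'N" assume "norm z < r"
  with r have "norm z < 1" by simp
  from rotation_difference_bound[OF u this s, of 1]
  show "cmod (rot_diff s u z) \<le> s * integral {0..1} (\<lambda>y. cmod (radial u (cis (s * y) *s z)))"
    by (simp add: rot_diff_def)
qed (auto intro!: continuous_intros)

lemma mean_le_rot_diff_taylor:
  fixes u :: "complex ^ 'N \<Rightarrow> complex"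
  assumes p: "1 \<le> p" and u: "hol u" and m: "mean_le p r A (radial (radial u))" and r: "r \<le> 1" and A: "0 \<le> A" and s: "0 \<le> s"
  shows "mean_le p r (s\<^sup>2 * A) (\<lambda>z. rot_diff s u z - \<i> * s * radial u z)"
proof (rule mean_le_interval_average[OF p _ m r A, where \<tau> = "\<lambda>y. cis (s * y)"])
  have hr: "hol (radial u)" by (rule hol_radial[OF u])
  show "continuous_on (ball 0 1) (radial (radial u))" by (rule hol_continuous[OF hol_radial[OF hr]])
  fix z :: "complex ^ 'N" assume "norm z < r"
  with r have z: "norm z < 1" by simp
  define I where "I = integral {0..1} (\<lambda>y. cmod (radial (radial u) (cis (s * y) *s z)))"
  have "((\<lambda>x. \<i> * s * radial u (cis (s * x) *s z)) has_integral u (cis (s * 1) *s z) - u (cis (s * 0) *s z)) {0..1}"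
    by (intro fundamental_theorem_of_calculus)
      (auto intro: has_vector_derivative_at_within hol_rotation_derivative u z)
  moreover have "((\<lambda>x::real. \<i> * s * radial u z) has_integral \<i> * s * radial u z) {0..1}"
    using has_integral_const_real[of "\<i> * s * radial u z" 0 1] by simp
  ultimately have "((\<lambda>x. \<i> * s * radial u (cis (s * x) *s z) - \<i> * s * radial u z) has_integral
      rot_diff s u z - \<i> * s * radial u z) {0..1}"
    by (rule has_integral_diff[THEN has_integral_eq_rhs]) (simp add: rot_diff_def)
  then have "cmod (rot_diff s u z - \<i> * s * radial u z) \<le> s\<^sup>2 * I * integral {0..1} (\<lambda>x::real. 1)"
  proof (rule norm_has_integral_le)
    fix x :: real assume x: "x \<in> {0..1}"
    have "cmod (\<i> * s * radial u (cis (s * x) *s z) - \<i> * s * radial u z)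
       = s * cmod (radial u (cis (s * x) *s z) - radial u z)"
      using s by (simp add: right_diff_distrib[symmetric] norm_mult)
    also have "\<dots> \<le> s * (s * I)" unfolding I_def
      using x s by (intro mult_left_mono rotation_difference_bound hr z) auto
    finally show "cmod (\<i> * s * radial u (cis (s * x) *s z) - \<i> * s * radial u z) \<le> s\<^sup>2 * I * 1"
      by (simp add: power2_eq_square)
  qed simp
  then show "cmod (rot_diff s u z - \<i> * s * radial u z)
      \<le> s\<^sup>2 * integral {0..1} (\<lambda>y. cmod (radial (radial u) (cis (s * y) *s z)))"
    by (simp add: I_def)
qed (auto intro!: continuous_intros)

text \<open>
  The mean of \<open>u\<close> over the circle through \<open>z\<close> is \<open>u 0 = 0\<close>, so \<open>u z\<close> is the mean of the differences
  between its value at \<open>z\<close> and its other values on this circle.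
\<close>
lemma mean_le_of_radial:
  fixes u :: "complex ^ 'N \<Rightarrow> complex"
  assumes p: "1 \<le> p" and u: "hol u" "u 0 = 0" and m: "mean_le p r A (radial u)" and r: "r \<le> 1" and A: "0 \<le> A"
  shows "mean_le p r (2 * pi * A) u"
proof (rule mean_le_interval_average[OF p hol_continuous[OF hol_radial[OF u(1)]] m r A,
    where \<tau> = "\<lambda>y. cis (2 * pi * y)"])
  fix z :: "complex ^ 'N" assume "norm z < r"
  with r have z: "norm z < 1" by simp
  define I where "I = integral {0..1} (\<lambda>y. cmod (radial u (cis (2 * pi * y) *s z)))"
  have "((\<lambda>x. u (cis (2 * pi * x) *s z)) has_integral 0) {0..1}"
    using mean_value_integral[OF u(1) norm_disc_less[of 0 1 z], of 1] z u(2) by simp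
  moreover have "((\<lambda>x::real. u z) has_integral u z) {0..1}"
    using has_integral_const_real[of "u z" 0 1] by simp
  ultimately have "((\<lambda>x. u (cis (2 * pi * x) *s z) - u z) has_integral 0 - u z) {0..1}"
    by (rule has_integral_diff)
  then have "cmod (0 - u z) \<le> 2 * pi * I * integral {0..1} (\<lambda>x::real. 1)"
  proof (rule norm_has_integral_le)
    show "cmod (u (cis (2 * pi * x) *s z) - u z) \<le> 2 * pi * I * 1" if "x \<in> {0..1}" for x
      unfolding I_def mult_1_right using that by (intro rotation_difference_bound u z) auto
  qed simp
  then show "cmod (u z) \<le> 2 * pi * integral {0..1} (\<lambda>y. cmod (radial u (cis (2 * pi * y) *s z)))"
    by (simp add: I_def)
qed (auto intro!: continuous_intros)

text \<open>
  Cauchy's formula on the disc of radius \<open>e \<bar>z\<bar>\<close> about \<open>z\<close> in the complex line through \<open>z\<close>. The points of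
  its boundary are multiples of \<open>z\<close>, so that the mean over the sphere is not distorted.
\<close>
lemma mean_le_radial_Cauchy:
  fixes u :: "complex ^ 'N \<Rightarrow> complex"
  assumes p: "1 \<le> p" and u: "hol u" and m: "mean_le p ((1 + e) * r) A u" and r: "(1 + e) * r \<le> 1"
    and A: "0 \<le> A" and e: "0 < e" "e < 1"
  shows "mean_le p r (1 / e * A) (radial u)"
proof (rule mean_le_interval_average[OF p hol_continuous[OF u] m r A, where \<tau> = "\<lambda>x. 1 + circ e x"])
  have up: "cmod (1 + circ e x) \<le> 1 + e" for x
    using norm_triangle_ineq[of 1 "circ e x"] e by (simp add: norm_mult)
  show "0 < cmod (1 + circ e x) \<and> cmod (1 + circ e x) * \<rho> < (1 + e) * r" if "0 < \<rho>" "\<rho> < r" for x \<rho>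
  proof -
    have "1 - e \<le> cmod (1 + circ e x)"
      using norm_diff_ineq[of 1 "circ e x"] e by (simp add: norm_mult)
    then have "0 < cmod (1 + circ e x)" using e by linarith
    moreover have "cmod (1 + circ e x) * \<rho> \<le> (1 + e) * \<rho>"
      using that by (intro mult_right_mono up) auto
    moreover have "(1 + e) * \<rho> < (1 + e) * r" using that e by simp
    ultimately show ?thesis by linarith
  qed
  fix z :: "complex ^ 'N" assume zr: "norm z < r"
  have "(1 + e) * norm z < (1 + e) * r" using zr e by simp
  then have z: "norm z + e * norm z < 1" using r by (simp add: distrib_right)
  have "norm ((1 + circ e x) *s z) < 1" for x
  proof -
    have "norm ((1 + circ e x) *s z) \<le> (1 + e) * norm z"
      unfolding norm_vector_scale by (intro mult_right_mono up) simp
    then show ?thesis using z by (simp add: algebra_simps)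
  qed
  then have "continuous_on {0..1} (\<lambda>x. u ((1 + circ e x) *s z))"
    by (intro continuous_on_compose2[OF hol_continuous[OF u]]
        bounded_linear.continuous_on[OF bounded_linear_vector_scale] continuous_intros) auto
  then have c: "continuous_on {0..1} (\<lambda>x. cmod (u ((1 + circ e x) *s z)))" by (rule continuous_on_norm)
  have "((\<lambda>x. u ((1 + circ e x) *s z) / circ e x) has_integral radial u z) {0..1}"
    using dir_deriv_integral[OF u norm_disc_less[OF z] e(1)] by (simp add: radial_def vector_sadd_rdistrib)
  from norm_has_integral_le[OF this c, of "1 / e"]
  show "cmod (radial u z) \<le> 1 / e * integral {0..1} (\<lambda>x. cmod (u ((1 + circ e x) *s z)))"
    using e by (simp add: norm_divide norm_mult)
qed (use e in \<open>auto intro!: continuous_intros\<close>)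

section \<open>Differences against powers of the radial derivative\<close>

lemma dir_deriv_eqI:
  fixes f :: "complex ^ 'N \<Rightarrow> complex"
  assumes "(f has_derivative D) (at z)" "\<And>c v. D (c *s v) = c * D v"
  shows "dir_deriv v f z = D v"
proof -
  have lin: "linear D" using assms(1) by (rule has_derivative_linear)
  have "dir_deriv v f z = (\<Sum>j\<in>UNIV. v $ j * D (axis j 1))"
    unfolding dir_deriv_def by (intro sum.cong refl arg_cong2[where f = times] partial_deriv_eqI[OF assms])
  also have "\<dots> = D (\<Sum>j\<in>UNIV. v $ j *s axis j 1)" by (simp only: linear_sum[OF lin] assms(2))
  finally show ?thesis by (simp only: basis_expansion)
qed

lemma hol_cong:
  assumes "hol f" "\<And>z. norm z < 1 \<Longrightarrow> g z = f z"
  shows "hol g" "norm z < 1 \<Longrightarrow> dir_deriv v g z = dir_deriv v f z"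
proof -
  have *: "(g has_derivative (\<lambda>v. dir_deriv v f z)) (at z)" if "norm z < 1" for z
    by (rule has_derivative_transform_within_open[OF hol_has_derivative[OF assms(1) that] open_ball[of 0 1]])
       (use that assms(2) in auto)
  show "hol g" by (rule holI[OF *]) (auto simp: dir_deriv_scale)
  show "norm z < 1 \<Longrightarrow> dir_deriv v g z = dir_deriv v f z"
    by (rule dir_deriv_eqI[OF *]) (auto simp: dir_deriv_scale)
qed

lemma radial_cong:
  "hol f \<Longrightarrow> (\<And>z. norm z < 1 \<Longrightarrow> g z = f z) \<Longrightarrow> norm z < 1 \<Longrightarrow> radial g z = radial f z"
  unfolding radial_def by (rule hol_cong(2))

lemma hol_radial_pow: "hol f \<Longrightarrow> hol ((radial ^^ n) f)"
  by (induction n) (simp_all add: hol_radial)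

lemma hol_linear:
  assumes "hol f" "hol g"
  shows "hol (\<lambda>z. f z + c * g z)"
  by (intro hol_add hol_mult hol_const assms)

lemma dir_deriv_linear:
  assumes "hol f" "hol g" "norm z < 1"
  shows "dir_deriv v (\<lambda>z. f z + c * g z) z = dir_deriv v f z + c * dir_deriv v g z"
  by (rule dir_deriv_eqI[where D = "\<lambda>v. dir_deriv v f z + c * dir_deriv v g z"])
     (auto intro!: has_derivative_add has_derivative_mult_right hol_has_derivative assms
       simp: dir_deriv_scale algebra_simps)

lemma radial_linear:
  "hol f \<Longrightarrow> hol g \<Longrightarrow> norm z < 1 \<Longrightarrow> radial (\<lambda>z. f z + c * g z) z = radial f z + c * radial g z"
  unfolding radial_def by (rule dir_deriv_linear)

lemma radial_pow_linear:
  assumes "hol f" "hol g" "norm z < 1"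
  shows "(radial ^^ n) (\<lambda>z. f z + c * g z) z = (radial ^^ n) f z + c * (radial ^^ n) g z"
  using assms(3)
proof (induction n arbitrary: z)
  case (Suc n)
  have "radial ((radial ^^ n) (\<lambda>z. f z + c * g z)) z = radial (\<lambda>z. (radial ^^ n) f z + c * (radial ^^ n) g z) z"
    by (rule radial_cong[OF _ Suc.IH Suc.prems]) (intro hol_linear hol_radial_pow assms)
  then show ?case using radial_linear[OF hol_radial_pow[OF assms(1)] hol_radial_pow[OF assms(2)] Suc.prems] by simp
qed simp

lemma rotate_has_derivative:
  fixes u :: "complex ^ 'N \<Rightarrow> complex"
  assumes "hol u" "norm z < 1"
  shows "((\<lambda>z. u (cis t *s z)) has_derivative (\<lambda>v. dir_deriv (cis t *s v) u (cis t *s z))) (at z)"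
proof -
  have "((\<lambda>z :: complex ^ 'N. cis t *s z) has_derivative (\<lambda>v. cis t *s v)) (at z)"
    by (intro bounded_linear_imp_has_derivative bounded_bilinear.bounded_linear_right[OF bounded_bilinear_vector_scale])
  from has_derivative_compose[OF this hol_has_derivative[OF assms(1)]] assms(2)
  show ?thesis by (simp add: norm_rotate)
qed

lemma hol_rotate: "hol u \<Longrightarrow> hol (\<lambda>z. u (cis t *s z))"
  by (rule holI[OF rotate_has_derivative])
     (auto simp: dir_deriv_scale vector_smult_assoc mult.commute mult.left_commute)

lemma radial_rotate:
  fixes u :: "complex ^ 'N \<Rightarrow> complex"
  assumes "hol u" "norm z < 1"
  shows "radial (\<lambda>z. u (cis t *s z)) z = radial u (cis t *s z)"
  unfolding radial_def
  by (rule dir_deriv_eqI[OF rotate_has_derivative[OF assms]])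
     (simp add: dir_deriv_scale vector_smult_assoc mult.commute mult.left_commute)

lemma rot_diff_alt: "rot_diff s u = (\<lambda>z. u (cis s *s z) + (- 1) * u z)"
  by (simp add: rot_diff_def fun_eq_iff)

lemma hol_rot_diff: "hol u \<Longrightarrow> hol (rot_diff s u)"
  unfolding rot_diff_alt by (intro hol_linear hol_rotate)

lemma hol_rot_diff_pow: "hol u \<Longrightarrow> hol ((rot_diff s ^^ n) u)"
  by (induction n) (simp_all add: hol_rot_diff)

lemma radial_rot_diff:
  assumes "hol u" "norm z < 1"
  shows "radial (rot_diff s u) z = rot_diff s (radial u) z"
  unfolding rot_diff_alt using assms by (simp only: radial_linear hol_rotate radial_rotate)

lemma radial_pow_rot_diff:
  assumes "hol u" "norm z < 1"
  shows "(radial ^^ n) (rot_diff s u) z = rot_diff s ((radial ^^ n) u) z"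
  using assms(2)
proof (induction n arbitrary: z)
  case (Suc n)
  have "radial ((radial ^^ n) (rot_diff s u)) z = radial (rot_diff s ((radial ^^ n) u)) z"
    by (rule radial_cong[OF _ Suc.IH Suc.prems]) (intro hol_rot_diff hol_radial_pow assms)
  then show ?case using radial_rot_diff[OF hol_radial_pow[OF assms(1)] Suc.prems] by simp
qed simp

lemma rot_diff_pow_linear:
  "(rot_diff s ^^ n) (\<lambda>z. f z + c * g z) = (\<lambda>z. (rot_diff s ^^ n) f z + c * (rot_diff s ^^ n) g z)"
proof (induction n)
  case (Suc n)
  then show ?case by (simp add: rot_diff_def fun_eq_iff algebra_simps)
qed simp

text \<open>
  Every difference is traded for a factor \<open>s\<close> and a radial derivative.
\<close>
lemma mean_le_rot_diff_pow:
  assumes p: "1 \<le> p" and r: "r \<le> 1" and s: "0 \<le> s"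
  shows "hol u \<Longrightarrow> 0 \<le> A \<Longrightarrow> mean_le p r A ((radial ^^ n) u) \<Longrightarrow> mean_le p r (s ^ n * A) ((rot_diff s ^^ n) u)"
proof (induction n arbitrary: u A)
  case (Suc n)
  have h: "hol ((radial ^^ n) u)" by (rule hol_radial_pow[OF Suc.prems(1)])
  have "mean_le p r A (radial ((radial ^^ n) u))" using Suc.prems(3) by simp
  from mean_le_rot_diff[OF p h this r Suc.prems(2) s]
  have "mean_le p r (s * A) ((radial ^^ n) (rot_diff s u))"
    by (subst mean_le_cong[OF radial_pow_rot_diff[OF Suc.prems(1)] r])
  then have "mean_le p r (s ^ n * (s * A)) ((rot_diff s ^^ n) (rot_diff s u))"
    using Suc.prems(2) s by (intro Suc.IH hol_rot_diff Suc.prems(1)) auto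
  then show ?case by (simp only: funpow_Suc_right o_apply power_Suc2 mult.assoc)
qed simp

primrec taylor_const :: "nat \<Rightarrow> real" where
  "taylor_const 0 = 0"
| "taylor_const (Suc n) = 2 * (1 + taylor_const n)"

lemma taylor_const_nonneg: "0 \<le> taylor_const n"
  by (induction n) auto

text \<open>
  With \<open>D = i s R\<close>, the induction step is the identity
  \<open>\<Delta>\<^sup>n\<^sup>+\<^sup>1 - D\<^sup>n\<^sup>+\<^sup>1 = \<Delta>\<^sup>n (\<Delta> - D) + D (\<Delta>\<^sup>n - D\<^sup>n)\<close>. In its first term \<open>\<Delta> - D\<close> gains \<open>s\<^sup>2\<close> by Taylor's formula
  and each \<open>\<Delta>\<close> gains another factor \<open>s\<close>.
\<close>
lemma rot_diff_pow_taylor: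
  fixes u :: "complex ^ 'N \<Rightarrow> complex"
  assumes p: "1 \<le> p" and s: "0 \<le> s" and A: "0 \<le> A" and r: "r \<le> 1"
  shows "hol u \<Longrightarrow> mean_le p r A ((radial ^^ Suc n) u) \<Longrightarrow> mean_le p r (taylor_const n * s ^ Suc n * A)
     (\<lambda>z. (rot_diff s ^^ n) u z + (- ((\<i> * s) ^ n)) * (radial ^^ n) u z)"
proof (induction n arbitrary: u)
  case 0
  then show ?case by (simp add: mean_le_def norm_le_def)
next
  case (Suc n)
  note u = Suc.prems(1) and m = Suc.prems(2)
  let ?C = "taylor_const n" and ?Ru = "radial u"
  have C: "0 \<le> ?C" by (rule taylor_const_nonneg)
  define w where "w = (\<lambda>z. rot_diff s u z + (- (\<i> * s)) * ?Ru z)"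
  define d where "d = (\<lambda>z. (rot_diff s ^^ n) ?Ru z + (- ((\<i> * s) ^ n)) * (radial ^^ n) ?Ru z)"
  have R: "hol ?Ru" by (rule hol_radial[OF u])
  have hw: "hol w" unfolding w_def by (intro hol_linear hol_rot_diff R u)
  have hd: "hol d" unfolding d_def by (intro hol_linear hol_rot_diff_pow hol_radial_pow R)
  have hn: "hol ((radial ^^ n) u)" by (rule hol_radial_pow[OF u])
  have "mean_le p r A (radial (radial ((radial ^^ n) u)))" using m by simp
  from mean_le_rot_diff_taylor[OF p hn this r A s]
  have "mean_le p r (s\<^sup>2 * A) ((radial ^^ n) w)"
  proof (subst mean_le_cong[OF _ r])
    fix z :: "complex ^ 'N" assume z: "norm z < 1"
    have "(radial ^^ n) w z = (radial ^^ n) (rot_diff s u) z + (- (\<i> * s)) * (radial ^^ n) ?Ru z"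
      unfolding w_def by (intro radial_pow_linear hol_rot_diff R u z)
    also have "(radial ^^ n) ?Ru = radial ((radial ^^ n) u)" by (simp add: funpow_swap1)
    also have "(radial ^^ n) (rot_diff s u) z = rot_diff s ((radial ^^ n) u) z"
      by (rule radial_pow_rot_diff[OF u z])
    finally show "(radial ^^ n) w z = rot_diff s ((radial ^^ n) u) z - \<i> * s * radial ((radial ^^ n) u) z"
      by simp
  qed
  then have 1: "mean_le p r (s ^ n * (s\<^sup>2 * A)) ((rot_diff s ^^ n) w)"
    using A by (intro mean_le_rot_diff_pow p r s hw) auto
  have "mean_le p r A ((radial ^^ Suc n) ?Ru)" using m by (simp only: funpow_Suc_right o_apply)
  from Suc.IH[OF R this] have "mean_le p r (?C * s ^ Suc n * A) d" unfolding d_def .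
  then have 2: "mean_le p r (cmod (\<i> * s) * (?C * s ^ Suc n * A)) (\<lambda>z. \<i> * s * d z)"
    using A C s by (intro mean_le_scale hol_continuous hd r) auto
  have eq: "(rot_diff s ^^ Suc n) u z + (- ((\<i> * s) ^ Suc n)) * (radial ^^ Suc n) u z
     = (rot_diff s ^^ n) w z + \<i> * s * d z" for z
  proof -
    have "(rot_diff s ^^ n) w z = (rot_diff s ^^ n) (rot_diff s u) z + (- (\<i> * s)) * (rot_diff s ^^ n) ?Ru z"
      unfolding w_def rot_diff_pow_linear ..
    then show ?thesis by (simp only: funpow_Suc_right o_apply d_def) (simp add: algebra_simps)
  qed
  have "mean_le p r (2 * (s ^ n * (s\<^sup>2 * A) + cmod (\<i> * s) * (?C * s ^ Suc n * A)))
      (\<lambda>z. (rot_diff s ^^ n) w z + \<i> * s * d z)"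
    using A C s by (intro mean_le_add[OF p 1 2] hol_continuous hol_rot_diff_pow hw r hol_mult hol_const hd) auto
  moreover have "2 * (s ^ n * (s\<^sup>2 * A) + cmod (\<i> * s) * (?C * s ^ Suc n * A)) = taylor_const (Suc n) * s ^ Suc (Suc n) * A"
    using s by (simp add: norm_mult power2_eq_square algebra_simps)
  ultimately show ?case unfolding eq by (simp only:)
qed

text \<open>
  Taylor's formula leaves an error \<open>s R\<^sup>n\<^sup>+\<^sup>1 f\<close>, and Cauchy's formula brings it back to \<open>R\<^sup>n f\<close> at the
  price of \<open>1 / e\<close> and of a larger radius. With \<open>s\<close> small compared to \<open>e\<close> the unknown on the right
  has a small coefficient.
\<close>
lemma radial_pow_absorption:
  fixes f :: "complex ^ 'N \<Rightarrow> complex"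
  assumes p: "1 \<le> p" and f: "hol f" and s: "0 < s" and e: "0 < e" "e < 1" and er: "(1 + e) * r \<le> 1" and r0: "0 \<le> r"
    and D: "0 \<le> D" and W: "0 \<le> W"
    and mD: "mean_le p r D ((rot_diff s ^^ n) f)" and mW: "mean_le p ((1 + e) * r) W ((radial ^^ n) f)"
  shows "mean_le p r (2 * (1 + taylor_const n) * (D / s ^ n + s / e * W)) ((radial ^^ n) f)"
proof -
  let ?C = "taylor_const n"
  have C: "0 \<le> ?C" by (rule taylor_const_nonneg)
  have "0 \<le> e * r" using e r0 by simp
  then have r: "r \<le> 1" using er by (simp add: distrib_right)
  have We: "0 \<le> 1 / e * W" using W e by simp
  define E where "E = ?C * s ^ Suc n * (1 / e * W)"
  have E: "0 \<le> E" unfolding E_def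
    by (rule mult_nonneg_nonneg[OF mult_nonneg_nonneg[OF C zero_le_power[OF less_imp_le[OF s]]] We])
  define d where "d = (\<lambda>z. (rot_diff s ^^ n) f z + (- ((\<i> * s) ^ n)) * (radial ^^ n) f z)"
  have d: "continuous_on (ball 0 1) d" unfolding d_def
    by (intro hol_continuous hol_linear hol_rot_diff_pow hol_radial_pow f)
  have "mean_le p r (1 / e * W) ((radial ^^ Suc n) f)"
    using mean_le_radial_Cauchy[OF p hol_radial_pow[OF f] mW er W e] by simp
  from rot_diff_pow_taylor[OF p less_imp_le[OF s] We r f this]
  have "mean_le p r E d" unfolding E_def d_def .
  from mean_le_scale[OF this d r E, of "- 1"] have "mean_le p r E (\<lambda>z. - 1 * d z)" by simp
  from mean_le_add[OF p mD this hol_continuous[OF hol_rot_diff_pow[OF f]] _ r D E]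
  have "mean_le p r (2 * (D + E)) (\<lambda>z. (rot_diff s ^^ n) f z + - 1 * d z)"
    by (simp add: d continuous_on_minus)
  then have 1: "mean_le p r (2 * (D + E)) (\<lambda>z. (\<i> * s) ^ n * (radial ^^ n) f z)"
    by (simp add: d_def)
  have "mean_le p r (cmod (1 / (\<i> * s) ^ n) * (2 * (D + E))) (\<lambda>z. 1 / (\<i> * s) ^ n * ((\<i> * s) ^ n * (radial ^^ n) f z))"
    using E D by (intro mean_le_scale[OF 1] hol_continuous hol_mult hol_const hol_radial_pow f r) auto
  then have 2: "mean_le p r (1 / s ^ n * (2 * (D + E))) ((radial ^^ n) f)"
    using s by (simp add: norm_divide norm_power norm_mult)
  show ?thesis
  proof (rule mean_le_mono[OF 2])
    show "0 \<le> 1 / s ^ n * (2 * (D + E))" using s E D by simp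
    have "1 / s ^ n * (2 * (D + E)) = 2 * (D / s ^ n) + 2 * ?C * (s / e * W)"
      using s by (simp add: E_def field_simps)
    also have "\<dots> \<le> 2 * (D / s ^ n) + 2 * ?C * (s / e * W) + (2 * ?C * (D / s ^ n) + 2 * (s / e * W))"
      using C s e D W by simp
    also have "\<dots> = 2 * (1 + ?C) * (D / s ^ n + s / e * W)" by (simp add: algebra_simps)
    finally show "1 / s ^ n * (2 * (D + E)) \<le> 2 * (1 + ?C) * (D / s ^ n + s / e * W)" .
  qed simp
qed

text \<open>
  Lower order terms are dominated by \<open>R u\<close> if \<open>u\<close> vanishes at the origin.
\<close>
lemma mean_le_radial_shift:
  fixes u :: "complex ^ 'N \<Rightarrow> complex"
  assumes p: "1 \<le> p" and u: "hol u" "u 0 = 0" and m: "mean_le p r A (radial u)" and r: "r \<le> 1" and A: "0 \<le> A"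
  shows "mean_le p r (2 * (1 + cmod c * (2 * pi)) * A) (\<lambda>z. radial u z + c * u z)"
proof -
  have "mean_le p r (cmod c * (2 * pi * A)) (\<lambda>z. c * u z)"
    using A by (intro mean_le_scale mean_le_of_radial p u m r hol_continuous) auto
  from mean_le_add[OF p m this] have "mean_le p r (2 * (A + cmod c * (2 * pi * A))) (\<lambda>z. radial u z + c * u z)"
    using A by (simp add: r hol_continuous hol_radial hol_mult hol_const u)
  moreover have "2 * (A + cmod c * (2 * pi * A)) = 2 * (1 + cmod c * (2 * pi)) * A" by (simp add: algebra_simps)
  ultimately show ?thesis by (simp only:)
qed

section \<open>Tangential derivatives\<close>

text \<open>
  For a unit vector \<open>\<zeta>\<close>, the projection of \<open>a\<close> to the complex hyperplane orthogonal to \<open>\<zeta>\<close>.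
\<close>
definition tangential :: "complex ^ 'N \<Rightarrow> complex ^ 'N \<Rightarrow> complex ^ 'N" where
  "tangential a \<zeta> = a - herm a \<zeta> *s \<zeta>"

lemma herm_tangential: "norm \<zeta> = 1 \<Longrightarrow> herm (tangential a \<zeta>) \<zeta> = 0"
proof -
  assume "norm \<zeta> = 1"
  then have "herm \<zeta> \<zeta> = 1" by (simp add: herm_self)
  moreover have "tangential a \<zeta> = a + (- herm a \<zeta>) *s \<zeta>" by (simp add: tangential_def vec_eq_iff)
  ultimately show ?thesis by (simp only: herm_add_left herm_scale_left) simp
qed

lemma norm_add_orthogonal:
  fixes \<zeta> v :: "complex ^ 'N"
  assumes "herm v \<zeta> = 0"
  shows "(norm (\<alpha> *\<^sub>R \<zeta> + w *s v))\<^sup>2 = \<alpha>\<^sup>2 * (norm \<zeta>)\<^sup>2 + (cmod w)\<^sup>2 * (norm v)\<^sup>2"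
proof -
  have 0: "herm \<zeta> v = 0" using assms by (metis complex_cnj_zero herm_cnj)
  have "herm (of_real \<alpha> *s \<zeta> + w *s v) (of_real \<alpha> *s \<zeta> + w *s v)
     = of_real (\<alpha>\<^sup>2) * herm \<zeta> \<zeta> + (w * cnj w) * herm v v"
    by (simp only: herm_add_left herm_add_right herm_scale_left herm_scale_right assms 0)
       (simp add: power2_eq_square algebra_simps)
  also have "\<dots> = of_real (\<alpha>\<^sup>2 * (norm \<zeta>)\<^sup>2 + (cmod w)\<^sup>2 * (norm v)\<^sup>2)"
    by (simp add: herm_self complex_norm_square[symmetric])
  finally show ?thesis unfolding herm_self of_real_scale by (simp only: of_real_eq_iff)
qed

lemma norm_tangential_le:
  assumes "norm \<zeta> = 1" shows "norm (tangential a \<zeta>) \<le> norm a"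
proof -
  have "a = 1 *\<^sub>R tangential a \<zeta> + herm a \<zeta> *s \<zeta>" by (simp add: tangential_def)
  moreover have "herm \<zeta> (tangential a \<zeta>) = 0"
    using herm_tangential[OF assms, of a] by (metis complex_cnj_zero herm_cnj)
  ultimately have "(norm a)\<^sup>2 = (norm (tangential a \<zeta>))\<^sup>2 + (cmod (herm a \<zeta>))\<^sup>2"
    using norm_add_orthogonal[of \<zeta> "tangential a \<zeta>" 1 "herm a \<zeta>"] assms by simp
  then have "(norm (tangential a \<zeta>))\<^sup>2 \<le> (norm a)\<^sup>2" by simp
  then show ?thesis by (rule power2_le_imp_le) simp
qed

lemma tangential_unitary:
  assumes "unitary_map T" shows "tangential (T a) (T \<zeta>) = T (tangential a \<zeta>)"
proof -
  have "linear T" "\<And>c x. T (c *s x) = c *s T x" using assms by (auto simp: unitary_map_def unitary_map_linear)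
  then show ?thesis by (simp add: tangential_def unitary_map_herm[OF assms] linear_diff)
qed

lemma tangential_scale: "tangential (c *s a) \<zeta> = c *s tangential a \<zeta>"
  by (simp add: tangential_def herm_scale_left vec_eq_iff algebra_simps)

lemma tangential_add: "tangential (a + b) \<zeta> = tangential a \<zeta> + tangential b \<zeta>"
  by (simp add: tangential_def herm_add_left vec_eq_iff algebra_simps)

lemma continuous_on_herm [continuous_intros]:
  assumes "continuous_on S f" "continuous_on S g"
  shows "continuous_on S (\<lambda>x. herm (f x) (g x))"
  unfolding herm_def using assms by (intro continuous_intros)

lemma continuous_on_vector_scale [continuous_intros]:
  fixes g :: "'a::topological_space \<Rightarrow> complex ^ 'N"
  assumes "continuous_on S f" "continuous_on S g"
  shows "continuous_on S (\<lambda>x. f x *s g x)"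
  by (rule bounded_bilinear.continuous_on[OF bounded_bilinear_vector_scale assms])

lemma continuous_on_tangential [continuous_intros]:
  fixes f :: "'a::topological_space \<Rightarrow> complex ^ 'N"
  assumes "continuous_on S f" "continuous_on S g"
  shows "continuous_on S (\<lambda>x. tangential (f x) (g x))"
  unfolding tangential_def using assms by (intro continuous_intros)

lemma borel_measurable_tangential [measurable (raw)]:
  fixes f :: "'a \<Rightarrow> complex ^ 'N"
  assumes "f \<in> borel_measurable M" "g \<in> borel_measurable M"
  shows "(\<lambda>x. tangential (f x) (g x)) \<in> borel_measurable M"
  using assms by (rule borel_measurable_continuous_Pair) (intro continuous_intros)

lemma measurable_sphere_id [measurable]: "(\<lambda>\<zeta>. \<zeta>) \<in> borel_measurable sphere_measure"
  by (rule borel_measurable_sphereI) simp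

text \<open>
  The displaced point moves by the unitary map \<open>T\<close> when \<open>\<zeta>\<close> and \<open>a\<close> are both moved by \<open>T\<close>, so its law
  for independent uniform \<open>\<zeta>\<close> and \<open>a\<close> is unitarily invariant. By orthogonality its norm lies
  between \<open>\<alpha>\<close> and \<open>r\<close>.
\<close>
lemma nn_integral_tangential_le:
  fixes G :: "complex ^ 'N \<Rightarrow> real"
  assumes G [measurable]: "G \<in> borel_measurable borel" and Gc: "continuous_on (cball 0 r) G" and r: "0 < r" "r \<le> 1"
    and A: "\<And>\<rho>. 0 < \<rho> \<Longrightarrow> \<rho> \<le> r \<Longrightarrow> (\<integral>\<^sup>+\<zeta>. ennreal (G (\<rho> *\<^sub>R \<zeta>)) \<partial>sphere_measure) \<le> A"
    and ab: "0 < \<alpha>" "\<alpha>\<^sup>2 + \<beta>\<^sup>2 \<le> r\<^sup>2"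
  shows "(\<integral>\<^sup>+\<zeta>. (\<integral>\<^sup>+a. ennreal (G (\<alpha> *\<^sub>R \<zeta> + of_real \<beta> *s tangential a \<zeta>)) \<partial>sphere_measure) \<partial>sphere_measure) \<le> A"
proof -
  let ?\<sigma> = "sphere_measure :: (complex ^ 'N) measure"
  define Q where "Q \<zeta> a = \<alpha> *\<^sub>R \<zeta> + of_real \<beta> *s tangential a \<zeta>" for \<zeta> a :: "complex ^ 'N"
  interpret S: prob_space ?\<sigma> by (rule prob_space_sphere_measure)
  interpret SS: pair_prob_space ?\<sigma> ?\<sigma> ..
  have mQ [measurable]: "(\<lambda>w. Q (fst w) (snd w)) \<in> borel_measurable (?\<sigma> \<Otimes>\<^sub>M ?\<sigma>)"
    unfolding Q_def by measurable
  have mQ1: "(\<lambda>w. Q (fst w) (snd w)) \<in> borel_measurable (borel \<Otimes>\<^sub>M ?\<sigma>)"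
    unfolding Q_def by measurable
  have mQ2 [measurable]: "Q \<zeta> \<in> borel_measurable borel" for \<zeta>
    unfolding Q_def by measurable
  define \<mu> where "\<mu> = distr (?\<sigma> \<Otimes>\<^sub>M ?\<sigma>) borel (\<lambda>w. Q (fst w) (snd w))"
  have int: "(\<integral>\<^sup>+x. g x \<partial>\<mu>) = (\<integral>\<^sup>+\<zeta>. (\<integral>\<^sup>+a. g (Q \<zeta> a) \<partial>?\<sigma>) \<partial>?\<sigma>)"
    if [measurable]: "g \<in> borel_measurable borel" for g :: "complex ^ 'N \<Rightarrow> ennreal"
  proof -
    have "(\<integral>\<^sup>+x. g x \<partial>\<mu>) = (\<integral>\<^sup>+w. g (Q (fst w) (snd w)) \<partial>(?\<sigma> \<Otimes>\<^sub>M ?\<sigma>))"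
      unfolding \<mu>_def by (rule nn_integral_distr[OF mQ]) simp
    then show ?thesis by (simp add: S.nn_integral_fst[symmetric])
  qed
  have nQ: "0 < norm (Q \<zeta> a) \<and> norm (Q \<zeta> a) \<le> r" if "norm \<zeta> = 1" "norm a = 1" for \<zeta> a
  proof -
    have n: "(norm (Q \<zeta> a))\<^sup>2 = \<alpha>\<^sup>2 + \<beta>\<^sup>2 * (norm (tangential a \<zeta>))\<^sup>2"
      unfolding Q_def norm_add_orthogonal[OF herm_tangential[OF that(1)]] using that by simp
    have "(norm (tangential a \<zeta>))\<^sup>2 \<le> 1"
      using norm_tangential_le[OF that(1), of a] that(2) by (simp add: power_le_one)
    then have "\<beta>\<^sup>2 * (norm (tangential a \<zeta>))\<^sup>2 \<le> \<beta>\<^sup>2" by (simp add: mult_left_le)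
    then have "(norm (Q \<zeta> a))\<^sup>2 \<le> r\<^sup>2" using n ab by linarith
    moreover have "0 < (norm (Q \<zeta> a))\<^sup>2"
      unfolding n using ab(1) by (intro add_pos_nonneg) auto
    ultimately show ?thesis using r by (auto intro: power2_le_imp_le)
  qed
  have "(\<integral>\<^sup>+x. ennreal (G x) \<partial>\<mu>) \<le> A"
  proof (rule nn_integral_unitary_invariant_le[OF _ _ _ _ r(2) G Gc A])
    show "prob_space \<mu>" unfolding \<mu>_def by (rule SS.prob_space_distr) measurable
    show "sets \<mu> = sets borel" by (simp add: \<mu>_def)
    show "AE x in \<mu>. 0 < norm x \<and> norm x \<le> r"
      unfolding \<mu>_def using nQ
      by (subst AE_distr_iff) (auto intro!: AE_I2 simp: space_pair_measure space_sphere_measure)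
    fix T :: "complex ^ 'N \<Rightarrow> complex ^ 'N" and g :: "complex ^ 'N \<Rightarrow> ennreal"
    assume T: "unitary_map T" and g [measurable]: "g \<in> borel_measurable borel"
    have [measurable]: "T \<in> borel_measurable borel" using T by (rule unitary_map_measurable)
    have TQ: "T (Q \<zeta> a) = Q (T \<zeta>) (T a)" for \<zeta> a
    proof -
      have "T (\<beta>' *s x) = \<beta>' *s T x" for \<beta>' x using T by (auto simp: unitary_map_def)
      then show ?thesis
        by (simp add: Q_def linear_add[OF unitary_map_linear[OF T]] linear_scale[OF unitary_map_linear[OF T]]
          tangential_unitary[OF T])
    qed
    have "(\<integral>\<^sup>+x. g (T x) \<partial>\<mu>) = (\<integral>\<^sup>+\<zeta>. (\<integral>\<^sup>+a. g (Q (T \<zeta>) (T a)) \<partial>?\<sigma>) \<partial>?\<sigma>)"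
      by (subst int) (simp_all add: TQ)
    also have "\<dots> = (\<integral>\<^sup>+\<zeta>. (\<integral>\<^sup>+a. g (Q (T \<zeta>) a) \<partial>?\<sigma>) \<partial>?\<sigma>)"
      by (intro nn_integral_cong nn_integral_sphere_unitary[OF T]) measurable
    also have "\<dots> = (\<integral>\<^sup>+\<zeta>. (\<integral>\<^sup>+a. g (Q \<zeta> a) \<partial>?\<sigma>) \<partial>?\<sigma>)"
    proof (rule nn_integral_sphere_unitary[OF T, of "\<lambda>\<zeta>. \<integral>\<^sup>+a. g (Q \<zeta> a) \<partial>?\<sigma>"])
      have "(\<lambda>w. g (Q (fst w) (snd w))) \<in> borel_measurable (borel \<Otimes>\<^sub>M ?\<sigma>)"
        using mQ1 by measurable
      then show "(\<lambda>\<zeta>. \<integral>\<^sup>+a. g (Q \<zeta> a) \<partial>?\<sigma>) \<in> borel_measurable borel"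
        by (intro S.borel_measurable_nn_integral) (simp add: split_beta')
    qed
    also have "\<dots> = (\<integral>\<^sup>+x. g x \<partial>\<mu>)" by (rule int[symmetric]) measurable
    finally show "(\<integral>\<^sup>+x. g (T x) \<partial>\<mu>) = (\<integral>\<^sup>+x. g x \<partial>\<mu>)" .
  qed
  then show ?thesis by (subst (asm) int) (simp_all add: Q_def)
qed

text \<open>
  By transitivity the mean of \<open>\<bar>L\<bar>\<close> over the sphere depends only on the norm of \<open>L\<close>. For the coordinate
  functionals these equal means add up to at least 1, because the moduli of the coordinates
  of a unit vector do.
\<close>
lemma linear_functional_le_sphere_mean:
  fixes L :: "complex ^ 'N \<Rightarrow> complex"
  assumes add: "\<And>a b. L (a + b) = L a + L b" and scale: "\<And>c a. L (c *s a) = c * L a"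
  shows "ennreal (cmod (L (axis j 1))) \<le> ennreal (real CARD('N)) * (\<integral>\<^sup>+a. ennreal (cmod (L a)) \<partial>sphere_measure)"
proof -
  let ?\<sigma> = "sphere_measure :: (complex ^ 'N) measure" and ?N = "ennreal (real CARD('N))"
  interpret S: prob_space ?\<sigma> by (rule prob_space_sphere_measure)
  have L0: "L 0 = 0" using scale[of 0 0] by simp
  have Lsum: "L (\<Sum>k\<in>I. h k) = (\<Sum>k\<in>I. L (h k))" if "finite I" for I :: "'N set" and h
    using that by (induction I rule: finite_induct) (auto simp: L0 add)
  \<comment> \<open>The vector that represents \<open>L\<close> by the hermitian product.\<close>
  define m where "m = (\<chi> k. cnj (L (axis k 1)))"
  have La: "L a = herm a m" for a
  proof -
    have "L a = L (\<Sum>k\<in>UNIV. a $ k *s axis k 1)" by (simp only: basis_expansion)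
    also have "\<dots> = (\<Sum>k\<in>UNIV. a $ k * L (axis k 1))" by (simp only: Lsum[OF finite] scale)
    finally show ?thesis by (simp add: herm_def m_def)
  qed
  define \<kappa> where "\<kappa> e = (\<integral>\<^sup>+a. ennreal (cmod (herm a e)) \<partial>?\<sigma>)" for e
  have mh [measurable]: "(\<lambda>a. herm a e) \<in> borel_measurable borel" for e :: "complex ^ 'N"
    by (intro borel_measurable_continuous_onI continuous_intros)
  have unit: "\<kappa> e = \<kappa> e'" if "norm e = norm e'" for e e'
  proof -
    obtain T where T: "unitary_map T" "T e = e'" using \<open>norm e = norm e'\<close> by (rule unitary_map_transitive)
    have "\<kappa> e' = (\<integral>\<^sup>+a. ennreal (cmod (herm (T a) (T e))) \<partial>?\<sigma>)" unfolding \<kappa>_def T(2)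
      by (rule nn_integral_sphere_unitary[OF T(1), symmetric]) measurable
    then show ?thesis by (simp add: \<kappa>_def unitary_map_herm[OF T(1)])
  qed
  have sc: "\<kappa> (of_real c *s e) = ennreal c * \<kappa> e" if "0 \<le> c" for c e
    unfolding \<kappa>_def using that
    by (subst nn_integral_cmult[symmetric])
       (auto simp: herm_scale_right norm_mult ennreal_mult intro!: borel_measurable_sphereI)
  have e1: "norm (axis k (1::complex) :: complex ^ 'N) = 1" for k by (simp add: norm_axis_complex)
  have "1 = (\<integral>\<^sup>+a. 1 \<partial>?\<sigma>)" by (simp add: S.emeasure_space_1)
  also have "\<dots> \<le> (\<integral>\<^sup>+a. (\<Sum>k\<in>UNIV. ennreal (cmod (herm a (axis k 1)))) \<partial>?\<sigma>)"
  proof (rule nn_integral_sphere_mono)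
    fix a :: "complex ^ 'N" assume "norm a = 1"
    have h: "herm a (axis k 1) = a $ k" for k
    proof -
      have "herm a (axis k 1) = (\<Sum>i\<in>UNIV. if i = k then a $ k else 0)"
        unfolding herm_def by (intro sum.cong) (auto simp: axis_def)
      then show ?thesis by simp
    qed
    have "1 \<le> (\<Sum>k\<in>UNIV. cmod (a $ k))"
      using L2_set_le_sum[of UNIV "\<lambda>k. cmod (a $ k)"] \<open>norm a = 1\<close> by (simp add: norm_vec_def)
    then have "ennreal 1 \<le> ennreal (\<Sum>k\<in>UNIV. cmod (a $ k))" by (rule ennreal_leI)
    then show "1 \<le> (\<Sum>k\<in>UNIV. ennreal (cmod (herm a (axis k 1))))" by (simp add: h sum_ennreal)
  qed
  also have "\<dots> = (\<Sum>k\<in>UNIV. \<kappa> (axis k 1))"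
    unfolding \<kappa>_def by (intro nn_integral_sum borel_measurable_sphereI) measurable
  also have "\<dots> = (\<Sum>k\<in>(UNIV::'N set). \<kappa> (axis j 1))"
    by (intro sum.cong refl unit) (simp add: e1)
  also have "\<dots> = ?N * \<kappa> (axis j 1)" by (simp add: ennreal_of_nat_eq_real_of_nat)
  finally have N1: "1 \<le> ?N * \<kappa> (axis j 1)" .
  have "cmod (L (axis j 1)) \<le> norm m"
    using Finite_Cartesian_Product.norm_nth_le[of m j] by (simp add: m_def)
  then have "ennreal (cmod (L (axis j 1))) \<le> ennreal (norm m) * 1" by (simp add: ennreal_leI)
  also have "\<dots> \<le> ennreal (norm m) * (?N * \<kappa> (axis j 1))" by (intro mult_left_mono N1) simp
  also have "\<dots> = ?N * \<kappa> (of_real (norm m) *s axis j 1)" by (simp add: sc mult.left_commute)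
  also have "\<kappa> (of_real (norm m) *s axis j 1) = \<kappa> m"
    by (intro unit) (simp add: norm_vector_scale e1)
  finally show ?thesis unfolding \<kappa>_def La .
qed

text \<open>
  The points of a tangential disc of radius \<open>\<delta>\<close> about \<open>\<alpha> \<zeta>\<close> have squared norm at most \<open>\<alpha>\<^sup>2 + \<delta>\<^sup>2\<close>, so \<open>\<delta>\<close> may be
  as large as the square root of \<open>1 - \<alpha>\<^sup>2\<close>. The circle in Cauchy's formula disappears in the mean over
  \<open>a\<close>, whose distribution is invariant under multiplication by unimodular numbers.
\<close>
lemma dir_deriv_tangential_bound:
  fixes g :: "complex ^ 'N \<Rightarrow> complex"
  assumes g: "hol g" and z: "norm \<zeta> = 1" and d: "0 < \<delta>" and s: "0 < \<alpha>" "\<alpha>\<^sup>2 + \<delta>\<^sup>2 < 1"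
  shows "ennreal (cmod (dir_deriv (tangential (axis j 1) \<zeta>) g (\<alpha> *\<^sub>R \<zeta>)))
    \<le> ennreal (real CARD('N) / \<delta>) * (\<integral>\<^sup>+a. ennreal (ball_norm g (\<alpha> *\<^sub>R \<zeta> + of_real \<delta> *s tangential a \<zeta>)) \<partial>sphere_measure)"
proof -
  let ?\<sigma> = "sphere_measure :: (complex ^ 'N) measure" and ?I = "restrict_space lborel {0..1::real}"
  interpret S: prob_space ?\<sigma> by (rule prob_space_sphere_measure)
  interpret I: prob_space ?I by (rule prob_space_unit_interval)
  interpret SI: pair_sigma_finite ?\<sigma> ?I ..
  have [measurable]: "ball_norm g \<in> borel_measurable borel"
    by (rule ball_norm_measurable[OF hol_continuous[OF g]])
  have [measurable]: "(\<lambda>x. x) \<in> borel_measurable ?I" by (rule measurable_restrict_space1) simp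
  have [measurable]: "cis \<in> borel_measurable borel"
    by (intro borel_measurable_continuous_onI continuous_intros)
  have [measurable]: "fst \<in> borel_measurable (?\<sigma> \<Otimes>\<^sub>M ?I)" "snd \<in> borel_measurable (?\<sigma> \<Otimes>\<^sub>M ?I)"
    by (rule measurable_compose[OF measurable_fst measurable_sphere_id])
       (rule measurable_compose[OF measurable_snd], measurable)
  have nrm: "norm (\<alpha> *\<^sub>R \<zeta> + w *s tangential a \<zeta>) < 1" if "cmod w \<le> \<delta>" "norm a = 1" for w a
  proof -
    have "(norm (tangential a \<zeta>))\<^sup>2 \<le> 1"
      using norm_tangential_le[OF z, of a] that(2) by (simp add: power_le_one)
    then have "(cmod w)\<^sup>2 * (norm (tangential a \<zeta>))\<^sup>2 \<le> \<delta>\<^sup>2 * 1"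
      using that(1) by (intro mult_mono power_mono) auto
    then have "(norm (\<alpha> *\<^sub>R \<zeta> + w *s tangential a \<zeta>))\<^sup>2 < 1"
      unfolding norm_add_orthogonal[OF herm_tangential[OF z]] using z s by simp
    then show ?thesis by (simp add: power_less_one_iff)
  qed
  have bd: "ennreal (cmod (dir_deriv (tangential a \<zeta>) g (\<alpha> *\<^sub>R \<zeta>)))
    \<le> ennreal (1 / \<delta>) * (\<integral>\<^sup>+x. ennreal (ball_norm g (\<alpha> *\<^sub>R \<zeta> + of_real \<delta> *s tangential (cis (2 * pi * x) *s a) \<zeta>)) \<partial>?I)"
    if a: "norm a = 1" for a
  proof -
    let ?v = "tangential a \<zeta>"
    let ?F = "\<lambda>x. g (\<alpha> *\<^sub>R \<zeta> + (circ \<delta> x) *s ?v)"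
    have n: "norm (\<alpha> *\<^sub>R \<zeta> + (circ \<delta> x) *s ?v) < 1" for x
      using d by (intro nrm a) (simp add: norm_mult)
    have h: "((\<lambda>x. ?F x / (circ \<delta> x)) has_integral dir_deriv ?v g (\<alpha> *\<^sub>R \<zeta>)) {0..1}"
      using nrm[OF _ a] by (intro dir_deriv_integral[OF g _ d])
    have "continuous_on {0..1} ?F"
      by (intro continuous_on_compose2[OF hol_continuous[OF g]] continuous_intros) (use n in auto)
    then have c: "continuous_on {0..1} (\<lambda>x. cmod (?F x))" by (rule continuous_on_norm)
    have "cmod (dir_deriv ?v g (\<alpha> *\<^sub>R \<zeta>)) \<le> 1 / \<delta> * integral {0..1} (\<lambda>x. cmod (?F x))"
      using d by (intro norm_has_integral_le[OF h c]) (simp add: norm_divide norm_mult)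
    then have "ennreal (cmod (dir_deriv ?v g (\<alpha> *\<^sub>R \<zeta>))) \<le> ennreal (1 / \<delta> * integral {0..1} (\<lambda>x. cmod (?F x)))"
      by (rule ennreal_leI)
    also have "\<dots> = ennreal (1 / \<delta>) * ennreal (integral {0..1} (\<lambda>x. cmod (?F x)))"
      using d by (intro ennreal_mult') simp
    also have "ennreal (integral {0..1} (\<lambda>x. cmod (?F x))) = (\<integral>\<^sup>+x. ennreal (cmod (?F x)) \<partial>?I)"
      by (rule nn_integral_unit_interval[OF c, symmetric]) simp
    also have "\<dots> = (\<integral>\<^sup>+x. ennreal (ball_norm g (\<alpha> *\<^sub>R \<zeta> + of_real \<delta> *s tangential (cis (2 * pi * x) *s a) \<zeta>)) \<partial>?I)"
      unfolding tangential_scale vector_smult_assoc ball_norm_eq[OF n] ..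
    finally show ?thesis .
  qed
  have "ennreal (cmod (dir_deriv (tangential (axis j 1) \<zeta>) g (\<alpha> *\<^sub>R \<zeta>)))
    \<le> ennreal (real CARD('N)) * (\<integral>\<^sup>+a. ennreal (cmod (dir_deriv (tangential a \<zeta>) g (\<alpha> *\<^sub>R \<zeta>))) \<partial>?\<sigma>)"
    by (rule linear_functional_le_sphere_mean[of "\<lambda>a. dir_deriv (tangential a \<zeta>) g (\<alpha> *\<^sub>R \<zeta>)"])
       (simp_all only: tangential_add tangential_scale dir_deriv_add dir_deriv_scale)
  also have "(\<integral>\<^sup>+a. ennreal (cmod (dir_deriv (tangential a \<zeta>) g (\<alpha> *\<^sub>R \<zeta>))) \<partial>?\<sigma>)
     \<le> (\<integral>\<^sup>+a. ennreal (1 / \<delta>) * (\<integral>\<^sup>+x. ennreal (ball_norm g (\<alpha> *\<^sub>R \<zeta> + of_real \<delta> *s tangential (cis (2 * pi * x) *s a) \<zeta>)) \<partial>?I) \<partial>?\<sigma>)"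
    by (rule nn_integral_sphere_mono[OF bd])
  also have "\<dots> = ennreal (1 / \<delta>) * (\<integral>\<^sup>+a. (\<integral>\<^sup>+x. ennreal (ball_norm g (\<alpha> *\<^sub>R \<zeta> + of_real \<delta> *s tangential (cis (2 * pi * x) *s a) \<zeta>)) \<partial>?I) \<partial>?\<sigma>)"
    by (rule nn_integral_cmult) measurable
  also have "(\<integral>\<^sup>+a. (\<integral>\<^sup>+x. ennreal (ball_norm g (\<alpha> *\<^sub>R \<zeta> + of_real \<delta> *s tangential (cis (2 * pi * x) *s a) \<zeta>)) \<partial>?I) \<partial>?\<sigma>)
    = (\<integral>\<^sup>+x. (\<integral>\<^sup>+a. ennreal (ball_norm g (\<alpha> *\<^sub>R \<zeta> + of_real \<delta> *s tangential (cis (2 * pi * x) *s a) \<zeta>)) \<partial>?\<sigma>) \<partial>?I)"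
    by (rule SI.Fubini'[symmetric]) measurable
  also have "\<dots> = (\<integral>\<^sup>+x. (\<integral>\<^sup>+a. ennreal (ball_norm g (\<alpha> *\<^sub>R \<zeta> + of_real \<delta> *s tangential a \<zeta>)) \<partial>?\<sigma>) \<partial>?I)"
    by (intro nn_integral_cong nn_integral_sphere_unitary[OF unitary_map_scale,
        of _ "\<lambda>a. ennreal (ball_norm g (\<alpha> *\<^sub>R \<zeta> + of_real \<delta> *s tangential a \<zeta>))"]) simp_all
  also have "\<dots> = (\<integral>\<^sup>+a. ennreal (ball_norm g (\<alpha> *\<^sub>R \<zeta> + of_real \<delta> *s tangential a \<zeta>)) \<partial>?\<sigma>)"
    by (simp only: nn_integral_const I.emeasure_space_1 mult_1_right)
  also have "ennreal (real CARD('N)) * (ennreal (1 / \<delta>) * (\<integral>\<^sup>+a. ennreal (ball_norm g (\<alpha> *\<^sub>R \<zeta> + of_real \<delta> *s tangential a \<zeta>)) \<partial>?\<sigma>))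
    = ennreal (real CARD('N) / \<delta>) * (\<integral>\<^sup>+a. ennreal (ball_norm g (\<alpha> *\<^sub>R \<zeta> + of_real \<delta> *s tangential a \<zeta>)) \<partial>?\<sigma>)"
  proof -
    have "ennreal (real CARD('N)) * ennreal (1 / \<delta>) = ennreal (real CARD('N) / \<delta>)"
      using ennreal_mult'[of "1 / \<delta>" "real CARD('N)"] d by (simp add: mult.commute)
    then show ?thesis by (simp only: mult.assoc[symmetric])
  qed
  finally show ?thesis by (simp add: mult_left_mono)
qed

text \<open>
  The formula \<open>\<partial>\<^sub>jf(z) = \<integral>\<^sub>0\<^sup>1 \<partial>\<^sub>j(R f)(s z) ds\<close> after the substitution \<open>s = 1 - u\<^sup>2\<close>, whose factor \<open>2 u\<close>
  cancels the square root that the tangential Cauchy estimate produces.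
\<close>
lemma dir_deriv_eq_integral_radial:
  fixes f :: "complex ^ 'N \<Rightarrow> complex"
  assumes f: "hol f" and z: "norm z < 1"
  shows "((\<lambda>u. of_real (2 * u) * dir_deriv v (radial f) ((1 - u\<^sup>2) *\<^sub>R z)) has_integral dir_deriv v f z) {0..1}"
proof -
  have 1: "((\<lambda>u. of_real (2 * u) * partial_deriv j (radial f) ((1 - u\<^sup>2) *\<^sub>R z)) has_integral partial_deriv j f z) {0..1}" for j
  proof -
    let ?h = "partial_deriv j f"
    have hh: "hol ?h" by (rule hol_partial_deriv[OF f])
    have n: "norm ((1 - u\<^sup>2) *\<^sub>R z) < 1" if "u \<in> {0..1}" for u :: real
    proof -
      have "norm ((1 - u\<^sup>2) *\<^sub>R z) \<le> 1 * norm z"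
        unfolding norm_scaleR using that by (intro mult_right_mono) (auto simp: abs_le_iff power_le_one)
      then show ?thesis using z by simp
    qed
    have "((\<lambda>u. of_real (2 * u) * partial_deriv j (radial f) ((1 - u\<^sup>2) *\<^sub>R z)) has_integral
        (of_real (- (1 - 1\<^sup>2)) * ?h ((1 - 1\<^sup>2) *\<^sub>R z)) - (of_real (- (1 - 0\<^sup>2)) * ?h ((1 - 0\<^sup>2) *\<^sub>R z))) {0..1}"
    proof (rule fundamental_theorem_of_calculus)
      fix u :: real assume u: "u \<in> {0..1}"
      let ?y = "(1 - u\<^sup>2) *\<^sub>R z"
      have d1: "((\<lambda>u. (1 - u\<^sup>2) *\<^sub>R z) has_vector_derivative (- (2 * u)) *\<^sub>R z) (at u)"
        unfolding has_vector_derivative_def by (auto intro!: derivative_eq_intros)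
      have "((\<lambda>u. - (1 - u\<^sup>2)) has_real_derivative 2 * u) (at u)"
        by (auto intro!: derivative_eq_intros)
      then have d2: "((\<lambda>u. of_real (- (1 - u\<^sup>2))) has_vector_derivative (of_real (2 * u) :: complex)) (at u)"
        unfolding has_real_derivative_iff_has_vector_derivative
        by (rule bounded_linear.has_vector_derivative[OF bounded_linear_of_real])
      have "((\<lambda>u. of_real (- (1 - u\<^sup>2)) * ?h ((1 - u\<^sup>2) *\<^sub>R z)) has_vector_derivative
          (of_real (- (1 - u\<^sup>2)) * dir_deriv ((- (2 * u)) *\<^sub>R z) ?h ?y + of_real (2 * u) * ?h ?y)) (at u)"
        by (rule has_vector_derivative_mult[OF d2 hol_curve[OF hh d1 n[OF u]]])
      moreover have "of_real (- (1 - u\<^sup>2)) * dir_deriv ((- (2 * u)) *\<^sub>R z) ?h ?y + of_real (2 * u) * ?h ?y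
          = of_real (2 * u) * partial_deriv j (radial f) ?y"
      proof -
        have "radial ?h ?y = of_real (1 - u\<^sup>2) * dir_deriv z ?h ?y"
          unfolding radial_def by (simp only: of_real_scale[symmetric] dir_deriv_scale)
        moreover have "dir_deriv ((- (2 * u)) *\<^sub>R z) ?h ?y = of_real (- (2 * u)) * dir_deriv z ?h ?y"
          by (simp only: of_real_scale[symmetric] dir_deriv_scale)
        moreover have "of_real (- c) * (of_real (- d) * D) + of_real d * H = of_real d * (H + of_real c * D)"
          for c d :: real and D H :: complex by (simp add: algebra_simps)
        ultimately show ?thesis unfolding partial_deriv_radial[OF f n[OF u]] by (simp only:)
      qed
      ultimately have "((\<lambda>u. of_real (- (1 - u\<^sup>2)) * ?h ((1 - u\<^sup>2) *\<^sub>R z)) has_vector_derivative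
          of_real (2 * u) * partial_deriv j (radial f) ?y) (at u)" by (simp only:)
      then show "((\<lambda>u. of_real (- (1 - u\<^sup>2)) * ?h ((1 - u\<^sup>2) *\<^sub>R z)) has_vector_derivative
          of_real (2 * u) * partial_deriv j (radial f) ?y) (at u within {0..1})"
        by (rule has_vector_derivative_at_within)
    qed simp
    then show ?thesis by simp
  qed
  have "((\<lambda>u. \<Sum>j\<in>UNIV. v $ j * (of_real (2 * u) * partial_deriv j (radial f) ((1 - u\<^sup>2) *\<^sub>R z)))
     has_integral (\<Sum>j\<in>UNIV. v $ j * partial_deriv j f z)) {0..1}"
    by (intro has_integral_sum has_integral_mult_right 1) simp
  then show ?thesis by (simp only: dir_deriv_def sum_distrib_left mult.left_commute)
qed

abbreviation open_unit :: "real measure" where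
  "open_unit \<equiv> restrict_space lborel {0<..<1}"

lemma prob_space_open_unit: "prob_space open_unit"
  by (rule prob_spaceI) (simp add: space_restrict_space emeasure_restrict_space)

lemma nn_integral_open_unit:
  "(\<integral>\<^sup>+x. F x \<partial>restrict_space lborel {0..1::real}) = (\<integral>\<^sup>+x. F x \<partial>open_unit)"
proof -
  have "(\<integral>\<^sup>+x\<in>{0..1}. F x \<partial>lborel) = (\<integral>\<^sup>+x\<in>{0<..<1}. F x \<partial>lborel)"
  proof (rule nn_integral_cong_AE)
    have "AE x in lborel. x \<noteq> (0::real)" "AE x in lborel. x \<noteq> (1::real)"
      by (rule AE_lborel_singleton)+
    then show "AE x in lborel. F x * indicator {0..1} x = F x * indicator {0<..<1} x"
      by eventually_elim (auto simp: indicator_def)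
  qed
  then show ?thesis by (simp add: nn_integral_restrict_space)
qed

text \<open>
  About the point at radius \<open>(1 - u\<^sup>2) \<rho>\<close>, tangential discs of radius \<open>u / 2\<close> stay well inside the unit ball,
  at radii below the midpoint of \<open>r\<close> and 1.
\<close>
lemma tangential_radius_less:
  fixes \<rho> r u :: real
  assumes "0 < \<rho>" "\<rho> < r" "r < 1" "0 < u" "u < 1"
  shows "((1 - u\<^sup>2) * \<rho>)\<^sup>2 + (u / 2)\<^sup>2 < ((1 + r) / 2)\<^sup>2"
proof -
  define R where "R = (1 + r) / 2"
  define s where "s = 1 - u\<^sup>2"
  have u2: "0 < u\<^sup>2" "u\<^sup>2 < 1" using assms by (simp_all add: power_less_one_iff)
  have Rr: "(1 + \<rho>) / 2 < R" "1 / 2 < R" using assms by (simp_all add: R_def)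
  have *: "u\<^sup>2 / 2 < R - s * \<rho>"
  proof -
    have "u\<^sup>2 * (1 - 2 * \<rho>) < 1 - \<rho>"
    proof (cases "\<rho> \<le> 1 / 2")
      case True
      then have "u\<^sup>2 * (1 - 2 * \<rho>) \<le> 1 * (1 - 2 * \<rho>)" using u2 by (intro mult_right_mono) auto
      then show ?thesis using assms by simp
    next
      case False
      then have "u\<^sup>2 * (1 - 2 * \<rho>) \<le> 0" using u2 by (intro mult_nonneg_nonpos) auto
      then show ?thesis using assms by simp
    qed
    then have "u\<^sup>2 / 2 < (1 + \<rho>) / 2 - s * \<rho>" by (simp add: s_def field_simps)
    then show ?thesis using Rr by linarith
  qed
  have "0 \<le> s * \<rho>" using u2 assms by (simp add: s_def)
  then have **: "1 / 2 < R + s * \<rho>" using Rr by linarith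
  have "0 < R - s * \<rho>" using * u2 by linarith
  then have "u\<^sup>2 / 2 * (1 / 2) < (R - s * \<rho>) * (R + s * \<rho>)"
    using * ** by (intro mult_strict_mono) simp_all
  then have "s * \<rho> * (s * \<rho>) + u\<^sup>2 / 4 < R * R" by (simp add: algebra_simps)
  then show ?thesis by (simp add: R_def s_def power2_eq_square)
qed

lemma norm_le_point:
  assumes "mean_le \<infinity> r A g" "0 < norm x" "norm x < r"
  shows "cmod (g x) \<le> A"
proof -
  have *: "\<forall>\<zeta>\<in>sphere 0 1. cmod (g (norm x *\<^sub>R \<zeta>)) \<le> A"
    using assms by (simp add: mean_le_def norm_le_def)
  have "x /\<^sub>R norm x \<in> sphere 0 1" using assms by simp
  from bspec[OF * this] have "cmod (g (norm x *\<^sub>R (x /\<^sub>R norm x))) \<le> A" .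
  moreover have "norm x *\<^sub>R (x /\<^sub>R norm x) = x" using assms by simp
  ultimately show ?thesis by (simp only:)
qed

text \<open>
  At \<open>s = 1 - u\<^sup>2\<close> Cauchy's formula is used with radius \<open>u / 2\<close>; its loss \<open>2 / u\<close> is compensated
  by the weight \<open>2 u\<close>, so that the derivative is bounded by the average of \<open>R f\<close> at randomly displaced
  points, over \<open>u\<close> and over \<open>a\<close>.
\<close>
lemma norm_le_tangential_deriv:
  fixes f :: "complex ^ 'N \<Rightarrow> complex"
  assumes p: "1 \<le> p" and f: "hol f" and r: "r < 1" and A: "0 \<le> A"
    and m: "mean_le p ((1 + r) / 2) A (radial f)" and rho: "0 < \<rho>" "\<rho> < r"
  shows "norm_le p (4 * real CARD('N) * A) (\<lambda>\<zeta>. cmod (dir_deriv (tangential (axis j 1) \<zeta>) f (\<rho> *\<^sub>R \<zeta>)))"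
proof -
  let ?\<sigma> = "sphere_measure :: (complex ^ 'N) measure" and ?R = "(1 + r) / 2" and ?P = "enn2real p"
  let ?N = "real CARD('N)"
  interpret S: prob_space ?\<sigma> by (rule prob_space_sphere_measure)
  interpret J: prob_space open_unit by (rule prob_space_open_unit)
  interpret SS: pair_sigma_finite ?\<sigma> ?\<sigma> ..
  interpret JS: pair_prob_space open_unit ?\<sigma> ..
  define g where "g = radial f"
  have g: "hol g" unfolding g_def by (rule hol_radial[OF f])
  have m: "mean_le p ?R A g" unfolding g_def by (rule m)
  have R: "0 < ?R" "?R < 1" using rho r by auto
  define Q where "Q u a \<zeta> = ((1 - u\<^sup>2) * \<rho>) *\<^sub>R \<zeta> + of_real (u / 2) *s tangential a \<zeta>"
    for u :: real and a \<zeta> :: "complex ^ 'N"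
  have bm [measurable]: "ball_norm g \<in> borel_measurable borel"
    by (rule ball_norm_measurable[OF hol_continuous[OF g]])
  have [measurable]: "(\<lambda>x. x) \<in> borel_measurable open_unit" by (rule measurable_restrict_space1) simp
  have alpha: "0 < (1 - u\<^sup>2) * \<rho>" if "0 < u" "u < 1" for u
    using that rho by (simp add: power_less_one_iff)
  have norm_Q: "(norm (Q u a \<zeta>))\<^sup>2 = ((1 - u\<^sup>2) * \<rho>)\<^sup>2 + (u / 2)\<^sup>2 * (norm (tangential a \<zeta>))\<^sup>2"
    if "norm \<zeta> = 1" for u a \<zeta>
    unfolding Q_def norm_add_orthogonal[OF herm_tangential[OF that]] using that by (simp add: power_divide)
  have Qn: "0 < norm (Q u a \<zeta>) \<and> norm (Q u a \<zeta>) < ?R" if "0 < u" "u < 1" "norm \<zeta> = 1" "norm a = 1" for u a \<zeta>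
  proof -
    have "(norm (tangential a \<zeta>))\<^sup>2 \<le> 1"
      using norm_tangential_le[OF that(3), of a] that(4) by (simp add: power_le_one)
    then have "(u / 2)\<^sup>2 * (norm (tangential a \<zeta>))\<^sup>2 \<le> (u / 2)\<^sup>2" by (intro mult_left_le) auto
    then have "(norm (Q u a \<zeta>))\<^sup>2 < ?R\<^sup>2"
      using norm_Q[OF that(3)] tangential_radius_less[OF rho r that(1,2)] by simp
    moreover have "0 < (norm (Q u a \<zeta>))\<^sup>2"
      unfolding norm_Q[OF that(3)] using alpha[OF that(1,2)] by (intro add_pos_nonneg) auto
    ultimately show ?thesis using R power2_less_imp_less[of "norm (Q u a \<zeta>)" ?R] by simp
  qed
  have meas3: "(\<lambda>w. ball_norm g (Q (fst (fst w)) (snd (fst w)) (snd w))) \<in> borel_measurable ((open_unit \<Otimes>\<^sub>M ?\<sigma>) \<Otimes>\<^sub>M ?\<sigma>)"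
    unfolding Q_def by measurable
  have meas2: "(\<lambda>w. ball_norm g (Q (fst w) (snd w) \<zeta>)) \<in> borel_measurable (open_unit \<Otimes>\<^sub>M ?\<sigma>)" for \<zeta>
    unfolding Q_def by measurable
  have measF: "(\<lambda>w. ball_norm g (Q u (fst w) (snd w))) \<in> borel_measurable (?\<sigma> \<Otimes>\<^sub>M ?\<sigma>)" for u
    unfolding Q_def by measurable
  show ?thesis
  proof (rule norm_le_average[OF p JS.prob_space_axioms, where U = "\<lambda>w \<zeta>. ball_norm g (Q (fst w) (snd w) \<zeta>)"])
    show "(\<lambda>(w, \<zeta>). ball_norm g (Q (fst w) (snd w) \<zeta>)) \<in> borel_measurable ((open_unit \<Otimes>\<^sub>M ?\<sigma>) \<Otimes>\<^sub>M ?\<sigma>)"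
      using meas3 by (simp add: split_beta')
    show "0 \<le> A" "0 \<le> 4 * ?N" "\<And>w \<zeta>. 0 \<le> ball_norm g (Q (fst w) (snd w) \<zeta>)" using A by (auto simp: ball_norm_nonneg)
    show "ball_norm g (Q (fst w) (snd w) \<zeta>) \<le> A"
      if "p = \<infinity>" "w \<in> space (open_unit \<Otimes>\<^sub>M ?\<sigma>)" "norm \<zeta> = 1" for w \<zeta>
    proof -
      have n: "0 < norm (Q (fst w) (snd w) \<zeta>)" "norm (Q (fst w) (snd w) \<zeta>) < ?R"
        using Qn[of "fst w" \<zeta> "snd w"] that by (auto simp: space_pair_measure space_restrict_space space_sphere_measure)
      then have "cmod (g (Q (fst w) (snd w) \<zeta>)) \<le> A"
        using norm_le_point[of ?R A g] m that(1) by simp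
      then show ?thesis using n R by (simp add: ball_norm_eq)
    qed
    show "(\<integral>\<^sup>+w. (\<integral>\<^sup>+\<zeta>. ennreal (ball_norm g (Q (fst w) (snd w) \<zeta>) powr ?P) \<partial>?\<sigma>) \<partial>(open_unit \<Otimes>\<^sub>M ?\<sigma>))
        \<le> ennreal (A powr ?P)" if pf: "p \<noteq> \<infinity>"
    proof -
      have P: "1 \<le> ?P" using p pf by (rule one_le_enn2real)
      have in_u: "(\<integral>\<^sup>+a. (\<integral>\<^sup>+\<zeta>. ennreal (ball_norm g (Q u a \<zeta>) powr ?P) \<partial>?\<sigma>) \<partial>?\<sigma>) \<le> ennreal (A powr ?P)"
        if u: "0 < u" "u < 1" for u
      proof -
        \<comment> \<open>The largest norm of a point on a tangential disc about \<open>(1 - u\<^sup>2) \<rho> \<zeta>\<close>.\<close>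
        define q where "q = sqrt (((1 - u\<^sup>2) * \<rho>)\<^sup>2 + (u / 2)\<^sup>2)"
        have q2: "q\<^sup>2 = ((1 - u\<^sup>2) * \<rho>)\<^sup>2 + (u / 2)\<^sup>2" by (simp add: q_def)
        have "0 < q" unfolding q_def using alpha[OF u] by (intro real_sqrt_gt_zero add_pos_nonneg) auto
        moreover have "q < ?R" unfolding q_def
          using tangential_radius_less[OF rho r u] R by (intro real_less_lsqrt) auto
        ultimately have q: "0 < q" "q < ?R" "q \<le> 1" using R by auto
        have "(\<integral>\<^sup>+a. (\<integral>\<^sup>+\<zeta>. ennreal (ball_norm g (Q u a \<zeta>) powr ?P) \<partial>?\<sigma>) \<partial>?\<sigma>)
           = (\<integral>\<^sup>+\<zeta>. (\<integral>\<^sup>+a. ennreal (ball_norm g (Q u a \<zeta>) powr ?P) \<partial>?\<sigma>) \<partial>?\<sigma>)"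
          by (rule SS.Fubini'[symmetric]) (use measF[of u] in \<open>simp add: split_beta'\<close>)
        also have "\<dots> \<le> ennreal (A powr ?P)" unfolding Q_def
        proof (rule nn_integral_tangential_le[OF _ _ q(1,3) _ alpha[OF u]])
          show "(\<lambda>x. ball_norm g x powr ?P) \<in> borel_measurable borel" by measurable
          have "continuous_on (cball 0 q) (\<lambda>x. cmod (g x) powr ?P)"
            using q R P by (intro continuous_on_powr' continuous_on_norm continuous_on_const
                continuous_on_subset[OF hol_continuous[OF g]]) auto
          then show "continuous_on (cball 0 q) (\<lambda>x. ball_norm g x powr ?P)"
            by (rule continuous_on_eq) (use q R in \<open>auto simp: ball_norm_eq\<close>)
          show "((1 - u\<^sup>2) * \<rho>)\<^sup>2 + (u / 2)\<^sup>2 \<le> q\<^sup>2" by (simp add: q2)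
          fix s assume s: "0 < s" "s \<le> q"
          have "(\<integral>\<^sup>+\<zeta>. ennreal (ball_norm g (s *\<^sub>R \<zeta>) powr ?P) \<partial>?\<sigma>) = (\<integral>\<^sup>+\<zeta>. ennreal (cmod (g (s *\<^sub>R \<zeta>)) powr ?P) \<partial>?\<sigma>)"
            using s q R by (intro nn_integral_sphere_cong) (simp add: ball_norm_eq)
          also have "\<dots> \<le> ennreal (A powr ?P)"
            using m s q pf unfolding mean_le_def norm_le_def by auto
          finally show "(\<integral>\<^sup>+\<zeta>. ennreal (ball_norm g (s *\<^sub>R \<zeta>) powr ?P) \<partial>?\<sigma>) \<le> ennreal (A powr ?P)" .
        qed
        finally show ?thesis .
      qed
      have "(\<lambda>w. ennreal (ball_norm g (Q (fst (fst w)) (snd (fst w)) (snd w)) powr ?P)) \<in> borel_measurable ((open_unit \<Otimes>\<^sub>M ?\<sigma>) \<Otimes>\<^sub>M ?\<sigma>)"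
        using meas3 by measurable
      then have "(\<lambda>w. \<integral>\<^sup>+\<zeta>. ennreal (ball_norm g (Q (fst w) (snd w) \<zeta>) powr ?P) \<partial>?\<sigma>) \<in> borel_measurable (open_unit \<Otimes>\<^sub>M ?\<sigma>)"
        by (intro S.borel_measurable_nn_integral) (simp add: split_beta')
      from S.nn_integral_fst[OF this]
      have "(\<integral>\<^sup>+w. (\<integral>\<^sup>+\<zeta>. ennreal (ball_norm g (Q (fst w) (snd w) \<zeta>) powr ?P) \<partial>?\<sigma>) \<partial>(open_unit \<Otimes>\<^sub>M ?\<sigma>))
        = (\<integral>\<^sup>+u. (\<integral>\<^sup>+a. (\<integral>\<^sup>+\<zeta>. ennreal (ball_norm g (Q u a \<zeta>) powr ?P) \<partial>?\<sigma>) \<partial>?\<sigma>) \<partial>open_unit)"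
        by simp
      also have "\<dots> \<le> (\<integral>\<^sup>+u. ennreal (A powr ?P) \<partial>open_unit)"
        by (intro nn_integral_mono in_u) (auto simp: space_restrict_space)
      also have "\<dots> = ennreal (A powr ?P)"
        by (simp only: nn_integral_const J.emeasure_space_1 mult_1_right)
      finally show ?thesis .
    qed
    fix \<zeta> :: "complex ^ 'N" assume z: "norm \<zeta> = 1"
    define V where "V = tangential (axis j 1) \<zeta>"
    let ?k = "\<lambda>u. of_real (2 * u) * dir_deriv V g ((1 - u\<^sup>2) *\<^sub>R (\<rho> *\<^sub>R \<zeta>))"
    show "0 \<le> cmod (dir_deriv (tangential (axis j 1) \<zeta>) f (\<rho> *\<^sub>R \<zeta>))" by simp
    have zr: "norm (\<rho> *\<^sub>R \<zeta>) < 1" using rho r z by simp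
    have nn: "norm ((1 - u\<^sup>2) *\<^sub>R (\<rho> *\<^sub>R \<zeta>)) < 1" if "u \<in> {0..1}" for u :: real
    proof -
      have "\<bar>1 - u\<^sup>2\<bar> * norm (\<rho> *\<^sub>R \<zeta>) \<le> 1 * norm (\<rho> *\<^sub>R \<zeta>)"
        using that by (intro mult_right_mono) (auto simp: abs_le_iff power_le_one)
      then show ?thesis using zr by (simp add: abs_mult mult.assoc)
    qed
    have cV: "continuous_on (ball 0 1) (\<lambda>y. dir_deriv V g y)"
      unfolding dir_deriv_def
      by (intro continuous_on_sum continuous_on_mult continuous_on_const partial_deriv_continuous g)
    have "continuous_on {0..1} (\<lambda>u. dir_deriv V g ((1 - u\<^sup>2) *\<^sub>R (\<rho> *\<^sub>R \<zeta>)))"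
    proof (rule continuous_on_compose2[OF cV])
      show "continuous_on {0..1} (\<lambda>u. (1 - u\<^sup>2) *\<^sub>R (\<rho> *\<^sub>R \<zeta>))" by (intro continuous_intros)
    qed (use nn in auto)
    then have "continuous_on {0..1} ?k"
      by (intro continuous_on_mult continuous_on_of_real continuous_on_const continuous_on_id)
    then have kc: "continuous_on {0..1} (\<lambda>u. cmod (?k u))" by (rule continuous_on_norm)
    have hk: "(?k has_integral dir_deriv V f (\<rho> *\<^sub>R \<zeta>)) {0..1}"
      unfolding g_def by (rule dir_deriv_eq_integral_radial[OF f zr])
    have "cmod (dir_deriv V f (\<rho> *\<^sub>R \<zeta>)) \<le> integral {0..1} (\<lambda>u. cmod (?k u))"
      using integral_norm_bound_integral[OF has_integral_integrable[OF hk] integrable_continuous_interval[OF kc]]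
      unfolding integral_unique[OF hk] by blast
    then have "ennreal (cmod (dir_deriv V f (\<rho> *\<^sub>R \<zeta>))) \<le> ennreal (integral {0..1} (\<lambda>u. cmod (?k u)))"
      by (rule ennreal_leI)
    also have "\<dots> = (\<integral>\<^sup>+u. ennreal (cmod (?k u)) \<partial>open_unit)"
      using nn_integral_unit_interval[OF kc] by (simp add: nn_integral_open_unit)
    also have "\<dots> \<le> (\<integral>\<^sup>+u. ennreal (4 * ?N) * (\<integral>\<^sup>+a. ennreal (ball_norm g (Q u a \<zeta>)) \<partial>?\<sigma>) \<partial>open_unit)"
    proof (rule nn_integral_mono)
      fix u assume "u \<in> space open_unit"
      then have u: "0 < u" "u < 1" by (auto simp: space_restrict_space)
      have lt: "((1 - u\<^sup>2) * \<rho>)\<^sup>2 + (u / 2)\<^sup>2 < 1"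
        using tangential_radius_less[OF rho r u] power_le_one[of ?R 2] R by simp
      have "ennreal (cmod (?k u)) = ennreal (2 * u) * ennreal (cmod (dir_deriv V g (((1 - u\<^sup>2) * \<rho>) *\<^sub>R \<zeta>)))"
        using u by (simp add: norm_mult ennreal_mult)
      also have "\<dots> \<le> ennreal (2 * u) * (ennreal (?N / (u / 2)) * (\<integral>\<^sup>+a. ennreal (ball_norm g (Q u a \<zeta>)) \<partial>?\<sigma>))"
        unfolding V_def Q_def using u lt by (intro mult_left_mono dir_deriv_tangential_bound g z alpha) auto
      also have "\<dots> = ennreal (2 * u * (?N / (u / 2))) * (\<integral>\<^sup>+a. ennreal (ball_norm g (Q u a \<zeta>)) \<partial>?\<sigma>)"
        using u by (subst ennreal_mult) (auto simp: mult.assoc)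
      also have "2 * u * (?N / (u / 2)) = 4 * ?N" using u by simp
      finally show "ennreal (cmod (?k u)) \<le> ennreal (4 * ?N) * (\<integral>\<^sup>+a. ennreal (ball_norm g (Q u a \<zeta>)) \<partial>?\<sigma>)" .
    qed
    also have "\<dots> = ennreal (4 * ?N) * (\<integral>\<^sup>+u. (\<integral>\<^sup>+a. ennreal (ball_norm g (Q u a \<zeta>)) \<partial>?\<sigma>) \<partial>open_unit)"
      by (intro nn_integral_cmult S.borel_measurable_nn_integral) (use meas2[of \<zeta>] in \<open>simp add: split_beta'\<close>)
    also have "(\<integral>\<^sup>+u. (\<integral>\<^sup>+a. ennreal (ball_norm g (Q u a \<zeta>)) \<partial>?\<sigma>) \<partial>open_unit)
       = (\<integral>\<^sup>+w. ennreal (ball_norm g (Q (fst w) (snd w) \<zeta>)) \<partial>(open_unit \<Otimes>\<^sub>M ?\<sigma>))"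
      using S.nn_integral_fst[of "\<lambda>w. ennreal (ball_norm g (Q (fst w) (snd w) \<zeta>))" open_unit] meas2[of \<zeta>] by simp
    finally show "ennreal (cmod (dir_deriv (tangential (axis j 1) \<zeta>) f (\<rho> *\<^sub>R \<zeta>)))
      \<le> ennreal (4 * ?N) * (\<integral>\<^sup>+w. ennreal (ball_norm g (Q (fst w) (snd w) \<zeta>)) \<partial>(open_unit \<Otimes>\<^sub>M ?\<sigma>))"
      unfolding V_def .
  qed
qed

section \<open>The full gradient against the radial derivative\<close>

text \<open>
  At \<open>\<rho> \<zeta>\<close> the derivative in the direction \<open>\<zeta>\<close> is \<open>R f\<close> divided by \<open>\<rho>\<close>. For small \<open>\<rho>\<close> it is first
  replaced by its mean over a circle that stays away from the origin.
\<close>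
lemma norm_le_radial_direction:
  fixes f :: "complex ^ 'N \<Rightarrow> complex"
  assumes p: "1 \<le> p" and f: "hol f" and r: "r < 1" and A: "0 \<le> A"
    and m: "mean_le p ((1 + r) / 2) A (radial f)" and rho: "0 < \<rho>" "\<rho> < r"
  shows "norm_le p (8 * A) (\<lambda>\<zeta>. cmod (dir_deriv \<zeta> f (\<rho> *\<^sub>R \<zeta>)))"
proof -
  have c: "continuous_on (ball 0 1) (radial f)" by (rule hol_continuous[OF hol_radial[OF f]])
  have eq: "radial f (w *s \<zeta>) = w * dir_deriv \<zeta> f (w *s \<zeta>)" for w and \<zeta> :: "complex ^ 'N"
    by (simp add: radial_def dir_deriv_scale)
  show ?thesis
  proof (cases "1 / 8 \<le> \<rho>")
    case True
    have n: "norm_le p A (\<lambda>\<zeta>. cmod (radial f (\<rho> *\<^sub>R \<zeta>)))" using m rho r by (simp add: mean_le_def)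
    have "norm_le p (8 * A) (\<lambda>\<zeta>. 8 * cmod (radial f (\<rho> *\<^sub>R \<zeta>)))"
      using rho r by (intro norm_le_scale n A measurable_mean c) auto
    then show ?thesis
    proof (rule norm_le_mono)
      fix \<zeta> :: "complex ^ 'N"
      have "1 * cmod (dir_deriv \<zeta> f (\<rho> *\<^sub>R \<zeta>)) \<le> (8 * \<rho>) * cmod (dir_deriv \<zeta> f (\<rho> *\<^sub>R \<zeta>))"
        using True by (intro mult_right_mono) auto
      also have "\<dots> = 8 * cmod (radial f (\<rho> *\<^sub>R \<zeta>))"
        using eq[of "of_real \<rho>" \<zeta>] rho by (simp add: of_real_scale norm_mult)
      finally show "0 \<le> cmod (dir_deriv \<zeta> f (\<rho> *\<^sub>R \<zeta>)) \<and> cmod (dir_deriv \<zeta> f (\<rho> *\<^sub>R \<zeta>)) \<le> 8 * cmod (radial f (\<rho> *\<^sub>R \<zeta>))"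
        by simp
    qed (use A in auto)
  next
    case False
    \<comment> \<open>For \<open>\<rho> < 1/8\<close> the circle of radius 3/8 about \<open>\<rho>\<close> lies in the annulus between the radii 1/4 and 1/2.\<close>
    define \<tau> where "\<tau> x = of_real \<rho> + of_real (3 / 8) * cis (2 * pi * x)" for x
    have t: "1 / 4 \<le> cmod (\<tau> x)" "cmod (\<tau> x) \<le> 1 / 2" for x
      using norm_diff_ineq[of "of_real (3 / 8) * cis (2 * pi * x)" "of_real \<rho>"]
        norm_triangle_ineq[of "of_real \<rho>" "of_real (3 / 8) * cis (2 * pi * x)"] rho False
      unfolding \<tau>_def norm_mult norm_of_real by (auto simp: add.commute)
    have "norm_le p (8 * A) (\<lambda>\<zeta>. cmod (dir_deriv \<zeta> f (\<rho> *\<^sub>R \<zeta>)))"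
    proof (rule norm_le_interval_average[OF p c m _ A, where \<tau> = \<tau>])
      show "continuous_on {0..1} \<tau>" unfolding \<tau>_def by (intro continuous_intros)
      show "0 < cmod (\<tau> x) \<and> cmod (\<tau> x) < (1 + r) / 2" for x
      proof -
        have "1 / 2 < (1 + r) / 2" using rho by simp
        then show ?thesis using t[of x] by linarith
      qed
      fix \<zeta> :: "complex ^ 'N" assume z: "norm \<zeta> = 1"
      have h: "hol (dir_deriv \<zeta> f)"
        unfolding dir_deriv_def[abs_def] by (intro hol_sum hol_mult hol_const hol_partial_deriv f) simp
      have tz: "\<tau> x *s \<zeta> = \<rho> *\<^sub>R \<zeta> + (of_real (3 / 8) * cis (2 * pi * x)) *s \<zeta>" for x
        unfolding \<tau>_def vector_sadd_rdistrib of_real_scale ..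
      have "norm (\<rho> *\<^sub>R \<zeta>) + 3 / 8 * norm \<zeta> < 1" using z False rho by simp
      from mean_value_integral[OF h norm_disc_less[OF this], of "3 / 8"]
      have hi: "((\<lambda>x. dir_deriv \<zeta> f (\<tau> x *s \<zeta>)) has_integral dir_deriv \<zeta> f (\<rho> *\<^sub>R \<zeta>)) {0..1}"
        unfolding tz by simp
      have "continuous_on {0..1} (\<lambda>x. radial f (\<tau> x *s \<zeta>))"
      proof (rule continuous_on_compose2[OF c])
        show "continuous_on {0..1} (\<lambda>x. \<tau> x *s \<zeta>)" unfolding \<tau>_def by (intro continuous_intros)
        show "(\<lambda>x. \<tau> x *s \<zeta>) ` {0..1} \<subseteq> ball 0 1"
        proof safe
          fix x show "\<tau> x *s \<zeta> \<in> ball 0 1" using t(2)[of x] z by (simp add: norm_vector_scale)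
        qed
      qed
      then have rc: "continuous_on {0..1} (\<lambda>x. cmod (radial f (\<tau> x *s \<zeta>)))" by (rule continuous_on_norm)
      show "0 \<le> cmod (dir_deriv \<zeta> f (\<rho> *\<^sub>R \<zeta>)) \<and> cmod (dir_deriv \<zeta> f (\<rho> *\<^sub>R \<zeta>))
         \<le> 8 * integral {0..1} (\<lambda>x. cmod (radial f (\<tau> x *s \<zeta>)))"
      proof -
        have "1 * cmod (dir_deriv \<zeta> f (\<tau> x *s \<zeta>)) \<le> (8 * cmod (\<tau> x)) * cmod (dir_deriv \<zeta> f (\<tau> x *s \<zeta>))" for x
          using t(1)[of x] by (intro mult_right_mono) auto
        then have "cmod (dir_deriv \<zeta> f (\<tau> x *s \<zeta>)) \<le> 8 * cmod (radial f (\<tau> x *s \<zeta>))" for x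
          unfolding eq norm_mult by (simp only: mult_1 mult.assoc)
        then show ?thesis using norm_has_integral_le[OF hi rc, of 8] by simp
      qed
    qed (use r in auto)
    then show ?thesis .
  qed
qed

lemma continuous_on_sphere_dir_deriv:
  fixes f :: "complex ^ 'N \<Rightarrow> complex"
  assumes "hol f" "continuous_on (sphere 0 1) v" "0 < \<rho>" "\<rho> < 1"
  shows "continuous_on (sphere 0 1) (\<lambda>\<zeta>. dir_deriv (v \<zeta>) f (\<rho> *\<^sub>R \<zeta>))"
  unfolding dir_deriv_def
  by (intro continuous_on_sum continuous_on_mult continuous_on_component assms(2)
      continuous_on_sphere_scale partial_deriv_continuous assms)

text \<open>
  The coordinate direction is split into its tangential and its radial component at \<open>\<zeta>\<close>.
\<close>
lemma mean_le_partial_deriv: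
  fixes f :: "complex ^ 'N \<Rightarrow> complex"
  assumes p: "1 \<le> p" and f: "hol f" and r: "r < 1" and A: "0 \<le> A"
    and m: "mean_le p ((1 + r) / 2) A (radial f)"
  shows "mean_le p r ((8 * real CARD('N) + 16) * A) (partial_deriv j f)"
  unfolding mean_le_def
proof (intro allI impI)
  fix \<rho> assume rho: "0 < \<rho>" "\<rho> < r"
  let ?T = "\<lambda>\<zeta>. cmod (dir_deriv (tangential (axis j 1) \<zeta>) f (\<rho> *\<^sub>R \<zeta>))"
  let ?F = "\<lambda>\<zeta>. cmod (dir_deriv \<zeta> f (\<rho> *\<^sub>R \<zeta>))"
  have "norm_le p (2 * (4 * real CARD('N) * A + 8 * A)) (\<lambda>\<zeta>. ?T \<zeta> + ?F \<zeta>)"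
    using rho r A
    by (intro norm_le_add p f norm_le_tangential_deriv[OF p f r A m rho] norm_le_radial_direction[OF p f r A m rho]
        measurable_sphere_continuous continuous_on_norm continuous_on_sphere_dir_deriv continuous_intros) auto
  then show "norm_le p ((8 * real CARD('N) + 16) * A) (\<lambda>\<zeta>. cmod (partial_deriv j f (\<rho> *\<^sub>R \<zeta>)))"
  proof (rule norm_le_mono)
    fix \<zeta> :: "complex ^ 'N" assume z: "norm \<zeta> = 1"
    have "partial_deriv j f (\<rho> *\<^sub>R \<zeta>) = dir_deriv (tangential (axis j 1) \<zeta> + herm (axis j 1) \<zeta> *s \<zeta>) f (\<rho> *\<^sub>R \<zeta>)"
      by (simp add: tangential_def dir_deriv_axis)
    also have "\<dots> = dir_deriv (tangential (axis j 1) \<zeta>) f (\<rho> *\<^sub>R \<zeta>) + herm (axis j 1) \<zeta> * dir_deriv \<zeta> f (\<rho> *\<^sub>R \<zeta>)"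
      by (simp only: dir_deriv_add dir_deriv_scale)
    finally have "cmod (partial_deriv j f (\<rho> *\<^sub>R \<zeta>)) \<le> ?T \<zeta> + cmod (herm (axis j 1) \<zeta>) * ?F \<zeta>"
      by (metis norm_mult norm_triangle_ineq)
    also have "cmod (herm (axis j 1) \<zeta>) * ?F \<zeta> \<le> 1 * ?F \<zeta>"
      using norm_herm_le[of "axis j 1" \<zeta>] z by (intro mult_right_mono) (auto simp: norm_axis_complex)
    finally show "0 \<le> cmod (partial_deriv j f (\<rho> *\<^sub>R \<zeta>)) \<and> cmod (partial_deriv j f (\<rho> *\<^sub>R \<zeta>)) \<le> ?T \<zeta> + ?F \<zeta>"
      by simp
  qed (use A in \<open>auto simp: algebra_simps\<close>)
qed

abbreviation partials :: "'N list \<Rightarrow> (complex ^ 'N \<Rightarrow> complex) \<Rightarrow> complex ^ 'N \<Rightarrow> complex" where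
  "partials \<equiv> foldr partial_deriv"

lemma hol_partials: "hol f \<Longrightarrow> hol (partials js f)"
  by (induction js) (simp_all add: hol_partial_deriv)

lemma partial_deriv_cong:
  assumes "hol f" "\<And>z. norm z < 1 \<Longrightarrow> g z = f z" "norm z < 1"
  shows "partial_deriv j g z = partial_deriv j f z"
  using hol_cong(2)[OF assms(1,2,3), of "axis j 1"] by (simp add: dir_deriv_axis)

lemma partials_linear:
  assumes "hol f" "hol g" "norm z < 1"
  shows "partials js (\<lambda>z. f z + c * g z) z = partials js f z + c * partials js g z"
  using assms(3)
proof (induction js arbitrary: z)
  case (Cons j js)
  have "partial_deriv j (partials js (\<lambda>z. f z + c * g z)) z = partial_deriv j (\<lambda>z. partials js f z + c * partials js g z) z"
    by (rule partial_deriv_cong[OF _ Cons.IH Cons.prems]) (intro hol_linear hol_partials assms)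
  then show ?case
    using dir_deriv_linear[OF hol_partials[OF assms(1)] hol_partials[OF assms(2)] Cons.prems, of "axis j 1"]
    by (simp add: dir_deriv_axis)
qed simp

text \<open>
  A derivative of order \<open>k\<close> lowers homogeneous degrees by \<open>k\<close>, and \<open>R\<close> multiplies by the degree.
\<close>
lemma radial_partials:
  assumes f: "hol f" and "norm z < 1"
  shows "radial (partials js f) z = partials js (\<lambda>z. radial f z + (- of_nat (length js)) * f z) z"
  using assms(2)
proof (induction js arbitrary: z)
  case (Cons j js)
  let ?h = "partials js f" and ?k = "of_nat (length js) :: complex"
  have h: "hol ?h" by (rule hol_partials[OF f])
  have R: "hol (radial f)" by (rule hol_radial[OF f])
  have "radial (partial_deriv j ?h) z = partial_deriv j (radial ?h) z + (- 1) * partial_deriv j ?h z"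
    using partial_deriv_radial[OF h Cons.prems, of j] by simp
  also have "partial_deriv j (radial ?h) z = partial_deriv j (partials js (\<lambda>z. radial f z + (- ?k) * f z)) z"
    by (rule partial_deriv_cong[OF _ Cons.IH Cons.prems]) (intro hol_partials hol_linear R f)
  also have "\<dots> = partials (j # js) (\<lambda>z. radial f z + (- ?k) * f z) z" by simp
  also have "\<dots> + (- 1) * partial_deriv j ?h z = partials (j # js) (\<lambda>z. radial f z + (- of_nat (length (j # js))) * f z) z"
    unfolding partials_linear[OF R f Cons.prems] by (simp add: algebra_simps)
  finally show ?case by simp
qed simp

primrec partials_const :: "real \<Rightarrow> nat \<Rightarrow> real" where
  "partials_const N 0 = 1"
| "partials_const N (Suc n) = (8 * N + 16) * (partials_const N n * (2 * (1 + real n * (2 * pi))))"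

lemma partials_const_pos: "0 \<le> N \<Longrightarrow> 0 < partials_const N n"
proof (induction n)
  case (Suc n)
  have "0 < 8 * N + 16" "0 < 2 * (1 + real n * (2 * pi))" using Suc.prems by (auto intro: add_pos_nonneg)
  then show ?case using Suc by simp
qed simp

text \<open>
  Each derivative is traded for a radial one and half of the distance to the sphere. Moving \<open>R\<close> past the
  remaining derivatives produces lower order terms, which \<open>mean_le_radial_shift\<close> absorbs since
  \<open>R\<^sup>n f\<close> vanishes at the origin for \<open>n > 0\<close>.
\<close>
lemma mean_le_partials:
  fixes f :: "complex ^ 'N \<Rightarrow> complex"
  assumes p: "1 \<le> p"
  shows "hol f \<Longrightarrow> r < 1 \<Longrightarrow> 0 \<le> A \<Longrightarrow> mean_le p (1 - (1 - r) / 2 ^ length js) A ((radial ^^ length js) f) \<Longrightarrow>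
    mean_le p r (partials_const CARD('N) (length js) * A) (partials js f)"
proof (induction js arbitrary: f r A)
  case (Cons j js)
  note f = Cons.prems(1) and r = Cons.prems(2) and A = Cons.prems(3)
  let ?n = "length js" and ?P = "partials_const CARD('N) (length js)"
  let ?c = "- of_nat ?n :: complex" and ?g = "(radial ^^ length js) f"
  define E where "E = 2 * (1 + real ?n * (2 * pi))"
  have E: "1 \<le> E" unfolding E_def by simp
  have P: "0 < ?P" by (rule partials_const_pos) simp
  define r1 where "r1 = (1 + r) / 2"
  have r1: "r1 < 1" using r by (simp add: r1_def)
  have r2: "1 - (1 - r) / 2 ^ length (j # js) = 1 - (1 - r1) / 2 ^ ?n" by (simp add: r1_def field_simps)
  have r3: "1 - (1 - r1) / 2 ^ ?n \<le> 1" using r1 by simp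
  have hn: "hol ?g" by (rule hol_radial_pow[OF f])
  have eq: "(radial ^^ ?n) (\<lambda>z. radial f z + ?c * f z) z = radial ?g z + ?c * ?g z" if "norm z < 1" for z
    using radial_pow_linear[OF hol_radial[OF f] f that, of ?n ?c] by (simp add: funpow_swap1)
  have m: "mean_le p (1 - (1 - r1) / 2 ^ ?n) A (radial ?g)" using Cons.prems(4) unfolding r2 by simp
  have "mean_le p (1 - (1 - r1) / 2 ^ ?n) (E * A) (\<lambda>z. radial ?g z + ?c * ?g z)"
  proof (cases ?n)
    case 0
    have "mean_le p (1 - (1 - r1) / 2 ^ ?n) (E * A) (radial ?g)"
      using mult_right_mono[of 1 E A] E A by (intro mean_le_mono[OF m]) auto
    then show ?thesis using 0 by simp
  next
    case (Suc k)
    have "?g 0 = 0" by (simp add: Suc radial_def dir_deriv_def)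
    from mean_le_radial_shift[OF p hn this m r3 A, of ?c] show ?thesis by (simp add: E_def)
  qed
  then have "mean_le p (1 - (1 - r1) / 2 ^ ?n) (E * A) ((radial ^^ ?n) (\<lambda>z. radial f z + ?c * f z))"
    by (subst mean_le_cong[OF eq r3])
  then have "mean_le p r1 (?P * (E * A)) (partials js (\<lambda>z. radial f z + ?c * f z))"
    using A E by (intro Cons.IH hol_linear hol_radial f r1) auto
  then have "mean_le p r1 (?P * (E * A)) (radial (partials js f))"
    using r1 radial_partials[OF f, of _ js] by (subst mean_le_cong) auto
  then have "mean_le p r ((8 * real CARD('N) + 16) * (?P * (E * A))) (partial_deriv j (partials js f))"
    using P E A unfolding r1_def by (intro mean_le_partial_deriv p hol_partials f r) auto
  then show ?case by (simp add: E_def mult.assoc)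
qed simp

section \<open>The weighted inequality\<close>

lemma enn_powr_ennreal: "0 \<le> a \<Longrightarrow> enn_powr (ennreal a) q = ennreal (a powr q)"
  by (simp add: enn_powr_def)

lemma enn_powr_mono:
  assumes "x \<le> ennreal a" "0 \<le> a" "0 \<le> q"
  shows "enn_powr x q \<le> ennreal (a powr q)"
proof (cases x)
  case (real b)
  then have "b \<le> a" using assms by (simp add: ennreal_le_iff)
  then show ?thesis using real assms by (auto simp: enn_powr_ennreal intro!: ennreal_leI powr_mono2)
next
  case top
  then show ?thesis using assms by (simp add: top_unique)
qed

lemma norm_le_sum:
  fixes u :: "'i \<Rightarrow> complex ^ 'N \<Rightarrow> real"
  assumes p: "1 \<le> p" and A: "0 \<le> A" and "finite I"
    and "\<And>i. i \<in> I \<Longrightarrow> norm_le p A (u i)" "\<And>i. i \<in> I \<Longrightarrow> u i \<in> borel_measurable sphere_measure"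
    and "\<And>i \<zeta>. i \<in> I \<Longrightarrow> norm \<zeta> = 1 \<Longrightarrow> 0 \<le> u i \<zeta>"
  shows "norm_le p (4 ^ card I * A) (\<lambda>\<zeta>. \<Sum>i\<in>I. u i \<zeta>)"
  using assms(3-)
proof (induction I rule: finite_induct)
  case empty
  then show ?case using A by (simp add: norm_le_def)
next
  case (insert i I)
  have "norm_le p (2 * (A + 4 ^ card I * A)) (\<lambda>\<zeta>. u i \<zeta> + (\<Sum>i\<in>I. u i \<zeta>))"
    using insert A by (intro norm_le_add p) (auto intro!: sum_nonneg)
  then have "norm_le p (4 ^ card (insert i I) * A) (\<lambda>\<zeta>. u i \<zeta> + (\<Sum>i\<in>I. u i \<zeta>))"
  proof (rule norm_le_mono)
    fix \<zeta> :: "complex ^ 'N" assume "norm \<zeta> = 1"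
    then have "0 \<le> u i \<zeta> + (\<Sum>i\<in>I. u i \<zeta>)" using insert by (auto intro!: sum_nonneg add_nonneg_nonneg)
    then show "0 \<le> u i \<zeta> + (\<Sum>i\<in>I. u i \<zeta>) \<and> u i \<zeta> + (\<Sum>i\<in>I. u i \<zeta>) \<le> u i \<zeta> + (\<Sum>i\<in>I. u i \<zeta>)" by simp
  next
    show "0 \<le> 2 * (A + 4 ^ card I * A)" using A by simp
    have "1 * A \<le> 4 ^ card I * A" using A by (intro mult_right_mono) auto
    then show "2 * (A + 4 ^ card I * A) \<le> 4 ^ card (insert i I) * A"
      using insert(1,2) by (simp add: mult.commute)
  qed
  then show ?case using insert by simp
qed

definition gradient_const :: "'N itself \<Rightarrow> nat \<Rightarrow> real" where
  "gradient_const _ n = 4 ^ card {js :: 'N list. length js = n} * partials_const CARD('N) n"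

lemma gradient_const_pos: "0 < gradient_const TYPE('N) n"
  unfolding gradient_const_def by (intro mult_pos_pos partials_const_pos) auto

lemma int_mean_nth_gradient:
  fixes f :: "complex ^ 'N \<Rightarrow> complex"
  assumes p: "1 \<le> p" and f: "hol f" and r: "0 < r" "r < 1" and A: "0 \<le> A"
    and m: "mean_le p (1 - (1 - r) / 2 ^ Suc n) A ((radial ^^ n) f)"
  shows "int_mean p r (nth_gradient n f) \<le> ennreal (gradient_const TYPE('N) n * A)"
proof -
  define I where "I = {js :: 'N list. length js = n}"
  have fin: "finite I" unfolding I_def using finite_lists_length_eq[of "UNIV :: 'N set" n] by simp
  have c: "continuous_on (ball 0 1) (partials js f)" for js by (rule hol_continuous[OF hol_partials[OF f]])
  define B where "B = partials_const CARD('N) n * A"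
  have B: "0 \<le> B" unfolding B_def using A by (intro mult_nonneg_nonneg less_imp_le[OF partials_const_pos]) auto
  define r1 where "r1 = (1 + r) / 2"
  have r1: "r < r1" "r1 < 1" using r by (simp_all add: r1_def)
  have "1 - (1 - r) / 2 ^ Suc n = 1 - (1 - r1) / 2 ^ n" by (simp add: r1_def field_simps)
  then have "mean_le p r1 B (partials js f)" if "js \<in> I" for js
    using mean_le_partials[OF p f r1(2) A, of js] m that by (simp add: I_def B_def)
  then have "norm_le p B (\<lambda>\<zeta>. cmod (partials js f (r *\<^sub>R \<zeta>)))" if "js \<in> I" for js
    using that r r1 unfolding mean_le_def by simp
  then have "norm_le p (4 ^ card I * B) (\<lambda>\<zeta>. \<Sum>js\<in>I. cmod (partials js f (r *\<^sub>R \<zeta>)))"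
    using B by (intro norm_le_sum p fin measurable_mean c r) auto
  then have "norm_le p (4 ^ card I * B) (\<lambda>\<zeta>. norm (nth_gradient n f (r *\<^sub>R \<zeta>)))"
  proof (rule norm_le_mono)
    fix \<zeta> :: "complex ^ 'N"
    have "nth_gradient n f (r *\<^sub>R \<zeta>) = L2_set (\<lambda>js. cmod (partials js f (r *\<^sub>R \<zeta>))) I"
      by (simp add: nth_gradient_def L2_set_def I_def)
    then show "0 \<le> norm (nth_gradient n f (r *\<^sub>R \<zeta>)) \<and> norm (nth_gradient n f (r *\<^sub>R \<zeta>)) \<le> (\<Sum>js\<in>I. cmod (partials js f (r *\<^sub>R \<zeta>)))"
      using L2_set_le_sum[of I "\<lambda>js. cmod (partials js f (r *\<^sub>R \<zeta>))"] by (simp add: L2_set_nonneg)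
  qed (use B in auto)
  moreover have "continuous_on (ball 0 1) (nth_gradient n f)"
    unfolding nth_gradient_def[abs_def] by (intro continuous_intros c)
  moreover have "gradient_const TYPE('N) n * A = 4 ^ card I * B"
    by (simp add: gradient_const_def I_def B_def mult.assoc)
  ultimately show ?thesis using B r by (simp add: int_mean_le_iff[OF p])
qed

definition sup_mean :: "ennreal \<Rightarrow> (complex ^ 'N \<Rightarrow> complex) \<Rightarrow> real \<Rightarrow> ennreal" where
  "sup_mean p u r = (SUP \<rho>\<in>{0<..<r}. int_mean p \<rho> u)"

lemma sup_mean_le_iff:
  assumes "1 \<le> p" "continuous_on (ball 0 1) u" "r \<le> 1" "0 \<le> A"
  shows "sup_mean p u r \<le> ennreal A \<longleftrightarrow> mean_le p r A u"
proof -
  have "int_mean p \<rho> u \<le> ennreal A \<longleftrightarrow> norm_le p A (\<lambda>\<zeta>. cmod (u (\<rho> *\<^sub>R \<zeta>)))" if "\<rho> \<in> {0<..<r}" for \<rho>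
    using that assms by (intro int_mean_le_iff) auto
  then show ?thesis unfolding sup_mean_def SUP_le_iff mean_le_def by auto
qed

lemma sup_mean_mono: "r \<le> s \<Longrightarrow> sup_mean p u r \<le> sup_mean p u s"
  unfolding sup_mean_def by (intro SUP_subset_mono) auto

lemma sup_mean_finite:
  fixes u :: "complex ^ 'N \<Rightarrow> complex"
  assumes p: "1 \<le> p" and u: "continuous_on (ball 0 1) u" and r: "r < 1"
  shows "sup_mean p u r < \<infinity>"
proof -
  have "compact (u ` cball 0 r)"
    using r by (intro compact_continuous_image continuous_on_subset[OF u]) auto
  then obtain B where B: "B > 0" "\<And>z. z \<in> cball 0 r \<Longrightarrow> cmod (u z) \<le> B"
    using bounded_pos[of "u ` cball 0 r"] compact_imp_bounded by auto
  interpret S: prob_space "sphere_measure :: (complex ^ 'N) measure" by (rule prob_space_sphere_measure)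
  have "mean_le p r B u" unfolding mean_le_def
  proof (intro allI impI)
    fix \<rho> assume rho: "0 < \<rho>" "\<rho> < r"
    have le: "cmod (u (\<rho> *\<^sub>R \<zeta>)) \<le> B" if "norm \<zeta> = 1" for \<zeta> using that rho by (intro B) simp
    show "norm_le p B (\<lambda>\<zeta>. cmod (u (\<rho> *\<^sub>R \<zeta>)))"
    proof (cases "p = \<infinity>")
      case False
      have "(\<integral>\<^sup>+\<zeta>. ennreal (cmod (u (\<rho> *\<^sub>R \<zeta>)) powr enn2real p) \<partial>sphere_measure)
          \<le> (\<integral>\<^sup>+\<zeta>. ennreal (B powr enn2real p) \<partial>(sphere_measure :: (complex ^ 'N) measure))"
        using le by (intro nn_integral_sphere_mono ennreal_leI powr_mono2) auto
      then show ?thesis using False by (simp add: norm_le_def S.emeasure_space_1)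
    qed (use le in \<open>simp add: norm_le_def\<close>)
  qed
  then have "sup_mean p u r \<le> ennreal B" using B p u r by (subst sup_mean_le_iff) auto
  also have "\<dots> < \<infinity>" by simp
  finally show ?thesis .
qed

lemma sup_mean_measurable:
  assumes "1 \<le> p" "continuous_on (ball 0 1) u" "\<delta> < 1"
  shows "(\<lambda>r. enn2real (sup_mean p u (min \<delta> r))) \<in> borel_measurable borel"
proof (rule borel_measurable_mono, rule monoI)
  fix r s :: real assume "r \<le> s"
  moreover have "sup_mean p u (min \<delta> s) < \<infinity>" using assms by (intro sup_mean_finite) auto
  ultimately show "enn2real (sup_mean p u (min \<delta> r)) \<le> enn2real (sup_mean p u (min \<delta> s))"
    by (intro enn2real_mono sup_mean_mono) auto
qed

abbreviation weighted_integral :: "(real \<Rightarrow> real) \<Rightarrow> (real \<Rightarrow> ennreal) \<Rightarrow> ennreal" where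
  "weighted_integral \<phi> F \<equiv> \<integral>\<^sup>+x. F x * ennreal (\<phi> x) \<partial>lebesgue"

text \<open>
  A weight on the unit interval, extended by zero to the real line; the doubling inequality then
  holds at every point.
\<close>
definition doubling_weight :: "real \<Rightarrow> (real \<Rightarrow> real) \<Rightarrow> bool" where
  "doubling_weight K \<phi> \<longleftrightarrow> \<phi> \<in> borel_measurable lebesgue \<and> (\<forall>x. 0 \<le> \<phi> x) \<and> (\<forall>x. \<phi> (2 * x) \<le> K * \<phi> x)
     \<and> (\<forall>x. x \<notin> {0<..<1} \<longrightarrow> \<phi> x = 0) \<and> weighted_integral \<phi> (\<lambda>_. 1) < \<infinity>"

text \<open>
  The substitution \<open>x \<mapsto> 2 x\<close>, repeated \<open>m\<close> times.
\<close>
lemma nn_integral_doubling: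
  fixes \<phi> :: "real \<Rightarrow> real"
  assumes K: "0 < K" and w: "doubling_weight K \<phi>"
  shows "F \<in> borel_measurable lebesgue \<Longrightarrow>
    weighted_integral \<phi> F \<le> ennreal ((2 * K) ^ m) * weighted_integral \<phi> (\<lambda>x. F (2 ^ m * x))"
proof (induction m arbitrary: F)
  case (Suc m)
  note F [measurable] = Suc.prems
  have [measurable]: "\<phi> \<in> borel_measurable lebesgue" and phi0: "\<And>x. 0 \<le> \<phi> x" and dbl: "\<And>x. \<phi> (2 * x) \<le> K * \<phi> x"
    using w by (auto simp: doubling_weight_def)
  have F2 [measurable]: "(\<lambda>x. F (c * x)) \<in> borel_measurable lebesgue" for c :: real
    using measurable_compose[OF lebesgue_measurable_scaling[of c] F] by simp
  have "weighted_integral \<phi> (\<lambda>x. F x) = ennreal 2 * (\<integral>\<^sup>+x. F (2 * x) * ennreal (\<phi> (2 * x)) \<partial>lebesgue)"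
    using nn_integral_real_affine_lebesgue[of "\<lambda>x. F x * ennreal (\<phi> x)" 2 0] F by simp
  also have "\<dots> \<le> ennreal 2 * (\<integral>\<^sup>+x. ennreal K * (F (2 * x) * ennreal (\<phi> x)) \<partial>lebesgue)"
  proof (intro mult_left_mono nn_integral_mono)
    fix x
    have "ennreal (\<phi> (2 * x)) \<le> ennreal K * ennreal (\<phi> x)"
      using dbl[of x] phi0 K by (simp add: ennreal_mult[symmetric] ennreal_leI)
    then have "F (2 * x) * ennreal (\<phi> (2 * x)) \<le> F (2 * x) * (ennreal K * ennreal (\<phi> x))"
      by (rule mult_left_mono) simp
    then show "F (2 * x) * ennreal (\<phi> (2 * x)) \<le> ennreal K * (F (2 * x) * ennreal (\<phi> x))"
      by (simp only: mult.left_commute)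
  qed simp
  also have "\<dots> = ennreal (2 * K) * weighted_integral \<phi> (\<lambda>x. F (2 * x))"
    using K by (subst nn_integral_cmult) (auto simp: ennreal_mult mult.assoc)
  also have "\<dots> \<le> ennreal (2 * K) * (ennreal ((2 * K) ^ m) * weighted_integral \<phi> (\<lambda>x. F (2 * (2 ^ m * x))))"
    by (intro mult_left_mono Suc.IH[OF F2]) simp
  also have "\<dots> = ennreal ((2 * K) ^ Suc m) * weighted_integral \<phi> (\<lambda>x. F (2 ^ Suc m * x))"
    using K by (simp add: ennreal_mult mult.assoc)
  finally show ?case .
qed simp

definition diff_quotient_power :: "ennreal \<Rightarrow> real \<Rightarrow> nat \<Rightarrow> (complex ^ 'N \<Rightarrow> complex) \<Rightarrow> real \<Rightarrow> ennreal" where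
  "diff_quotient_power p q n f t = enn_powr (hardy_norm p (rot_diff_iter n t f) / ennreal (t ^ n)) q"

text \<open>
  The supremum of the means at radii below \<open>\<delta> (1 - x)\<close>, where \<open>x\<close> is the distance to the sphere before
  shrinking. The minimum with \<open>\<delta>\<close> only matters for negative \<open>x\<close>: it makes the value finite, hence
  monotone in \<open>x\<close> and Borel, on the whole line.
\<close>
definition shrunk_mean :: "ennreal \<Rightarrow> (complex ^ 'N \<Rightarrow> complex) \<Rightarrow> real \<Rightarrow> real \<Rightarrow> real" where
  "shrunk_mean p u \<delta> x = enn2real (sup_mean p u (min \<delta> (\<delta> * (1 - x))))"

lemma shrunk_mean_nonneg: "0 \<le> shrunk_mean p u \<delta> x"
  by (simp add: shrunk_mean_def)

lemma shrunk_mean_measurable: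
  assumes "1 \<le> p" "continuous_on (ball 0 1) u" "\<delta> < 1"
  shows "shrunk_mean p u \<delta> \<in> borel_measurable borel"
proof -
  have [measurable]: "(\<lambda>r. enn2real (sup_mean p u (min \<delta> r))) \<in> borel_measurable borel"
    by (rule sup_mean_measurable[OF assms])
  show ?thesis unfolding shrunk_mean_def[abs_def] by measurable
qed

lemma shrunk_mean_le:
  assumes "1 \<le> p" "continuous_on (ball 0 1) u" "\<delta> \<le> \<epsilon>" "\<epsilon> < 1"
    "min \<delta> (\<delta> * (1 - x)) \<le> min \<epsilon> (\<epsilon> * (1 - y))"
  shows "shrunk_mean p u \<delta> x \<le> shrunk_mean p u \<epsilon> y"
proof -
  have "sup_mean p u (min \<epsilon> (\<epsilon> * (1 - y))) < \<infinity>" using assms by (intro sup_mean_finite) auto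
  then show ?thesis unfolding shrunk_mean_def using assms by (intro enn2real_mono sup_mean_mono) auto
qed

lemma mean_le_shrunk_mean:
  assumes "1 \<le> p" "continuous_on (ball 0 1) u" "0 < \<delta>" "\<delta> < 1" "0 \<le> x"
  shows "mean_le p (\<delta> * (1 - x)) (shrunk_mean p u \<delta> x) u"
proof -
  have le: "\<delta> * (1 - x) \<le> \<delta>" using assms by (simp add: mult_le_cancel_left2)
  have lt: "\<delta> * (1 - x) < 1" using le assms(4) by (rule le_less_trans)
  have "sup_mean p u (\<delta> * (1 - x)) < \<infinity>" by (rule sup_mean_finite[OF assms(1,2) lt])
  then have "sup_mean p u (\<delta> * (1 - x)) \<le> ennreal (shrunk_mean p u \<delta> x)"
    using le by (simp add: shrunk_mean_def min_absorb2)
  then show ?thesis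
    by (simp only: sup_mean_le_iff[OF assms(1,2) less_imp_le[OF lt] shrunk_mean_nonneg])
qed

text \<open>
  The absorption inequality at radius \<open>\<delta> (1 - x)\<close> with \<open>e = x / 2\<close>, which leads to radius \<open>\<delta> (1 - x / 2)\<close>.
\<close>
lemma shrunk_mean_absorption:
  fixes f :: "complex ^ 'N \<Rightarrow> complex"
  assumes p: "1 \<le> p" and f: "hol f" and x: "0 < x" "x < 1" and y: "0 < y" and de: "0 < \<delta>" "\<delta> < 1" and d: "0 \<le> d"
    and D: "hardy_norm p (rot_diff_iter n y f) \<le> ennreal d"
  shows "shrunk_mean p ((radial ^^ n) f) \<delta> x
    \<le> 2 * (1 + taylor_const n) * (d / y ^ n + 2 * (y / x) * shrunk_mean p ((radial ^^ n) f) \<delta> (x / 2))"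
proof -
  let ?u = "(radial ^^ n) f" and ?C = "2 * (1 + taylor_const n)"
  define r where "r = \<delta> * (1 - x)"
  define W where "W = shrunk_mean p ?u \<delta> (x / 2)"
  have W: "0 \<le> W" by (simp add: W_def shrunk_mean_nonneg)
  have u: "continuous_on (ball 0 1) ?u" by (rule hol_continuous[OF hol_radial_pow[OF f]])
  have le: "r \<le> \<delta>" "\<delta> * (1 - x / 2) \<le> \<delta>" unfolding r_def using x de by (simp_all add: mult_le_cancel_left2)
  have r: "0 \<le> r" "r < 1" using x de le_less_trans[OF le(1) de(2)] by (simp_all add: r_def)
  have er: "(1 + x / 2) * r \<le> \<delta> * (1 - x / 2)"
  proof -
    have "(1 + x / 2) * (1 - x) = 1 - x / 2 - x * x / 2" by (simp add: field_simps)
    also have "\<dots> \<le> 1 - x / 2" using x by simp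
    finally have "\<delta> * ((1 + x / 2) * (1 - x)) \<le> \<delta> * (1 - x / 2)" using de by (intro mult_left_mono) auto
    then show ?thesis by (simp add: r_def mult.left_commute)
  qed
  have "mean_le p (\<delta> * (1 - x / 2)) W ?u"
    unfolding W_def using x by (intro mean_le_shrunk_mean p u de) auto
  then have mW: "mean_le p ((1 + x / 2) * r) W ?u" by (rule mean_le_mono[OF _ er W]) simp
  have mD: "mean_le p r d ((rot_diff y ^^ n) f)" unfolding mean_le_def
  proof (intro allI impI)
    fix \<rho> assume rho: "0 < \<rho>" "\<rho> < r"
    have "int_mean p \<rho> (rot_diff_iter n y f) \<le> hardy_norm p (rot_diff_iter n y f)"
      unfolding hardy_norm_def using rho r by (intro SUP_upper) auto
    also note D
    finally have "int_mean p \<rho> (rot_diff_iter n y f) \<le> ennreal d" .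
    then show "norm_le p d (\<lambda>\<zeta>. cmod ((rot_diff y ^^ n) f (\<rho> *\<^sub>R \<zeta>)))"
      unfolding rot_diff_iter_def using rho r d
      by (subst (asm) int_mean_le_iff[OF p hol_continuous[OF hol_rot_diff_pow[OF f]]]) auto
  qed
  have "mean_le p r (?C * (d / y ^ n + y / (x / 2) * W)) ?u"
    using x order_trans[OF er order_trans[OF le(2) less_imp_le[OF de(2)]]]
    by (intro radial_pow_absorption p f y d r W mW mD) auto
  then have m: "mean_le p r (?C * (d / y ^ n + 2 * (y / x) * W)) ?u" by (simp add: mult.commute)
  have nn: "0 \<le> ?C * (d / y ^ n + 2 * (y / x) * W)"
    using taylor_const_nonneg[of n] d x y W by (intro mult_nonneg_nonneg add_nonneg_nonneg) auto
  have "sup_mean p ?u (min \<delta> r) \<le> ennreal (?C * (d / y ^ n + 2 * (y / x) * W))"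
    unfolding min_absorb2[OF le(1)] using m nn r by (subst sup_mean_le_iff[OF p u]) auto
  then show ?thesis
    unfolding shrunk_mean_def[of p ?u \<delta> x] r_def[symmetric] W_def[symmetric]
    using nn by (metis enn2real_ennreal enn2real_mono ennreal_less_top)
qed

text \<open>
  Apply the absorption inequality with \<open>y = x / 2\<^sup>m\<close>. The term at \<open>x / 2\<close> has the coefficient \<open>2 / 2\<^sup>m\<close>, and the
  substitution \<open>x \<mapsto> 2 x\<close> costs the factor \<open>2 K\<close>; for large \<open>m\<close> it is at most half of the left-hand side, which
  is finite because \<open>\<delta> < 1\<close> bounds the integrand. The other term becomes the integral of the
  difference quotients after \<open>m\<close> further substitutions.
\<close>
lemma weighted_integral_shrunk_mean_le:
  fixes q K :: real
  assumes p: "1 \<le> p" and q: "1 \<le> q" and K: "0 < K"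
  shows "\<exists>C>0. \<forall>(f :: complex ^ 'N \<Rightarrow> complex) \<phi> \<delta>. hol f \<longrightarrow> doubling_weight K \<phi> \<longrightarrow> 0 < \<delta> \<longrightarrow> \<delta> < 1 \<longrightarrow>
     weighted_integral \<phi> (\<lambda>x. ennreal (shrunk_mean p ((radial ^^ n) f) \<delta> x powr q))
     \<le> ennreal C * weighted_integral \<phi> (diff_quotient_power p q n f)"
proof -
  define C where "C = 2 * (1 + taylor_const n)"
  have C: "C > 0" unfolding C_def using taylor_const_nonneg[of n] by simp
  define B where "B = C powr q * 2 powr q"
  have B: "B > 0" using C by (simp add: B_def)
  \<comment> \<open>The number of halvings that makes the absorbed term at most half of the left-hand side.\<close>
  obtain m where m: "B * (2 / 2 ^ m) powr q * (2 * K) \<le> 1 / 2"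
  proof -
    have "\<exists>m. (1 / 2 :: real) ^ m < 1 / (8 * (B * K) + 8)"
      using B K by (intro real_arch_pow_inv) (auto intro!: divide_pos_pos add_pos_pos)
    then obtain m where m: "(1 / 2 :: real) ^ m < 1 / (8 * (B * K) + 8)" ..
    have pos: "0 < 8 * (B * K) + 8" using B K by (intro add_pos_pos) auto
    have *: "2 / 2 ^ m = 2 * (1 / 2 :: real) ^ m" by (simp add: power_divide)
    have e1: "2 / 2 ^ m \<le> 2 / (8 * (B * K) + 8)" using m unfolding * by simp
    have "2 / (8 * (B * K) + 8) \<le> 1" using pos B K by (simp add: divide_le_eq)
    then have "2 / 2 ^ m \<le> (1 :: real)" using e1 by linarith
    then have "(2 / 2 ^ m) powr q \<le> (2 / 2 ^ m :: real) powr 1"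
      using q by (intro powr_mono') auto
    then have "(2 / 2 ^ m) powr q \<le> 2 / (8 * (B * K) + 8)" using e1 by simp
    then have "B * (2 / 2 ^ m) powr q * (2 * K) \<le> B * (2 / (8 * (B * K) + 8)) * (2 * K)"
      using B K by (intro mult_right_mono mult_left_mono) auto
    also have "\<dots> = 4 * (B * K) / (8 * (B * K) + 8)" by simp
    also have "\<dots> \<le> 1 / 2" using pos by (simp add: divide_le_eq)
    finally show ?thesis by (rule that)
  qed
  define \<eta> where "\<eta> = B * (2 / 2 ^ m) powr q"
  have eta: "0 \<le> \<eta>" "\<eta> * (2 * K) \<le> 1 / 2" using B m by (auto simp: \<eta>_def)
  show ?thesis
  proof (intro exI[of _ "2 * ((2 * K) ^ m * B)"] conjI allI impI)
    show "0 < 2 * ((2 * K) ^ m * B)" using K B by simp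
    fix f :: "complex ^ 'N \<Rightarrow> complex" and \<phi> :: "real \<Rightarrow> real" and \<delta> :: real
    assume f: "hol f" and dw: "doubling_weight K \<phi>" and de: "0 < \<delta>" "\<delta> < 1"
    have phi [measurable]: "\<phi> \<in> borel_measurable lebesgue" and phi0: "\<And>x. 0 \<le> \<phi> x"
      and supp: "\<And>x. x \<notin> {0<..<1} \<Longrightarrow> \<phi> x = 0" and fin: "weighted_integral \<phi> (\<lambda>_. 1) < \<infinity>"
      using dw by (auto simp: doubling_weight_def)
    let ?u = "(radial ^^ n) f"
    have u: "continuous_on (ball 0 1) ?u" by (rule hol_continuous[OF hol_radial_pow[OF f]])
    define w where "w = shrunk_mean p ?u \<delta>"
    define T where "T = diff_quotient_power p q n f"
    have w0: "0 \<le> w x" for x by (simp add: w_def shrunk_mean_nonneg)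
    have [measurable]: "w \<in> borel_measurable borel" unfolding w_def by (rule shrunk_mean_measurable[OF p u de(2)])
    define I where "I x = w x powr q" for x
    have I_borel [measurable]: "I \<in> borel_measurable borel" unfolding I_def by measurable
    have I0: "0 \<le> I x" for x by (simp add: I_def)
    \<comment> \<open>The part of \<open>I\<close> that the difference quotients have to control. Integrating \<open>a\<close> in their place keeps
        the substitutions within measurable functions.\<close>
    define a where "a x = (if x \<in> {0<..<1} then max 0 (I x - \<eta> * I (x / 2)) else 0)" for x
    have a_borel [measurable]: "a \<in> borel_measurable borel" unfolding a_def by measurable
    have a0: "0 \<le> a x" for x by (simp add: a_def)
    have leb: "(\<lambda>x. g (c * x)) \<in> borel_measurable lebesgue" if [measurable]: "g \<in> borel_measurable borel"
      for g :: "real \<Rightarrow> real" and c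
    proof -
      have "(\<lambda>x. g (c * x)) \<in> borel_measurable borel" by measurable
      then show ?thesis by (simp add: measurable_completion)
    qed
    have wphi: "(\<lambda>x. ennreal (g x) * ennreal (\<phi> x)) \<in> borel_measurable lebesgue"
      if [measurable]: "g \<in> borel_measurable lebesgue" for g
      by measurable
    let ?L = "weighted_integral \<phi> (\<lambda>x. ennreal (I x))" and ?A = "weighted_integral \<phi> (\<lambda>x. ennreal (a x))"
    let ?T = "weighted_integral \<phi> T"
    have key: "ennreal (a (2 ^ m * y) / B) \<le> T y" for y
    proof (cases "2 ^ m * y \<in> {0<..<1} \<and> hardy_norm p (rot_diff_iter n y f) < \<infinity>")
      case True
      define x where "x = 2 ^ m * y"
      have x: "0 < x" "x < 1" using True by (auto simp: x_def)
      have y: "0 < y" using x unfolding x_def by (simp add: zero_less_mult_iff)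
      have yx: "y / x = 1 / 2 ^ m" using y by (simp add: x_def)
      define d where "d = enn2real (hardy_norm p (rot_diff_iter n y f))"
      have d: "0 \<le> d" "hardy_norm p (rot_diff_iter n y f) = ennreal d" using True by (simp_all add: d_def)
      have Ty: "T y = ennreal ((d / y ^ n) powr q)"
        unfolding T_def diff_quotient_power_def d(2) using y d(1) by (simp add: divide_ennreal enn_powr_ennreal)
      have "w x \<le> C * (d / y ^ n + 2 * (y / x) * w (x / 2))"
        unfolding w_def C_def using d by (intro shrunk_mean_absorption p f x y de) auto
      then have "I x \<le> (C * (d / y ^ n + 2 / 2 ^ m * w (x / 2))) powr q"
        unfolding I_def yx using q w0 by (intro powr_mono2) auto
      also have "\<dots> = C powr q * (d / y ^ n + 2 / 2 ^ m * w (x / 2)) powr q"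
        using C d y w0 by (intro powr_mult) 
      also have "\<dots> \<le> C powr q * (2 powr q * ((d / y ^ n) powr q + (2 / 2 ^ m * w (x / 2)) powr q))"
        using q d y w0 by (intro mult_left_mono powr_add_le) auto
      also have "(2 / 2 ^ m * w (x / 2)) powr q = (2 / 2 ^ m) powr q * I (x / 2)"
        unfolding I_def using w0 by (intro powr_mult) 
      finally have "I x \<le> B * (d / y ^ n) powr q + \<eta> * I (x / 2)"
        by (simp add: B_def \<eta>_def algebra_simps)
      then have "a x \<le> B * (d / y ^ n) powr q" using B by (simp add: a_def)
      then have "a x / B \<le> (d / y ^ n) powr q" using B by (simp add: divide_le_eq mult.commute)
      then show ?thesis unfolding Ty x_def[symmetric] by (rule ennreal_leI)
    next
      case False
      then consider "2 ^ m * y \<notin> {0<..<1}" | "hardy_norm p (rot_diff_iter n y f) = \<infinity>"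
        by (metis infinity_ennreal_def top.not_eq_extremum)
      then show ?thesis
      proof cases
        case 1
        then have "a (2 ^ m * y) = 0" by (simp only: a_def if_False)
        then show ?thesis by simp
      next
        case 2
        then show ?thesis unfolding T_def diff_quotient_power_def 2 by (simp add: enn_powr_def ennreal_top_divide)
      qed
    qed
    have A: "?A \<le> ennreal ((2 * K) ^ m * B) * ?T"
    proof -
      have "?A \<le> ennreal ((2 * K) ^ m) * weighted_integral \<phi> (\<lambda>x. ennreal (a (2 ^ m * x)))"
        using leb[OF a_borel, of 1] by (intro nn_integral_doubling K dw) simp
      also have "weighted_integral \<phi> (\<lambda>x. ennreal (a (2 ^ m * x)))
          = (\<integral>\<^sup>+x. ennreal B * (ennreal (a (2 ^ m * x) / B) * ennreal (\<phi> x)) \<partial>lebesgue)"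
      proof (rule nn_integral_cong)
        fix x
        have "ennreal (a (2 ^ m * x)) = ennreal B * ennreal (a (2 ^ m * x) / B)"
          using B a0[of "2 ^ m * x"] by (simp add: ennreal_mult[symmetric])
        then show "ennreal (a (2 ^ m * x)) * ennreal (\<phi> x) = ennreal B * (ennreal (a (2 ^ m * x) / B) * ennreal (\<phi> x))"
          by (simp only: mult.assoc)
      qed
      also have "\<dots> = ennreal B * weighted_integral \<phi> (\<lambda>x. ennreal (a (2 ^ m * x) / B))"
      proof (rule nn_integral_cmult)
        have "(\<lambda>x. a x / B) \<in> borel_measurable borel" by measurable
        from leb[OF this] show "(\<lambda>x. ennreal (a (2 ^ m * x) / B) * ennreal (\<phi> x)) \<in> borel_measurable lebesgue"
          by (rule wphi)
      qed
      also have "weighted_integral \<phi> (\<lambda>x. ennreal (a (2 ^ m * x) / B)) \<le> ?T"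
        by (intro nn_integral_mono mult_right_mono key) simp
      also have "ennreal ((2 * K) ^ m) * (ennreal B * ?T) = ennreal ((2 * K) ^ m * B) * ?T"
        using B K by (simp add: ennreal_mult mult.assoc)
      finally show ?thesis by (simp add: mult_left_mono)
    qed
    have L1: "?L \<le> ?A + ennreal \<eta> * weighted_integral \<phi> (\<lambda>x. ennreal (I (x / 2)))"
    proof -
      have m2: "(\<lambda>x. ennreal (I (x / 2)) * ennreal (\<phi> x)) \<in> borel_measurable lebesgue"
        using leb[OF I_borel, of "1 / 2"] by (intro wphi) simp
      have m1: "(\<lambda>x. ennreal (a x) * ennreal (\<phi> x)) \<in> borel_measurable lebesgue"
        using leb[OF a_borel, of 1] by (intro wphi) simp
      have "?L \<le> (\<integral>\<^sup>+x. ennreal (a x) * ennreal (\<phi> x) + ennreal \<eta> * (ennreal (I (x / 2)) * ennreal (\<phi> x)) \<partial>lebesgue)"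
      proof (rule nn_integral_mono)
        fix x
        show "ennreal (I x) * ennreal (\<phi> x) \<le> ennreal (a x) * ennreal (\<phi> x) + ennreal \<eta> * (ennreal (I (x / 2)) * ennreal (\<phi> x))"
        proof (cases "x \<in> {0<..<1}")
          case True
          have "I x \<le> a x + \<eta> * I (x / 2)" using True by (simp add: a_def)
          then have "ennreal (I x) \<le> ennreal (a x + \<eta> * I (x / 2))" by (rule ennreal_leI)
          also have "\<dots> = ennreal (a x) + ennreal \<eta> * ennreal (I (x / 2))"
            using a0[of x] eta I0[of "x / 2"] by (simp add: ennreal_mult)
          finally have "ennreal (I x) * ennreal (\<phi> x) \<le> (ennreal (a x) + ennreal \<eta> * ennreal (I (x / 2))) * ennreal (\<phi> x)"
            by (rule mult_right_mono) simp
          then show ?thesis by (simp only: distrib_right mult.assoc)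
        qed (use supp in simp)
      qed
      also have "\<dots> = ?A + ennreal \<eta> * weighted_integral \<phi> (\<lambda>x. ennreal (I (x / 2)))"
        using m1 m2 by (subst nn_integral_add) (auto simp: nn_integral_cmult)
      finally show ?thesis .
    qed
    have L2: "weighted_integral \<phi> (\<lambda>x. ennreal (I (x / 2))) \<le> ennreal (2 * K) * ?L"
    proof -
      have "(\<lambda>x. ennreal (I (x / 2))) \<in> borel_measurable lebesgue"
        using leb[OF I_borel, of "1 / 2"] by (intro measurable_compose[OF _ measurable_ennreal]) simp
      from nn_integral_doubling[OF K dw this, of 1] show ?thesis by simp
    qed
    have Lfin: "?L < \<infinity>"
    proof -
      have "?L \<le> weighted_integral \<phi> (\<lambda>x. ennreal (w 0 powr q))"
      proof (rule nn_integral_mono)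
        fix x
        show "ennreal (I x) * ennreal (\<phi> x) \<le> ennreal (w 0 powr q) * ennreal (\<phi> x)"
        proof (cases "x \<in> {0<..<1}")
          case True
          have "w x \<le> w 0" unfolding w_def
            using True de by (intro shrunk_mean_le p u) (auto simp: mult_le_cancel_left2)
          then have "I x \<le> w 0 powr q" unfolding I_def using w0 q by (intro powr_mono2) auto
          then show ?thesis by (intro mult_right_mono ennreal_leI) auto
        qed (use supp in simp)
      qed
      also have "\<dots> = ennreal (w 0 powr q) * weighted_integral \<phi> (\<lambda>_. 1)"
        by (simp add: nn_integral_cmult)
      also have "\<dots> < \<infinity>" using fin by (simp add: ennreal_mult_less_top)
      finally show ?thesis .
    qed
    then obtain l where l: "0 \<le> l" "?L = ennreal l" by (cases ?L) auto
    have "ennreal \<eta> * (ennreal (2 * K) * ?L) = ennreal (\<eta> * (2 * K) * l)"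
      unfolding l(2) using eta K l by (simp add: ennreal_mult mult.assoc)
    also have "\<dots> \<le> ennreal (l / 2)"
      using mult_right_mono[OF eta(2) l(1)] by (intro ennreal_leI) simp
    finally have half: "ennreal \<eta> * (ennreal (2 * K) * ?L) \<le> ennreal (l / 2)" .
    have "?L \<le> ?A + ennreal \<eta> * weighted_integral \<phi> (\<lambda>x. ennreal (I (x / 2)))" by (rule L1)
    also have "\<dots> \<le> ?A + ennreal \<eta> * (ennreal (2 * K) * ?L)"
      by (intro add_left_mono mult_left_mono L2) simp
    also have "\<dots> \<le> ?A + ennreal (l / 2)" by (intro add_left_mono half)
    finally have LA: "ennreal l \<le> ?A + ennreal (l / 2)" unfolding l(2) .
    have "?L \<le> ennreal 2 * ?A"
    proof (cases ?A)
      case (real \<alpha>)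
      have "ennreal l \<le> ennreal (\<alpha> + l / 2)" using LA real l by simp
      then have "l \<le> 2 * \<alpha>" using real l by (simp add: ennreal_le_iff del: ennreal_plus)
      then show ?thesis unfolding l(2) real(2) using real(1) by (simp only: ennreal_mult[symmetric] ennreal_leI zero_le_numeral)
    next
      case top
      then show ?thesis by (simp add: ennreal_mult_top)
    qed
    also have "\<dots> \<le> ennreal 2 * (ennreal ((2 * K) ^ m * B) * ?T)" by (intro mult_left_mono A) simp
    also have "\<dots> = ennreal (2 * ((2 * K) ^ m * B)) * ?T"
      using K B by (simp add: ennreal_mult mult.assoc)
    finally show "weighted_integral \<phi> (\<lambda>x. ennreal (shrunk_mean p ?u \<delta> x powr q))
        \<le> ennreal (2 * ((2 * K) ^ m * B)) * weighted_integral \<phi> (diff_quotient_power p q n f)"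
      unfolding I_def w_def T_def .
  qed
qed

lemma exhaustion_index:
  fixes b :: real
  assumes "b < 1"
  obtains k where "b \<le> 1 - 1 / (real k + 2)"
proof -
  obtain k where k: "inverse (real (Suc k)) < 1 - b" using reals_Archimedean[of "1 - b"] assms by auto
  have "1 / (real k + 2) \<le> inverse (real (Suc k))" by (simp add: field_simps)
  then show ?thesis using k by (intro that[of k]) simp
qed

theorem theorem1p5:
  fixes n :: nat and p :: ennreal and q K :: real
  assumes "n \<ge> 1" and "1 \<le> p" and "1 \<le> q" and "K > 0"
  shows "\<exists>C::real. C > 0 \<and>
    (\<forall>(f :: complex ^ 'N \<Rightarrow> complex) (\<psi> :: real \<Rightarrow> real).
       f \<in> hardy_space p \<longrightarrow>
       set_integrable lebesgue {0<..<1} \<psi> \<longrightarrow>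
       (\<forall>x\<in>{0<..<1}. \<psi> x \<ge> 0) \<longrightarrow>
       (\<forall>x\<in>{0<..<1/2}. \<psi> (2 * x) \<le> K * \<psi> x) \<longrightarrow>
       (\<integral>\<^sup>+r\<in>{0<..<1}. (enn_powr (int_mean p r (nth_gradient n f)) q * ennreal (\<psi> (1 - r))) \<partial>lebesgue)
       \<le> ennreal C *
         (\<integral>\<^sup>+t\<in>{0<..<1}. (enn_powr (hardy_norm p (rot_diff_iter n t f) / ennreal (t ^ n)) q
              * ennreal (\<psi> t)) \<partial>lebesgue))"
proof -
  note p = \<open>1 \<le> p\<close> and q = \<open>1 \<le> q\<close> and K = \<open>K > 0\<close>
  obtain C where C: "C > 0" and main: "\<And>(f :: complex ^ 'N \<Rightarrow> complex) \<phi> \<delta>. hol f \<Longrightarrow> doubling_weight K \<phi> \<Longrightarrow> 0 < \<delta> \<Longrightarrow> \<delta> < 1 \<Longrightarrow>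
     weighted_integral \<phi> (\<lambda>x. ennreal (shrunk_mean p ((radial ^^ n) f) \<delta> x powr q))
     \<le> ennreal C * weighted_integral \<phi> (diff_quotient_power p q n f)"
    using weighted_integral_shrunk_mean_le[OF p q K, of n] by blast
  define D where "D = gradient_const TYPE('N) n"
  have D: "D > 0" unfolding D_def by (rule gradient_const_pos)
  \<comment> \<open>The distance to the sphere is halved \<open>n\<close> times by the \<open>n\<close> derivatives, once to include the radius \<open>r\<close>
      itself, and once to make room for the factors \<open>\<delta> k\<close> below.\<close>
  define m where "m = Suc (Suc n)"
  show ?thesis
  proof (intro exI[of _ "D powr q * ((2 * K) ^ m * C)"] conjI allI impI)
    show "0 < D powr q * ((2 * K) ^ m * C)" using C D K by simp
    fix f :: "complex ^ 'N \<Rightarrow> complex" and \<psi> :: "real \<Rightarrow> real"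
    assume "f \<in> hardy_space p" and psi: "set_integrable lebesgue {0<..<1} \<psi>"
      and psi0: "\<forall>x\<in>{0<..<1}. \<psi> x \<ge> 0" and dbl: "\<forall>x\<in>{0<..<1/2}. \<psi> (2 * x) \<le> K * \<psi> x"
    then have f: "hol f" by (simp add: hardy_space_def)
    let ?u = "(radial ^^ n) f"
    have u: "continuous_on (ball 0 1) ?u" by (rule hol_continuous[OF hol_radial_pow[OF f]])
    define \<phi> where "\<phi> x = indicator {0<..<1} x *\<^sub>R \<psi> x" for x :: real
    have int: "integrable lebesgue \<phi>" using psi by (simp add: set_integrable_def \<phi>_def[abs_def])
    then have phi [measurable]: "\<phi> \<in> borel_measurable lebesgue" by simp
    have phi0: "0 \<le> \<phi> x" for x using psi0 by (auto simp: \<phi>_def indicator_def)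
    have supp: "\<phi> x = 0" if "x \<notin> {0<..<1}" for x using that by (simp add: \<phi>_def)
    have "\<phi> (2 * x) \<le> K * \<phi> x" for x
    proof (cases "x \<in> {0<..<1/2}")
      case True
      then show ?thesis using dbl by (simp add: \<phi>_def)
    next
      case False
      then have "\<phi> (2 * x) = 0" by (intro supp) auto
      then show ?thesis using phi0[of x] K by simp
    qed
    moreover have "weighted_integral \<phi> (\<lambda>_. 1) < \<infinity>"
      using int phi0 by (simp add: integrable_iff_bounded)
    ultimately have dw: "doubling_weight K \<phi>"
      using phi phi0 supp by (simp add: doubling_weight_def)
    \<comment> \<open>Shrinking factors that increase to 1 and lie strictly between 0 and 1 for every \<open>k\<close>.\<close>
    define \<delta> where "\<delta> k = 1 - 1 / (real k + 2)" for k :: nat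
    have de: "0 < \<delta> k" "\<delta> k < 1" for k by (simp_all add: \<delta>_def field_simps)
    have de_mono: "\<delta> k \<le> \<delta> l" if "k \<le> l" for k l
      using that by (simp add: \<delta>_def frac_le)
    define I where "I k x = shrunk_mean p ?u (\<delta> k) x powr q" for k x
    have I_borel [measurable]: "I k \<in> borel_measurable borel" for k
      using shrunk_mean_measurable[OF p u de(2), of k] unfolding I_def by measurable
    define J where "J x = (SUP k. ennreal (I k x))" for x
    have J_leb: "(\<lambda>x. J (x / c)) \<in> borel_measurable lebesgue" for c
    proof -
      have "(\<lambda>x. J (x / c)) \<in> borel_measurable borel" unfolding J_def by measurable
      then show ?thesis by (simp add: measurable_completion)
    qed
    let ?R = "weighted_integral \<phi> (diff_quotient_power p q n f)"
    have J_int: "weighted_integral \<phi> J \<le> ennreal C * ?R"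
    proof -
      have I_leb [measurable]: "I k \<in> borel_measurable lebesgue" for k by (simp add: measurable_completion)
      have inc: "incseq (\<lambda>k x. ennreal (I k x) * ennreal (\<phi> x))"
      proof (intro monoI le_funI)
        fix k l :: nat and x :: real assume kl: "k \<le> l"
        show "ennreal (I k x) * ennreal (\<phi> x) \<le> ennreal (I l x) * ennreal (\<phi> x)"
        proof (cases "x \<in> {0<..<1}")
          case True
          have "\<delta> k * (1 - x) \<le> \<delta> l * (1 - x)" using True de_mono[OF kl] by (intro mult_right_mono) auto
          then have "shrunk_mean p ?u (\<delta> k) x \<le> shrunk_mean p ?u (\<delta> l) x"
            using de_mono[OF kl] de by (intro shrunk_mean_le p u) auto
          then have "I k x \<le> I l x" unfolding I_def using q shrunk_mean_nonneg by (intro powr_mono2) auto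
          then show ?thesis by (intro mult_right_mono ennreal_leI) auto
        qed (simp add: supp)
      qed
      have "weighted_integral \<phi> J = (\<integral>\<^sup>+x. (SUP k. ennreal (I k x) * ennreal (\<phi> x)) \<partial>lebesgue)"
        unfolding J_def by (intro nn_integral_cong SUP_mult_right_ennreal)
      also have "\<dots> = (SUP k. weighted_integral \<phi> (\<lambda>x. ennreal (I k x)))"
        by (rule nn_integral_monotone_convergence_SUP[OF inc]) measurable
      also have "\<dots> \<le> ennreal C * ?R"
        unfolding I_def by (intro SUP_least main f dw de)
      finally show ?thesis .
    qed
    have pw: "enn_powr (int_mean p r (nth_gradient n f)) q \<le> ennreal (D powr q) * J ((1 - r) / 2 ^ m)"
      if r: "0 < r" "r < 1" for r
    proof -
      define x where "x = (1 - r) / 2 ^ m"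
      have "2 ^ m \<ge> (1::real)" by simp
      then have "1 - r < 2 ^ m" using r by linarith
      then have x: "0 < x" "x < 1" using r by (simp_all add: x_def divide_less_eq)
      have x2: "(1 - r) / 2 ^ Suc n = 2 * x" by (simp add: x_def m_def field_simps)
      have "(1 - 2 * x) / (1 - x) < 1" using x by (simp add: divide_less_eq)
      then obtain k where "(1 - 2 * x) / (1 - x) \<le> \<delta> k" unfolding \<delta>_def by (rule exhaustion_index)
      then have k: "1 - 2 * x \<le> \<delta> k * (1 - x)" using x by (simp add: divide_le_eq)
      define A where "A = shrunk_mean p ?u (\<delta> k) x"
      have A0: "0 \<le> A" by (simp add: A_def shrunk_mean_nonneg)
      have "mean_le p (\<delta> k * (1 - x)) A ?u"
        unfolding A_def using x by (intro mean_le_shrunk_mean p u de) auto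
      then have "mean_le p (1 - (1 - r) / 2 ^ Suc n) A ?u"
        by (rule mean_le_mono) (use k A0 in \<open>auto simp only: x2\<close>)
      then have "int_mean p r (nth_gradient n f) \<le> ennreal (D * A)"
        unfolding D_def by (intro int_mean_nth_gradient p f r A0)
      then have "enn_powr (int_mean p r (nth_gradient n f)) q \<le> ennreal ((D * A) powr q)"
        using D A0 q by (intro enn_powr_mono) auto
      also have "(D * A) powr q = D powr q * I k x" unfolding I_def A_def[symmetric] using D A0 by (intro powr_mult)
      also have "ennreal (D powr q * I k x) = ennreal (D powr q) * ennreal (I k x)" by (rule ennreal_mult') simp
      also have "\<dots> \<le> ennreal (D powr q) * J x" unfolding J_def by (intro mult_left_mono SUP_upper) auto
      finally show ?thesis unfolding x_def .
    qed
    define G where "G x = ennreal (D powr q) * (J (x / 2 ^ m) * ennreal (\<phi> x))" for x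
    have JG: "(\<lambda>x. J (x / 2 ^ m) * ennreal (\<phi> x)) \<in> borel_measurable lebesgue"
      by (rule borel_measurable_times_ennreal[OF J_leb]) measurable
    then have G: "G \<in> borel_measurable lebesgue"
      unfolding G_def[abs_def] by (intro borel_measurable_times_ennreal[OF borel_measurable_const])
    have "(\<integral>\<^sup>+r\<in>{0<..<1}. (enn_powr (int_mean p r (nth_gradient n f)) q * ennreal (\<psi> (1 - r))) \<partial>lebesgue)
       \<le> (\<integral>\<^sup>+r. G (1 - r) \<partial>lebesgue)"
    proof (rule nn_integral_mono)
      fix r :: real
      show "enn_powr (int_mean p r (nth_gradient n f)) q * ennreal (\<psi> (1 - r)) * indicator {0<..<1} r \<le> G (1 - r)"
      proof (cases "r \<in> {0<..<1}")
        case True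
        then have "\<phi> (1 - r) = \<psi> (1 - r)" by (simp add: \<phi>_def)
        moreover have "enn_powr (int_mean p r (nth_gradient n f)) q * ennreal (\<psi> (1 - r))
            \<le> ennreal (D powr q) * J ((1 - r) / 2 ^ m) * ennreal (\<psi> (1 - r))"
          using True by (intro mult_right_mono pw) auto
        ultimately show ?thesis using True by (simp add: G_def mult.assoc)
      qed simp
    qed
    also have "\<dots> = (\<integral>\<^sup>+x. G x \<partial>lebesgue)"
      using nn_integral_real_affine_lebesgue[OF G, of "- 1" 1] by simp
    also have "\<dots> = ennreal (D powr q) * weighted_integral \<phi> (\<lambda>x. J (x / 2 ^ m))"
      unfolding G_def by (rule nn_integral_cmult[OF JG])
    also have "\<dots> \<le> ennreal (D powr q) * (ennreal ((2 * K) ^ m) * weighted_integral \<phi> J)"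
      using nn_integral_doubling[OF K dw J_leb, of "2 ^ m" m] by (intro mult_left_mono) simp_all
    also have "\<dots> \<le> ennreal (D powr q) * (ennreal ((2 * K) ^ m) * (ennreal C * ?R))"
      by (intro mult_left_mono J_int) simp_all
    also have "\<dots> = ennreal (D powr q * ((2 * K) ^ m * C)) * ?R"
      using D K C by (simp add: ennreal_mult mult.assoc)
    also have "?R = (\<integral>\<^sup>+t\<in>{0<..<1}. (enn_powr (hardy_norm p (rot_diff_iter n t f) / ennreal (t ^ n)) q
              * ennreal (\<psi> t)) \<partial>lebesgue)"
      unfolding diff_quotient_power_def by (intro nn_integral_cong) (auto simp: \<phi>_def indicator_def)
    finally show "(\<integral>\<^sup>+r\<in>{0<..<1}. (enn_powr (int_mean p r (nth_gradient n f)) q * ennreal (\<psi> (1 - r))) \<partial>lebesgue)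
       \<le> ennreal (D powr q * ((2 * K) ^ m * C)) *
         (\<integral>\<^sup>+t\<in>{0<..<1}. (enn_powr (hardy_norm p (rot_diff_iter n t f) / ennreal (t ^ n)) q
              * ennreal (\<psi> t)) \<partial>lebesgue)" .
  qed
qed

end
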